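(* Let $(V,\omega)$ be a $2n$-dimensional complex symplectic vector space, let $\Gamma$ be a finite subgroup of $\mathrm{Sp}(V)$, let $S$ be the set of symplectic reflections in $\Gamma$, let $t\in\mathbb{C}$, and let $\mathbf{c}:S\to\mathbb{C}$ be a $\Gamma$-invariant function. Let $A_{t,\mathbf{c}}$ be the corresponding symplectic reflection algebra, $Z_{t,\mathbf{c}}$ its centre, and $e=|\Gamma|^{-1}\sum_{\gamma\in\Gamma}\gamma\in\mathbb{C}\Gamma\subseteq A_{t,\mathbf{c}}$. (1) If $t=0$ then $Z_{0,\mathbf{c}}\cong eA_{0,\mathbf{c}}e$ (as algebras) and $A_{0,\mathbf{c}}$ is a finitely generated $Z_{0,\mathbf{c}}$-module, for all $\mathbf{c}$. (2) If $t\neq 0$ then $Z_{t,\mathbf{c}}=\mathbb{C}$, for all $\mathbf{c}$.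
   Context: An element $s\in\Gamma$ is a symplectic reflection if, in its action on $V$, $\mathrm{rank}(1-s)=2$. The set $S$ of symplectic reflections is closed under conjugation in $\Gamma$; a function $\mathbf{c}:S\to\mathbb{C}$, $s\mapsto c_s$, is $\Gamma$-invariant if it is constant on $\Gamma$-conjugacy classes. For $s\in S$ there is an $\omega$-orthogonal decomposition $V=\mathrm{Im}(1-s)\oplus\mathrm{Ker}(1-s)$; let $\omega_s$ be the skew-symmetric form on $V$ which has $\mathrm{Ker}(1-s)$ as its radical and coincides with $\omega$ on $\mathrm{Im}(1-s)$. The symplectic reflection algebra $A_{t,\mathbf{c}}$ is the $\mathbb{C}$-algebra generated by the vector space $V$ and the group $\Gamma$, with relations those of $\Gamma$ together with $$\gamma x\gamma^{-1}=\gamma(x),\qquad xy-yx=t\,\omega(x,y)1_\Gamma+\sum_{s\in S}c_s\,\omega_s(x,y)\,s$$ for all $x,y\in V$ and $\gamma\in\Gamma$. *)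

theory Defs
  imports Complex_Main "HOL-Algebra.QuotRing" "HOL-Algebra.Module" "HOL-Library.Poly_Mapping"
begin

subsection \<open>Symplectic vector spaces and symplectic reflections\<close>

definition bilinear_form :: "(complex \<Rightarrow> 'v::ab_group_add \<Rightarrow> 'v) \<Rightarrow> ('v \<Rightarrow> 'v \<Rightarrow> complex) \<Rightarrow> bool" where
  "bilinear_form scale w \<longleftrightarrow>
     (\<forall>x. Vector_Spaces.linear scale (*) (w x)) \<and>
     (\<forall>y. Vector_Spaces.linear scale (*) (\<lambda>x. w x y))"

definition skew_symmetric :: "('v \<Rightarrow> 'v \<Rightarrow> complex) \<Rightarrow> bool" where
  "skew_symmetric w \<longleftrightarrow> (\<forall>x y. w x y = - w y x)"

definition radical :: "('v \<Rightarrow> 'v \<Rightarrow> complex) \<Rightarrow> 'v set" where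
  "radical w = {x. \<forall>y. w x y = 0}"

locale symplectic_vector_space = vector_space scale
  for scale :: "complex \<Rightarrow> 'v::ab_group_add \<Rightarrow> 'v" +
  fixes \<omega> :: "'v \<Rightarrow> 'v \<Rightarrow> complex"
  assumes finite_dimensional: "\<exists>B. finite_dimensional_vector_space scale B"
    and bilinear: "bilinear_form scale \<omega>"
    and skew: "skew_symmetric \<omega>"
    and nondegenerate: "radical \<omega> = {0}"

definition Sp :: "(complex \<Rightarrow> 'v::ab_group_add \<Rightarrow> 'v) \<Rightarrow> ('v \<Rightarrow> 'v \<Rightarrow> complex) \<Rightarrow> ('v \<Rightarrow> 'v) monoid" where
  "Sp scale \<omega> =
     \<lparr>carrier = {g. Vector_Spaces.linear scale scale g \<and> bij g \<and> (\<forall>x y. \<omega> (g x) (g y) = \<omega> x y)},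
      monoid.mult = (\<circ>), one = id\<rparr>"

definition im_1_minus :: "('v::ab_group_add \<Rightarrow> 'v) \<Rightarrow> 'v set" where
  "im_1_minus s = range (\<lambda>x. x - s x)"

definition ker_1_minus :: "('v::ab_group_add \<Rightarrow> 'v) \<Rightarrow> 'v set" where
  "ker_1_minus s = {x. x - s x = 0}"

definition symplectic_reflections ::
    "(complex \<Rightarrow> 'v::ab_group_add \<Rightarrow> 'v) \<Rightarrow> ('v \<Rightarrow> 'v) set \<Rightarrow> ('v \<Rightarrow> 'v) set" where
  "symplectic_reflections scale \<Gamma> = {s \<in> \<Gamma>. vector_space.dim scale (im_1_minus s) = 2}"

definition conj_invariant ::
    "('v \<Rightarrow> 'v) set \<Rightarrow> ('v \<Rightarrow> 'v) set \<Rightarrow> (('v \<Rightarrow> 'v) \<Rightarrow> complex) \<Rightarrow> bool" where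
  "conj_invariant \<Gamma> S c \<longleftrightarrow> (\<forall>\<gamma>\<in>\<Gamma>. \<forall>s\<in>S. c (\<gamma> \<circ> s \<circ> inv_into UNIV \<gamma>) = c s)"

definition is_reflection_form ::
    "(complex \<Rightarrow> 'v::ab_group_add \<Rightarrow> 'v) \<Rightarrow> ('v \<Rightarrow> 'v \<Rightarrow> complex) \<Rightarrow> ('v \<Rightarrow> 'v) \<Rightarrow>
      ('v \<Rightarrow> 'v \<Rightarrow> complex) \<Rightarrow> bool" where
  "is_reflection_form scale \<omega> s w \<longleftrightarrow>
     bilinear_form scale w \<and> skew_symmetric w \<and> radical w = ker_1_minus s \<and>
     (\<forall>x\<in>im_1_minus s. \<forall>y\<in>im_1_minus s. w x y = \<omega> x y)"

text \<open>The form \<open>\<omega>\<^sub>s\<close>; it is well-defined by \<open>reflection_form_unique_exists\<close> below.\<close>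

definition reflection_form ::
    "(complex \<Rightarrow> 'v::ab_group_add \<Rightarrow> 'v) \<Rightarrow> ('v \<Rightarrow> 'v \<Rightarrow> complex) \<Rightarrow> ('v \<Rightarrow> 'v) \<Rightarrow>
      'v \<Rightarrow> 'v \<Rightarrow> complex" where
  "reflection_form scale \<omega> s = (THE w. is_reflection_form scale \<omega> s w)"


subsection \<open>Free algebras\<close>

text \<open>The free monoid gets its own type so that it can be made an instance of \<open>monoid_add\<close>;
  multiplication of finitely supported functions on it is then convolution, that is,
  concatenation of words.\<close>

datatype 'g free_monoid = Word (letters: "'g list")

instantiation free_monoid :: (type) monoid_add
begin

definition zero_free_monoid :: "'a free_monoid" where
  "0 = Word []"

definition plus_free_monoid :: "'a free_monoid \<Rightarrow> 'a free_monoid \<Rightarrow> 'a free_monoid" where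
  "u + v = Word (letters u @ letters v)"

instance
  by standard (simp_all add: zero_free_monoid_def plus_free_monoid_def)

end

type_synonym 'g nc_poly = "'g free_monoid \<Rightarrow>\<^sub>0 complex"

definition generator :: "'g \<Rightarrow> 'g nc_poly" where
  "generator g = Poly_Mapping.single (Word [g]) 1"

definition scalar :: "complex \<Rightarrow> 'g nc_poly" where
  "scalar k = Poly_Mapping.single 0 k"

definition free_algebra :: "'g set \<Rightarrow> 'g nc_poly ring" where
  "free_algebra X =
     \<lparr>carrier = {p. \<forall>w\<in>Poly_Mapping.keys p. set (letters w) \<subseteq> X},
      monoid.mult = (*), one = 1, ring.zero = 0, add = (+)\<rparr>"


subsection \<open>The symplectic reflection algebra\<close>

datatype 'v sra_gen = Vec 'v | Grp "'v \<Rightarrow> 'v"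

abbreviation vec :: "'v \<Rightarrow> 'v sra_gen nc_poly" where
  "vec x \<equiv> generator (Vec x)"

abbreviation grp :: "('v \<Rightarrow> 'v) \<Rightarrow> 'v sra_gen nc_poly" where
  "grp \<gamma> \<equiv> generator (Grp \<gamma>)"

definition sra_free :: "('v \<Rightarrow> 'v) set \<Rightarrow> 'v sra_gen nc_poly ring" where
  "sra_free \<Gamma> = free_algebra (range Vec \<union> Grp ` \<Gamma>)"

text \<open>The first two families express that \<open>V\<close> is adjoined as a vector space, the next two that
  \<open>\<Gamma>\<close> is adjoined as a group (whose identity is the identity of the algebra).\<close>

definition sra_relators ::
    "(complex \<Rightarrow> 'v::ab_group_add \<Rightarrow> 'v) \<Rightarrow> ('v \<Rightarrow> 'v \<Rightarrow> complex) \<Rightarrow> ('v \<Rightarrow> 'v) set \<Rightarrow>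
      complex \<Rightarrow> (('v \<Rightarrow> 'v) \<Rightarrow> complex) \<Rightarrow> 'v sra_gen nc_poly set" where
  "sra_relators scale \<omega> \<Gamma> t c =
     {vec (x + y) - (vec x + vec y) | x y. True} \<union>
     {vec (scale k x) - scalar k * vec x | k x. True} \<union>
     {grp (\<gamma> \<circ> \<delta>) - grp \<gamma> * grp \<delta> | \<gamma> \<delta>. \<gamma> \<in> \<Gamma> \<and> \<delta> \<in> \<Gamma>} \<union>
     {grp id - 1} \<union>
     {grp \<gamma> * vec x * grp (inv_into UNIV \<gamma>) - vec (\<gamma> x) | \<gamma> x. \<gamma> \<in> \<Gamma>} \<union>
     {vec x * vec y - vec y * vec x
        - (scalar (t * \<omega> x y) * grp id
           + (\<Sum>s\<in>symplectic_reflections scale \<Gamma>.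
                scalar (c s * reflection_form scale \<omega> s x y) * grp s)) | x y. True}"

definition sra_ideal ::
    "(complex \<Rightarrow> 'v::ab_group_add \<Rightarrow> 'v) \<Rightarrow> ('v \<Rightarrow> 'v \<Rightarrow> complex) \<Rightarrow> ('v \<Rightarrow> 'v) set \<Rightarrow>
      complex \<Rightarrow> (('v \<Rightarrow> 'v) \<Rightarrow> complex) \<Rightarrow> 'v sra_gen nc_poly set" where
  "sra_ideal scale \<omega> \<Gamma> t c = Idl\<^bsub>sra_free \<Gamma>\<^esub> (sra_relators scale \<omega> \<Gamma> t c)"

definition sra_class ::
    "(complex \<Rightarrow> 'v::ab_group_add \<Rightarrow> 'v) \<Rightarrow> ('v \<Rightarrow> 'v \<Rightarrow> complex) \<Rightarrow> ('v \<Rightarrow> 'v) set \<Rightarrow>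
      complex \<Rightarrow> (('v \<Rightarrow> 'v) \<Rightarrow> complex) \<Rightarrow> 'v sra_gen nc_poly \<Rightarrow> 'v sra_gen nc_poly set" where
  "sra_class scale \<omega> \<Gamma> t c p = sra_ideal scale \<omega> \<Gamma> t c +>\<^bsub>sra_free \<Gamma>\<^esub> p"

text \<open>The algebra \<open>A\<^bsub>t,c\<^esub>\<close>. The record type \<open>module\<close> is used here merely to carry both the ring
  structure and the complex scalar multiplication (induced by left multiplication with the
  constants of the free algebra).\<close>

definition sra ::
    "(complex \<Rightarrow> 'v::ab_group_add \<Rightarrow> 'v) \<Rightarrow> ('v \<Rightarrow> 'v \<Rightarrow> complex) \<Rightarrow> ('v \<Rightarrow> 'v) set \<Rightarrow>
      complex \<Rightarrow> (('v \<Rightarrow> 'v) \<Rightarrow> complex) \<Rightarrow> (complex, 'v sra_gen nc_poly set) module" where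
  "sra scale \<omega> \<Gamma> t c =
     (let Q = sra_free \<Gamma> Quot sra_ideal scale \<omega> \<Gamma> t c
      in \<lparr>carrier = carrier Q, monoid.mult = monoid.mult Q, one = \<one>\<^bsub>Q\<^esub>, ring.zero = \<zero>\<^bsub>Q\<^esub>, add = add Q,
          smult = (\<lambda>k a. sra_class scale \<omega> \<Gamma> t c (scalar k) \<otimes>\<^bsub>Q\<^esub> a)\<rparr>)"

text \<open>The idempotent \<open>e = |\<Gamma>|\<^sup>-\<^sup>1 \<Sum>\<gamma>\<in>\<Gamma>. \<gamma>\<close>.\<close>

definition sra_e ::
    "(complex \<Rightarrow> 'v::ab_group_add \<Rightarrow> 'v) \<Rightarrow> ('v \<Rightarrow> 'v \<Rightarrow> complex) \<Rightarrow> ('v \<Rightarrow> 'v) set \<Rightarrow>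
      complex \<Rightarrow> (('v \<Rightarrow> 'v) \<Rightarrow> complex) \<Rightarrow> 'v sra_gen nc_poly set" where
  "sra_e scale \<omega> \<Gamma> t c =
     sra_class scale \<omega> \<Gamma> t c (scalar (1 / of_nat (card \<Gamma>)) * (\<Sum>\<gamma>\<in>\<Gamma>. grp \<gamma>))"


subsection \<open>Centres, corner algebras, isomorphisms\<close>

definition centre :: "('k, 'a) module \<Rightarrow> ('k, 'a) module" where
  "centre A = A\<lparr>carrier := {z \<in> carrier A. \<forall>a\<in>carrier A. z \<otimes>\<^bsub>A\<^esub> a = a \<otimes>\<^bsub>A\<^esub> z}\<rparr>"

definition corner :: "('k, 'a) module \<Rightarrow> 'a \<Rightarrow> ('k, 'a) module" where
  "corner A e = A\<lparr>carrier := {e \<otimes>\<^bsub>A\<^esub> a \<otimes>\<^bsub>A\<^esub> e | a. a \<in> carrier A}, one := e\<rparr>"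

definition algebra_isomorphic :: "(complex, 'a) module \<Rightarrow> (complex, 'b) module \<Rightarrow> bool" where
  "algebra_isomorphic A B \<longleftrightarrow>
     (\<exists>h \<in> ring_iso A B. \<forall>k. \<forall>a\<in>carrier A. h (k \<odot>\<^bsub>A\<^esub> a) = k \<odot>\<^bsub>B\<^esub> h a)"

text \<open>\<open>A\<close> as a left module over its subring with carrier \<open>Z\<close>.\<close>

definition finitely_generated_over :: "('k, 'a) module \<Rightarrow> 'a set \<Rightarrow> bool" where
  "finitely_generated_over A Z \<longleftrightarrow>
     (\<exists>G. finite G \<and> G \<subseteq> carrier A \<and>
        (\<forall>a\<in>carrier A. \<exists>z \<in> G \<rightarrow> Z. a = (\<Oplus>\<^bsub>A\<^esub>g\<in>G. z g \<otimes>\<^bsub>A\<^esub> g)))"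


subsection \<open>Well-definedness\<close>

lemma Sp_group:
  assumes "vector_space scale"
  shows "Group.group (Sp scale \<omega>)"
proof (rule groupI)
  interpret vector_space scale by fact
  fix x assume x: "x \<in> carrier (Sp scale \<omega>)"
  then have b: "bij x" by (simp add: Sp_def)
  interpret x: Vector_Spaces.linear scale scale x using x by (simp add: Sp_def)
  let ?i = "inv_into UNIV x"
  have xi: "x (?i y) = y" for y using b by (simp add: bij_is_surj surj_f_inv_f)
  have inj: "x u = x v \<Longrightarrow> u = v" for u v using b by (meson bij_is_inj injD)
  have "?i (u + v) = ?i u + ?i v" for u v by (rule inj) (simp add: xi x.add)
  moreover have "?i (scale a u) = scale a (?i u)" for a u by (rule inj) (simp add: xi x.scale)
  ultimately have "Vector_Spaces.linear scale scale ?i" by unfold_locales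
  moreover have "bij ?i" by (simp add: b bij_imp_bij_inv)
  moreover have "\<omega> (?i u) (?i v) = \<omega> u v" for u v
    using x xi by (metis (mono_tags, lifting) Sp_def mem_Collect_eq partial_object.select_convs(1))
  ultimately show "\<exists>y\<in>carrier (Sp scale \<omega>). y \<otimes>\<^bsub>Sp scale \<omega>\<^esub> x = \<one>\<^bsub>Sp scale \<omega>\<^esub>"
    by (intro bexI[of _ ?i]) (auto simp: Sp_def bij_is_inj[OF b])
qed (use assms in \<open>auto simp: Sp_def bij_comp vector_space.linear_id intro: Vector_Spaces.linear_compose\<close>)

lemma funpow_id_ex:
  fixes s :: "'v \<Rightarrow> 'v"
  assumes "finite \<Gamma>" "\<And>k. s ^^ k \<in> \<Gamma>" "bij s"
  shows "\<exists>m>0. s ^^ m = id"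
proof -
  have "\<not> inj (\<lambda>k::nat. s ^^ k)"
  proof
    assume "inj (\<lambda>k::nat. s ^^ k)"
    then have "infinite (range (\<lambda>k::nat. s ^^ k))" using finite_imageD by blast
    moreover have "range (\<lambda>k::nat. s ^^ k) \<subseteq> \<Gamma>" using assms(2) by auto
    ultimately show False using assms(1) finite_subset by blast
  qed
  then obtain i j where "i < j" and ij: "s ^^ i = s ^^ j"
    unfolding inj_def by (metis nat_neq_iff)
  then obtain m where m: "j = i + m" "m > 0" by (metis less_imp_add_positive)
  have "inj (s ^^ i)" using assms(3) by (simp add: bij_is_inj inj_fn)
  moreover have "(s ^^ i) ((s ^^ m) x) = (s ^^ i) x" for x
    using ij m(1) by (metis comp_apply funpow_add)
  ultimately have "(s ^^ m) x = x" for x by (meson injD)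
  then have "s ^^ m = id" by auto
  then show ?thesis using m(2) by blast
qed

lemma reflection_form_unique_exists:
  assumes "symplectic_vector_space scale \<omega>" "subgroup \<Gamma> (Sp scale \<omega>)" "finite \<Gamma>" "s \<in> \<Gamma>"
  shows "\<exists>!w. is_reflection_form scale \<omega> s w"
proof -
  interpret symplectic_vector_space scale \<omega> by fact
  have sS: "s \<in> carrier (Sp scale \<omega>)"
    using assms(2,4) by (meson subgroup.mem_carrier)
  then have lin: "Vector_Spaces.linear scale scale s" and bij: "bij s"
    and pres: "\<And>x y. \<omega> (s x) (s y) = \<omega> x y" by (auto simp: Sp_def)
  interpret s: Vector_Spaces.linear scale scale s by fact
  have pw: "s ^^ k \<in> \<Gamma>" for k
  proof (induction k)
    case 0 show ?case using subgroup.one_closed[OF assms(2)] by (simp add: Sp_def id_def)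
  next
    case (Suc k) then show ?case
      using subgroup.m_closed[OF assms(2) assms(4) Suc] by (simp add: Sp_def comp_def)
  qed
  obtain m where m: "m > 0" "s ^^ m = id" using funpow_id_ex[OF assms(3) pw bij] by auto
  define P where "P x = scale (1 / of_nat m) (\<Sum>k<m. (s ^^ k) x)" for x
  have sl: "(s ^^ k) (x + y) = (s ^^ k) x + (s ^^ k) y" "(s ^^ k) (scale a x) = scale a ((s ^^ k) x)" for k x y a
    by (induction k) (simp_all add: s.add s.scale)
  have P_add: "P (x + y) = P x + P y" for x y
    by (simp add: P_def sl sum.distrib scale_right_distrib)
  have P_scale: "P (scale a x) = scale a (P x)" for a x
    by (simp add: P_def sl scale_sum_right[symmetric] mult.commute)
  have mc: "(of_nat m :: complex) \<noteq> 0" using m(1) by simp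
  have KP: "P x = x" if "s x = x" for x
  proof -
    have "(s ^^ k) x = x" for k by (induction k) (use that in auto)
    then show ?thesis using mc by (simp add: P_def sum_constant_scale)
  qed
  have PK: "s (P x) = P x" for x
  proof -
    have "(\<Sum>k<m. s ((s ^^ k) x)) = (\<Sum>k<m. (s ^^ Suc k) x)" by simp
    also have "\<dots> = (\<Sum>k<Suc m. (s ^^ k) x) - x"
      by (subst sum.lessThan_Suc_shift) simp
    also have "\<dots> = (\<Sum>k<m. (s ^^ k) x)" using m(2) by simp
    finally show ?thesis by (simp add: P_def s.scale s.sum)
  qed
  have lin_c: "Vector_Spaces.linear scale (*) f \<longleftrightarrow>
      (\<forall>x y. f (x + y) = f x + f y) \<and> (\<forall>a x. f (scale a x) = a * f x)" for f :: "'a \<Rightarrow> complex"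
    unfolding Vector_Spaces.linear_def module_hom_def module_hom_axioms_def
    using vector_space_axioms module_axioms
    by (auto simp: vector_space_def Modules.module_def algebra_simps)
  have bl0: "\<omega> (x + y) z = \<omega> x z + \<omega> y z" "\<omega> z (x + y) = \<omega> z x + \<omega> z y"
    "\<omega> (scale a x) z = a * \<omega> x z" "\<omega> z (scale a x) = a * \<omega> z x" for x y z a
    using bilinear unfolding bilinear_form_def lin_c by blast+
  have bl1: "\<omega> (x - y) z = \<omega> x z - \<omega> y z" "\<omega> z (x - y) = \<omega> z x - \<omega> z y" for x y z
    using bl0(1)[of "x - y" y z] bl0(2)[of z "x - y" y] by simp_all
  note bl = bl0 bl1
  have orth: "\<omega> (x - s x) y = 0" if "s y = y" for x y
    using pres[of x y] that by (simp add: bl)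
  have imd: "x - (s ^^ k) x \<in> im_1_minus s" for x k
  proof -
    have "x - (s ^^ k) x = (\<Sum>j<k. (s ^^ j) x) - s (\<Sum>j<k. (s ^^ j) x)"
    proof (induction k)
      case (Suc k) then show ?case by (simp add: s.sum s.add algebra_simps)
    qed simp
    then show ?thesis by (auto simp: im_1_minus_def)
  qed
  have sub: "subspace (im_1_minus s)"
  proof -
    have ad: "x - s x + (y - s y) = (x + y) - s (x + y)" for x y by (simp add: s.add)
    have sc: "scale a (x - s x) = scale a x - s (scale a x)" for a x
      by (simp add: s.scale scale_right_diff_distrib)
    show ?thesis
    proof (rule subspaceI)
      have "0 = 0 - s 0" by (simp add: s.zero)
      then show "0 \<in> im_1_minus s" unfolding im_1_minus_def by (rule range_eqI)
    qed (auto simp: im_1_minus_def ad sc)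
  qed
  have imP: "x - P x \<in> im_1_minus s" for x
  proof -
    have "x - P x = scale (1 / of_nat m) (\<Sum>k<m. x - (s ^^ k) x)"
      using mc by (simp add: P_def sum_subtractf scale_right_diff_distrib sum_constant_scale)
    then show ?thesis by (simp add: subspace_scale subspace_sum sub imd)
  qed
  have P0: "P x = 0" if xi: "x \<in> im_1_minus s" for x
  proof -
    obtain y where x: "x = y - s y" using xi by (auto simp: im_1_minus_def)
    have a: "\<omega> (P x) z = 0" for z
    proof -
      have "\<omega> x (P z) = 0" unfolding x by (rule orth[OF PK])
      moreover have "\<omega> (x - P x) (P z) = 0"
        using imP[of x] orth[OF PK] by (auto simp: im_1_minus_def)
      ultimately have "\<omega> (P x) (P z) = 0" by (simp add: bl)
      moreover have "\<omega> (z - P z) (P x) = 0"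
        using imP[of z] orth[OF PK] by (auto simp: im_1_minus_def)
      then have "\<omega> (P x) (z - P z) = 0" using skew by (metis skew_symmetric_def neg_equal_0_iff_equal)
      ultimately show ?thesis by (simp add: bl)
    qed
    then have "P x \<in> radical \<omega>" by (simp add: radical_def)
    then show ?thesis using nondegenerate by auto
  qed
  define w where "w x y = \<omega> (x - P x) (y - P y)" for x y
  have "bilinear_form scale w"
    unfolding bilinear_form_def lin_c by (simp add: w_def bl P_add P_scale algebra_simps)
  moreover have "skew_symmetric w" using skew unfolding skew_symmetric_def w_def by metis
  moreover have "radical w = ker_1_minus s"
  proof (intro Set.set_eqI iffI)
    fix x assume "x \<in> ker_1_minus s"
    then have "P x = x" by (simp add: ker_1_minus_def KP)
    moreover have "\<omega> 0 y = 0" for y using bl(5)[of 0 0 y] by simp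
    ultimately show "x \<in> radical w" by (simp add: radical_def w_def)
  next
    fix x assume xr: "x \<in> radical w"
    have "\<omega> (x - P x) z = 0" for z
    proof -
      have "\<omega> (x - P x) (z - P z) = 0" using xr by (auto simp: radical_def w_def)
      moreover have "\<omega> (x - P x) (P z) = 0"
        using imP[of x] orth[OF PK] by (auto simp: im_1_minus_def)
      ultimately show ?thesis by (simp add: bl)
    qed
    then have "x - P x \<in> radical \<omega>" by (simp add: radical_def)
    then have "x = P x" using nondegenerate by auto
    then show "x \<in> ker_1_minus s" using PK by (metis (mono_tags) ker_1_minus_def mem_Collect_eq cancel_comm_monoid_add_class.diff_cancel)
  qed
  moreover have "\<forall>x\<in>im_1_minus s. \<forall>y\<in>im_1_minus s. w x y = \<omega> x y" by (simp add: w_def P0)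
  ultimately have ex: "is_reflection_form scale \<omega> s w" by (simp add: is_reflection_form_def)
  moreover have "w' = w" if w': "is_reflection_form scale \<omega> s w'" for w'
  proof (intro ext)
    fix x y
    have bl': "w' (x + y) z = w' x z + w' y z" "w' z (x + y) = w' z x + w' z y" for x y z
      using w' unfolding is_reflection_form_def bilinear_form_def lin_c by auto
    have k: "w' (P u) z = 0" "w' z (P u) = 0" for u z
    proof -
      have "P u \<in> radical w'" using w' by (simp add: is_reflection_form_def ker_1_minus_def PK)
      then show "w' (P u) z = 0" by (simp add: radical_def)
      then show "w' z (P u) = 0" using w' unfolding is_reflection_form_def skew_symmetric_def
        by (metis neg_equal_0_iff_equal)
    qed
    have "w' x y = w' ((x - P x) + P x) ((y - P y) + P y)" by simp
    also have "\<dots> = w' (x - P x) (y - P y)" unfolding bl' k by simp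
    also have "\<dots> = w x y" using w' imP by (simp add: is_reflection_form_def w_def)
    finally show "w' x y = w x y" .
  qed
  ultimately show ?thesis by blast
qed

lemma free_algebra_ring: "ring (free_algebra X)"
proof -
  have m: "x * y \<in> carrier (free_algebra X)"
    if "x \<in> carrier (free_algebra X)" "y \<in> carrier (free_algebra X)" for x y
    using that keys_mult[of x y] by (fastforce simp: free_algebra_def plus_free_monoid_def)
  have a: "x + y \<in> carrier (free_algebra X)"
    if "x \<in> carrier (free_algebra X)" "y \<in> carrier (free_algebra X)" for x y
    using that Poly_Mapping.keys_add[of x y] by (fastforce simp: free_algebra_def)
  have n: "- x \<in> carrier (free_algebra X)" if "x \<in> carrier (free_algebra X)" for x
    using that by (simp add: free_algebra_def)
  have z: "0 \<in> carrier (free_algebra X)" by (simp add: free_algebra_def)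
  have o: "1 \<in> carrier (free_algebra X)" by (simp add: free_algebra_def zero_free_monoid_def)
  have ops: "x \<otimes>\<^bsub>free_algebra X\<^esub> y = x * y" "x \<oplus>\<^bsub>free_algebra X\<^esub> y = x + y"
    "\<zero>\<^bsub>free_algebra X\<^esub> = 0" "\<one>\<^bsub>free_algebra X\<^esub> = 1" for x y
    by (simp_all add: free_algebra_def)
  show ?thesis
  proof (intro ringI abelian_groupI monoidI)
    fix x assume "x \<in> carrier (free_algebra X)"
    then show "\<exists>y\<in>carrier (free_algebra X). y \<oplus>\<^bsub>free_algebra X\<^esub> x = \<zero>\<^bsub>free_algebra X\<^esub>"
      using n by (intro bexI[of _ "- x"]) (simp_all add: ops)
  qed (simp_all only: ops m a z o mult.assoc distrib_left distrib_right add.assoc add.commute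
        mult_1_left mult_1_right add_0_left, simp_all add: add.left_commute)
qed

text \<open>Since the relators lie in the free algebra, the generated ideal is not the degenerate
  intersection over the empty family.\<close>

lemma sra_relators_carrier:
  assumes "vector_space scale" "subgroup \<Gamma> (Sp scale \<omega>)"
  shows "sra_relators scale \<omega> \<Gamma> t c \<subseteq> carrier (sra_free \<Gamma>)"
proof -
  let ?C = "carrier (sra_free \<Gamma>)"
  interpret R: ring "sra_free \<Gamma>" unfolding sra_free_def by (rule free_algebra_ring)
  have mu: "x * y \<in> ?C" if "x \<in> ?C" "y \<in> ?C" for x y
    using R.m_closed[OF that] by (simp add: sra_free_def free_algebra_def)
  have ad: "x + y \<in> ?C" if "x \<in> ?C" "y \<in> ?C" for x y
    using R.a_closed[OF that] by (simp add: sra_free_def free_algebra_def)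
  have ne: "- x \<in> ?C" if "x \<in> ?C" for x
    using that by (simp add: sra_free_def free_algebra_def)
  have mi: "x - y \<in> ?C" if "x \<in> ?C" "y \<in> ?C" for x y
    using ad[OF that(1) ne[OF that(2)]] by simp
  have z: "0 \<in> ?C" by (simp add: sra_free_def free_algebra_def)
  have o: "1 \<in> ?C" by (simp add: sra_free_def free_algebra_def zero_free_monoid_def)
  have sc: "scalar k \<in> ?C" for k
    by (simp add: scalar_def sra_free_def free_algebra_def zero_free_monoid_def)
  have su: "sum f I \<in> ?C" if "\<And>i. i \<in> I \<Longrightarrow> f i \<in> ?C" for f and I :: "('a \<Rightarrow> 'a) set"
    using that by (induction I rule: infinite_finite_induct) (auto intro: ad z)
  have v: "vec x \<in> ?C" for x by (simp add: generator_def sra_free_def free_algebra_def)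
  have g: "grp x \<in> ?C" if "x \<in> \<Gamma>" for x using that
    by (simp add: generator_def sra_free_def free_algebra_def)
  have idG: "id \<in> \<Gamma>" using subgroup.one_closed[OF assms(2)] by (simp add: Sp_def)
  have cG: "x \<circ> y \<in> \<Gamma>" if "x \<in> \<Gamma>" "y \<in> \<Gamma>" for x y
    using subgroup.m_closed[OF assms(2) that] by (simp add: Sp_def)
  have iG: "inv_into UNIV x \<in> \<Gamma>" if "x \<in> \<Gamma>" for x
  proof -
    have xc: "x \<in> carrier (Sp scale \<omega>)" by (meson assms(2) that subgroup.mem_carrier)
    let ?i = "m_inv (Sp scale \<omega>) x"
    have i: "?i \<in> \<Gamma>" by (rule subgroup.m_inv_closed[OF assms(2) that])
    have G: "Group.group (Sp scale \<omega>)"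
      by (rule Sp_group) fact
    have "?i \<circ> x = id" using group.l_inv[OF G xc] by (simp add: Sp_def)
    moreover have "bij x" using xc by (simp add: Sp_def)
    ultimately have "?i = inv_into UNIV x"
      by (metis bij_is_surj comp_assoc comp_id id_comp surj_iff)
    then show ?thesis using i by simp
  qed
  show ?thesis unfolding sra_relators_def
    by (auto intro!: mi ad mu su sc v g idG cG iG o simp: symplectic_reflections_def)
qed

lemma sra_ideal_ideal:
  assumes "vector_space scale" "subgroup \<Gamma> (Sp scale \<omega>)"
  shows "ideal (sra_ideal scale \<omega> \<Gamma> t c) (sra_free \<Gamma>)"
proof -
  interpret R: ring "sra_free \<Gamma>" unfolding sra_free_def by (rule free_algebra_ring)
  show ?thesis unfolding sra_ideal_def
    by (rule R.genideal_ideal[OF sra_relators_carrier[OF assms]])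
qed

lemma sra_ring:
  assumes "vector_space scale" "subgroup \<Gamma> (Sp scale \<omega>)"
  shows "ring (sra scale \<omega> \<Gamma> t c)"
proof -
  define Q where "Q = sra_free \<Gamma> Quot sra_ideal scale \<omega> \<Gamma> t c"
  interpret Q: ring Q
    unfolding Q_def by (rule ideal.quotient_is_ring[OF sra_ideal_ideal[OF assms]])
  let ?A = "sra scale \<omega> \<Gamma> t c"
  have ops: "carrier ?A = carrier Q" "x \<otimes>\<^bsub>?A\<^esub> y = x \<otimes>\<^bsub>Q\<^esub> y" "x \<oplus>\<^bsub>?A\<^esub> y = x \<oplus>\<^bsub>Q\<^esub> y"
    "\<zero>\<^bsub>?A\<^esub> = \<zero>\<^bsub>Q\<^esub>" "\<one>\<^bsub>?A\<^esub> = \<one>\<^bsub>Q\<^esub>" for x y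
    by (simp_all add: sra_def Let_def Q_def)
  show ?thesis
    by (intro ringI abelian_groupI monoidI)
      (auto simp: ops Q.a_assoc Q.m_assoc Q.l_distr Q.r_distr Q.a_comm Q.a_lcomm Q.l_neg
        intro!: bexI[of _ "\<ominus>\<^bsub>Q\<^esub> _"])
qed

end

theory Submission
  imports Defs "HOL-Computational_Algebra.Polynomial"
begin

text \<open>The algebra is filtered by the degree in \<open>V\<close>, and the PBW theorem says that its associated graded
  algebra is the smash product \<open>\<complex>[V] # \<Gamma>\<close>. So an element has, in each filtration degree, a symbol, which
  is a family of polynomials on \<open>V\<close> indexed by \<open>\<Gamma>\<close>; the element drops in degree as soon as its symbol
  vanishes (\<open>fil_if_symbol_0\<close>). The PBW theorem is proved by constructing the action on \<open>\<complex>[V] \<otimes> \<complex>\<Gamma>\<close>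
  (\<open>commutator_L\<close>): vectors act by multiplication plus corrections, which are obtained degree by degree
  from the explicit contraction of the Koszul complex that Euler's identity provides. The obstruction to
  solving for the corrections vanishes by the Jacobi identity \<open>reflection_form_jacobi\<close>.

  The commutator of two vectors has degree \<open>0\<close>, and its component at the identity of \<open>\<Gamma>\<close> is
  \<open>t \<omega>(x, y)\<close>. A nontrivial \<open>\<gamma>\<close> moves some vector, so the symbol of a central element is
  concentrated at the identity; it is a polynomial \<open>f\<close>, and \<open>- t \<partial>\<^sub>x f\<close> is the leading term of the
  commutator with \<open>x\<close> (\<open>symbol_comm_id\<close>). For \<open>t \<noteq> 0\<close> all derivatives of \<open>f\<close> therefore vanish, hence
  \<open>f\<close> is constant and the centre is \<open>\<complex>\<close> (\<open>central_scalar\<close>).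

  For \<open>t = 0\<close> the point is that every \<open>\<Gamma>\<close>-invariant polynomial is the symbol of a central element
  (\<open>central_lift\<close>). One starts from the symmetrised lift and pushes down the order of the commutators
  \<open>[z, x]\<close> step by step. In each step the components of their symbols at \<open>\<gamma> \<noteq> 1\<close> satisfy a cocycle
  condition with respect to the linear forms attached to \<open>\<gamma> x - x\<close>; two of these forms are independent,
  hence coprime, so the cocycle is a coboundary and a correction of \<open>z\<close> removes it
  (\<open>remove_group_components\<close>). The component at \<open>1\<close> is a derivation \<open>{f, \<cdot>}\<close> of \<open>\<complex>[V]\<close> which lowers degrees
  by \<open>d\<close>. It vanishes for \<open>d = 2\<close> because \<open>t = 0\<close>, and for \<open>d \<ge> 3\<close> by \<open>ham_eq_0\<close>: a vector \<open>v\<close> is a root of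
  \<open>\<Prod> (X - \<gamma> v)\<close>, whose coefficients \<open>a\<^sub>i\<close> are invariant, so with \<open>D(v) = \<Prod> (v - \<gamma> v)\<close>, the product
  over \<open>\<gamma> \<noteq> 1\<close>, the chain rule gives \<open>D(v) {f, v} = - \<Sum> v\<^sup>i {f, a\<^sub>i}\<close>. For \<open>Y\<^sub>v(w) = \<Sum> v\<^sup>i {a\<^sub>i, w}\<close> the same
  rule and the antisymmetry of commutators give \<open>D(w) Y\<^sub>v(w) = - D(v) Y\<^sub>w(v)\<close>. For generic \<open>v\<close> and \<open>w\<close>
  the polynomials \<open>D(v)\<close> and \<open>D(w)\<close> are coprime, so \<open>D(v)\<close> divides \<open>Y\<^sub>v(w)\<close>, whose degree
  \<open>|\<Gamma>| + 1 - d\<close> is too small. Hence \<open>Y\<^sub>v = 0\<close>, then \<open>D(v) {f, v} = 0\<close>, and \<open>{f, v} = 0\<close>.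

  Multiplication by \<open>e\<close> maps the centre to \<open>e A e\<close>. On symbols it turns \<open>f\<close> at the identity into the
  constant family \<open>f / |\<Gamma>|\<close>, and the symbols of elements of \<open>e A e\<close> are precisely the constant families of
  invariants. An induction on the filtration degree then gives injectivity (\<open>central_idem_injective\<close>)
  and, by means of central lifts, surjectivity (\<open>spherical_lift\<close>). The equation \<open>\<Sum> a\<^sub>i v\<^sup>i = 0\<close> also shows that, over the
  centre, the algebra is spanned by the finitely many lifts of monomials with exponents below
  \<open>|\<Gamma>|\<close>, multiplied by group elements (\<open>spanned_all\<close>).\<close>

section \<open>Symplectic linear algebra\<close>

locale symplectic_reflection_data = symplectic_vector_space scale \<omega>
  for scale :: "complex \<Rightarrow> 'v::ab_group_add \<Rightarrow> 'v" and \<omega> :: "'v \<Rightarrow> 'v \<Rightarrow> complex" +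
  fixes \<Gamma> :: "('v \<Rightarrow> 'v) set" and t :: complex and c :: "('v \<Rightarrow> 'v) \<Rightarrow> complex"
  assumes subgroup: "subgroup \<Gamma> (Sp scale \<omega>)"
    and finite_group: "finite \<Gamma>"
    and invariant: "conj_invariant \<Gamma> (symplectic_reflections scale \<Gamma>) c"
begin

abbreviation ginv :: "('v \<Rightarrow> 'v) \<Rightarrow> 'v \<Rightarrow> 'v" where "ginv \<equiv> inv_into UNIV"

abbreviation refl :: "('v \<Rightarrow> 'v) set" where "refl \<equiv> symplectic_reflections scale \<Gamma>"

abbreviation \<omega>s :: "('v \<Rightarrow> 'v) \<Rightarrow> 'v \<Rightarrow> 'v \<Rightarrow> complex" where "\<omega>s s \<equiv> reflection_form scale \<omega> s"

lemma linear_form_iff: "Vector_Spaces.linear scale (*) f \<longleftrightarrow>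
    (\<forall>x y. f (x + y) = f x + f y) \<and> (\<forall>a x. f (scale a x) = a * f x)" for f :: "'v \<Rightarrow> complex"
  unfolding Vector_Spaces.linear_def module_hom_def module_hom_axioms_def
  using vector_space_axioms module_axioms
  by (auto simp: vector_space_def Modules.module_def algebra_simps)

lemma bilinear_formD:
  assumes "bilinear_form scale w"
  shows "w (x + y) z = w x z + w y z" "w z (x + y) = w z x + w z y"
    "w (scale a x) z = a * w x z" "w z (scale a x) = a * w z x"
    "w (x - y) z = w x z - w y z" "w z (x - y) = w z x - w z y"
    "w 0 z = 0" "w z 0 = 0" "w (- x) z = - w x z" "w z (- x) = - w z x"
proof -
  have b: "w (x + y) z = w x z + w y z" "w z (x + y) = w z x + w z y"
    "w (scale a x) z = a * w x z" "w z (scale a x) = a * w z x" for x y z a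
    using assms unfolding bilinear_form_def linear_form_iff by blast+
  show "w (x + y) z = w x z + w y z" "w z (x + y) = w z x + w z y"
    "w (scale a x) z = a * w x z" "w z (scale a x) = a * w z x" by (fact b)+
  show "w (x - y) z = w x z - w y z" "w z (x - y) = w z x - w z y"
    using b(1)[of "x - y" y z] b(2)[of z "x - y" y] by simp_all
  show z: "w 0 z = 0" "w z 0 = 0" using b(1)[of 0 0 z] b(2)[of z 0 0] by simp_all
  show "w (- x) z = - w x z" "w z (- x) = - w z x"
    using b(1)[of "- x" x z] b(2)[of z "- x" x] z by (simp_all add: eq_neg_iff_add_eq_0)
qed

lemmas omega_simps [simp] = bilinear_formD[OF bilinear]

lemma omega_skew: "\<omega> x y = - \<omega> y x"
  using skew unfolding skew_symmetric_def by blast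

lemma omega_self [simp]: "\<omega> x x = 0"
  using omega_skew[of x x] by simp

lemma omega_sum_left: "\<omega> (\<Sum>i\<in>I. f i) y = (\<Sum>i\<in>I. \<omega> (f i) y)"
  by (induction I rule: infinite_finite_induct) auto

lemma omega_sum_right: "\<omega> y (\<Sum>i\<in>I. f i) = (\<Sum>i\<in>I. \<omega> y (f i))"
  by (induction I rule: infinite_finite_induct) auto

lemma omega_nondegenerate: "(\<And>y. \<omega> x y = 0) \<Longrightarrow> x = 0"
  using nondegenerate by (auto simp: radical_def)

lemma omega_eqI: "(\<And>y. \<omega> x y = \<omega> x' y) \<Longrightarrow> x = x'"
  using omega_nondegenerate[of "x - x'"] by simp

lemma group_linear: "\<gamma> \<in> \<Gamma> \<Longrightarrow> Vector_Spaces.linear scale scale \<gamma>"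
  and group_bij: "\<gamma> \<in> \<Gamma> \<Longrightarrow> bij \<gamma>"
  and group_omega [simp]: "\<gamma> \<in> \<Gamma> \<Longrightarrow> \<omega> (\<gamma> x) (\<gamma> y) = \<omega> x y"
  using subgroup.mem_carrier[OF subgroup] by (auto simp: Sp_def)

lemma group_id [simp]: "id \<in> \<Gamma>"
  using subgroup.one_closed[OF subgroup] by (simp add: Sp_def)

lemma group_comp [simp]: "\<gamma> \<in> \<Gamma> \<Longrightarrow> \<delta> \<in> \<Gamma> \<Longrightarrow> \<gamma> \<circ> \<delta> \<in> \<Gamma>"
  using subgroup.m_closed[OF subgroup] by (simp add: Sp_def)

lemma group_add: "\<gamma> \<in> \<Gamma> \<Longrightarrow> \<gamma> (x + y) = \<gamma> x + \<gamma> y"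
  and group_scale: "\<gamma> \<in> \<Gamma> \<Longrightarrow> \<gamma> (scale a x) = scale a (\<gamma> x)"
  and group_zero: "\<gamma> \<in> \<Gamma> \<Longrightarrow> \<gamma> 0 = 0"
  and group_diff: "\<gamma> \<in> \<Gamma> \<Longrightarrow> \<gamma> (x - y) = \<gamma> x - \<gamma> y"
  and group_sum: "\<gamma> \<in> \<Gamma> \<Longrightarrow> \<gamma> (sum f I) = (\<Sum>i\<in>I. \<gamma> (f i))"
proof -
  assume "\<gamma> \<in> \<Gamma>"
  then interpret g: Vector_Spaces.linear scale scale \<gamma> by (rule group_linear)
  show "\<gamma> (x + y) = \<gamma> x + \<gamma> y" "\<gamma> (scale a x) = scale a (\<gamma> x)" "\<gamma> 0 = 0"
    "\<gamma> (x - y) = \<gamma> x - \<gamma> y" "\<gamma> (sum f I) = (\<Sum>i\<in>I. \<gamma> (f i))"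
    by (simp_all add: g.add g.scale g.zero g.diff g.sum)
qed

lemmas group_lin [simp] = group_add group_scale group_zero group_diff group_sum

lemma ginv_left [simp]: "\<gamma> \<in> \<Gamma> \<Longrightarrow> ginv \<gamma> (\<gamma> x) = x"
  and ginv_right [simp]: "\<gamma> \<in> \<Gamma> \<Longrightarrow> \<gamma> (ginv \<gamma> x) = x"
  using group_bij by (auto simp: bij_is_inj bij_is_surj surj_f_inv_f)

lemma ginv_comp [simp]: "\<gamma> \<in> \<Gamma> \<Longrightarrow> ginv \<gamma> \<circ> \<gamma> = id" "\<gamma> \<in> \<Gamma> \<Longrightarrow> \<gamma> \<circ> ginv \<gamma> = id"
  by (auto simp: fun_eq_iff)

lemma ginv_comp_assoc [simp]: "\<gamma> \<in> \<Gamma> \<Longrightarrow> ginv \<gamma> \<circ> (\<gamma> \<circ> \<delta>) = \<delta>"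
  "\<gamma> \<in> \<Gamma> \<Longrightarrow> \<gamma> \<circ> (ginv \<gamma> \<circ> \<delta>) = \<delta>"
  by (auto simp: fun_eq_iff)

lemma group_ginv [simp]: "\<gamma> \<in> \<Gamma> \<Longrightarrow> ginv \<gamma> \<in> \<Gamma>"
proof -
  assume g: "\<gamma> \<in> \<Gamma>"
  let ?i = "m_inv (Sp scale \<omega>) \<gamma>"
  have i: "?i \<in> \<Gamma>" by (rule subgroup.m_inv_closed[OF subgroup g])
  have "?i \<circ> \<gamma> = id"
    using group.l_inv[OF Sp_group[OF vector_space_axioms] subgroup.mem_carrier[OF subgroup g]]
    by (simp add: Sp_def)
  then have "?i = ginv \<gamma>" using g by (metis comp_assoc comp_id id_comp ginv_comp(2))
  then show ?thesis using i by simp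
qed

lemma ginv_ginv [simp]: "\<gamma> \<in> \<Gamma> \<Longrightarrow> ginv (ginv \<gamma>) = \<gamma>"
  by (simp add: group_bij inv_inv_eq)

lemma ginv_compose [simp]: "\<gamma> \<in> \<Gamma> \<Longrightarrow> \<delta> \<in> \<Gamma> \<Longrightarrow> ginv (\<gamma> \<circ> \<delta>) = ginv \<delta> \<circ> ginv \<gamma>"
  by (simp add: group_bij o_inv_distrib)

lemma group_comp_iff [simp]: "\<gamma> \<in> \<Gamma> \<Longrightarrow> \<gamma> \<circ> \<delta> \<in> \<Gamma> \<longleftrightarrow> \<delta> \<in> \<Gamma>"
  by (metis group_comp group_ginv ginv_comp_assoc(1))

lemma ginv_comp_eq_iff: "\<gamma> \<in> \<Gamma> \<Longrightarrow> ginv \<gamma> \<circ> \<delta> = \<epsilon> \<longleftrightarrow> \<delta> = \<gamma> \<circ> \<epsilon>"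
  by (metis ginv_comp_assoc)

lemma omega_ginv: "\<gamma> \<in> \<Gamma> \<Longrightarrow> \<omega> (ginv \<gamma> x) y = \<omega> x (\<gamma> y)"
  using group_omega[of \<gamma> "ginv \<gamma> x" y] by simp

lemma bij_betw_comp_left: "\<gamma> \<in> \<Gamma> \<Longrightarrow> bij_betw (\<lambda>\<delta>. \<gamma> \<circ> \<delta>) \<Gamma> \<Gamma>"
  by (rule bij_betwI[where g = "\<lambda>\<delta>. ginv \<gamma> \<circ> \<delta>"]) auto

lemma bij_betw_comp_right: "\<gamma> \<in> \<Gamma> \<Longrightarrow> bij_betw (\<lambda>\<delta>. \<delta> \<circ> \<gamma>) \<Gamma> \<Gamma>"
  by (rule bij_betwI[where g = "\<lambda>\<delta>. \<delta> \<circ> ginv \<gamma>"]) (auto simp: comp_assoc)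

lemma card_group_nonzero [simp]: "of_nat (card \<Gamma>) \<noteq> (0::complex)" "card \<Gamma> \<noteq> 0"
  using finite_group group_id by (metis card_0_eq empty_iff of_nat_eq_0_iff)+

text \<open>By nondegeneracy every linear form on \<open>V\<close> is \<open>\<omega> e\<close> for some \<open>e\<close>; applied to the coordinate forms of a
  basis, this gives the vectors \<open>e\<close>. A set of pairs is convenient later: the sums over it are
  contractions with the tensor \<open>\<Sum> b \<otimes> e\<close>, in which the choice of the basis does not matter.\<close>

lemma dual_basis_exists:
  "\<exists>J :: ('v \<times> 'v) set. finite J \<and> (\<forall>v. v = (\<Sum>(b, e)\<in>J. scale (\<omega> e v) b))"
proof -
  obtain B where "finite_dimensional_vector_space scale B" using finite_dimensional by blast
  then interpret fd: finite_dimensional_vector_space scale B .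
  have fB: "finite B" and sp: "\<And>v. v \<in> span B" and ind: "independent B"
    using fd.finite_Basis fd.span_Basis fd.independent_Basis by auto
  have rep: "v = (\<Sum>b\<in>B. scale (representation B v b) b)" for v
    using sum_representation_eq[OF ind sp fB order_refl] by simp
  have repl: "Vector_Spaces.linear scale (*) (\<lambda>v. representation B v b)" for b
    using representation_add[OF ind sp sp] representation_scale[OF ind sp] by (simp add: linear_form_iff)
  let ?T = "\<lambda>x. \<Sum>b\<in>B. scale (\<omega> x b) b"
  have lin: "Vector_Spaces.linear scale scale ?T"
    by unfold_locales (auto simp: sum.distrib scale_left_distrib scale_sum_right)
  have "inj ?T"
  proof (rule injI)
    fix x y assume eq: "?T x = ?T y"
    have "representation B (?T z) b = (if b \<in> B then \<omega> z b else 0)" for z b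
      by (subst representation_sum[OF ind]) (auto simp: representation_scale[OF ind] sp span_scale span_base
         representation_basis[OF ind] if_distrib sum.delta fB cong: if_cong)
    then have eqb: "\<omega> x b = \<omega> y b" if "b \<in> B" for b using eq that by metis
    show "x = y"
    proof (rule omega_eqI)
      fix v
      show "\<omega> x v = \<omega> y v" by (subst (1 2) rep[of v]) (simp add: omega_sum_right eqb)
    qed
  qed
  then have surj: "surj ?T" using fd.linear_inj_imp_surj[OF lin] by blast
  have "\<exists>e. \<forall>v. \<omega> e v = representation B v b" if b: "b \<in> B" for b
  proof -
    obtain e where e: "?T e = b" using surjD[OF surj, of b] by (elim exE) (rule that, simp)
    have "representation B (?T e) b' = (if b' \<in> B then \<omega> e b' else 0)" for b'
      by (subst representation_sum[OF ind]) (auto simp: representation_scale[OF ind] sp span_scale span_base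
         representation_basis[OF ind] if_distrib sum.delta fB cong: if_cong)
    then have eb: "\<omega> e b' = (if b' = b then 1 else 0)" if "b' \<in> B" for b'
      using that e representation_basis[OF ind b] by (simp split: if_splits)
    have "\<omega> e v = representation B v b" for v
      by (subst rep[of v]) (simp add: omega_sum_right eb b fB if_distrib sum.delta cong: if_cong)
    then show ?thesis by blast
  qed
  then obtain d where d: "\<And>b v. b \<in> B \<Longrightarrow> \<omega> (d b) v = representation B v b" by metis
  show ?thesis
  proof (intro exI conjI allI)
    show "finite ((\<lambda>b. (b, d b)) ` B)" using fB by simp
    show "v = (\<Sum>(b, e)\<in>(\<lambda>b. (b, d b)) ` B. scale (\<omega> e v) b)" for v
    proof -
      have "(\<Sum>(b, e)\<in>(\<lambda>b. (b, d b)) ` B. scale (\<omega> e v) b) = (\<Sum>b\<in>B. scale (representation B v b) b)"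
        by (subst sum.reindex) (auto simp: inj_on_def d)
      then show ?thesis using rep[of v] by simp
    qed
  qed
qed

definition dual_basis :: "('v \<times> 'v) set" where
  "dual_basis = (SOME J. finite J \<and> (\<forall>v. v = (\<Sum>(b, e)\<in>J. scale (\<omega> e v) b)))"

lemma finite_dual_basis [simp]: "finite dual_basis"
  and dual_basis_left: "(\<Sum>(b, e)\<in>dual_basis. scale (\<omega> e v) b) = v"
  using someI_ex[OF dual_basis_exists] unfolding dual_basis_def[symmetric] by auto

lemma dual_basis_right: "(\<Sum>(b, e)\<in>dual_basis. scale (\<omega> u b) e) = u"
proof (rule omega_eqI)
  fix v
  have "\<omega> (\<Sum>(b, e)\<in>dual_basis. scale (\<omega> u b) e) v = \<omega> u (\<Sum>(b, e)\<in>dual_basis. scale (\<omega> e v) b)"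
    by (simp add: omega_sum_left omega_sum_right split_beta mult.commute)
  then show "\<omega> (\<Sum>(b, e)\<in>dual_basis. scale (\<omega> u b) e) v = \<omega> u v" by (simp add: dual_basis_left)
qed

lemma group_pow: "\<gamma> \<in> \<Gamma> \<Longrightarrow> \<gamma> ^^ k \<in> \<Gamma>"
  by (induction k) auto

text \<open>Suppose that all displacements are multiples of \<open>z = \<gamma> x - x\<close>. As \<open>\<gamma>\<close> preserves \<open>\<omega>\<close>, fixed vectors are
  orthogonal to \<open>z\<close>. If \<open>\<gamma>\<close> fixes \<open>z\<close>, it is a transvection, which has infinite order; otherwise \<open>V\<close> is
  spanned by \<open>z\<close> and fixed vectors, so \<open>z\<close> is orthogonal to \<open>V\<close>. Consequently fixed point sets of
  nontrivial elements have codimension at least two, on which the coprimality arguments rest.\<close>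

lemma displacement_not_in_line:
  assumes g: "\<gamma> \<in> \<Gamma>" "\<gamma> \<noteq> id"
  shows "\<exists>x. \<forall>k. \<gamma> x - x \<noteq> scale k w"
proof (rule ccontr)
  assume "\<not> ?thesis"
  then have line: "\<exists>k. \<gamma> x - x = scale k w" for x by blast
  obtain x where x: "\<gamma> x \<noteq> x" using g(2) by (auto simp: fun_eq_iff)
  define z where "z = \<gamma> x - x"
  have z0: "z \<noteq> 0" using x by (simp add: z_def)
  obtain k where k: "z = scale k w" using line z_def by blast
  then have "k \<noteq> 0" using z0 by auto
  then have w: "w = scale (1 / k) z" by (simp add: k)
  have linez: "\<exists>k. \<gamma> y - y = scale k z" for y
    using line[of y] unfolding w by auto
  have orth: "\<omega> z y = 0" if "\<gamma> y = y" for y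
    using group_omega[OF g(1), of x y] that by (simp add: z_def)
  obtain l where l: "\<gamma> z - z = scale l z" using linez by blast
  show False
  proof (cases "l = 0")
    case True
    then have gz: "\<gamma> z = z" using l by simp
    have pw: "(\<gamma> ^^ j) x = x + scale (of_nat j) z" for j
    proof (induction j)
      case (Suc j)
      have "\<gamma> x = x + z" by (simp add: z_def)
      then show ?case using Suc g(1) gz by (simp add: scale_left_distrib algebra_simps)
    qed simp
    obtain m where m: "m > 0" "\<gamma> ^^ m = id"
      using funpow_id_ex[OF finite_group group_pow[OF g(1)] group_bij[OF g(1)]] by blast
    then have "scale (of_nat m) z = 0" using pw[of m] by simp
    then show False using m z0 by simp
  next
    case False
    have "\<omega> z y = 0" for y
    proof -
      obtain k where k: "\<gamma> y - y = scale k z" using linez by blast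
      have "\<gamma> (y - scale (k / l) z) - (y - scale (k / l) z) = (\<gamma> y - y) - scale (k / l) (\<gamma> z - z)"
        using g(1) by (simp add: algebra_simps)
      also have "\<dots> = 0" using False by (simp add: k l)
      finally have "\<omega> z (y - scale (k / l) z) = 0" by (intro orth) simp
      then show ?thesis by simp
    qed
    then show False using omega_nondegenerate z0 by blast
  qed
qed

subsection \<open>The forms \<open>\<omega>\<^sub>s\<close>\<close>

lemma refl_group: "s \<in> refl \<Longrightarrow> s \<in> \<Gamma>"
  by (simp add: symplectic_reflections_def)

lemma id_not_refl: "id \<notin> refl"
proof
  assume "id \<in> refl"
  then have "dim (im_1_minus (id :: 'v \<Rightarrow> 'v)) = 2" by (simp add: symplectic_reflections_def)
  moreover have "im_1_minus (id :: 'v \<Rightarrow> 'v) = {0}" by (auto simp: im_1_minus_def)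
  moreover have "dim {0} \<le> card ({} :: 'v set)" by (rule dim_le_card) (auto simp: span_zero)
  ultimately show False by simp
qed

lemma reflection_form: "s \<in> \<Gamma> \<Longrightarrow> is_reflection_form scale \<omega> s (\<omega>s s)"
  unfolding reflection_form_def
  by (rule theI'[OF reflection_form_unique_exists[OF symplectic_vector_space_axioms subgroup finite_group]])

lemma reflection_form_eqI: "s \<in> \<Gamma> \<Longrightarrow> is_reflection_form scale \<omega> s w \<Longrightarrow> \<omega>s s = w"
  using reflection_form_unique_exists[OF symplectic_vector_space_axioms subgroup finite_group] reflection_form
  by blast

lemma reflection_form_bilinear:
  assumes "s \<in> \<Gamma>"
  shows "\<omega>s s (x + y) z = \<omega>s s x z + \<omega>s s y z" "\<omega>s s z (x + y) = \<omega>s s z x + \<omega>s s z y"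
    "\<omega>s s (scale a x) z = a * \<omega>s s x z" "\<omega>s s z (scale a x) = a * \<omega>s s z x"
    "\<omega>s s (x - y) z = \<omega>s s x z - \<omega>s s y z" "\<omega>s s z (x - y) = \<omega>s s z x - \<omega>s s z y"
  using reflection_form[OF assms] bilinear_formD[of "\<omega>s s"] by (auto simp: is_reflection_form_def)

lemma reflection_form_skew: "s \<in> \<Gamma> \<Longrightarrow> \<omega>s s x y = - \<omega>s s y x"
  using reflection_form[of s] unfolding is_reflection_form_def skew_symmetric_def by blast

lemma reflection_form_fixed: "s \<in> \<Gamma> \<Longrightarrow> s x = x \<Longrightarrow> \<omega>s s x y = 0"
  using reflection_form[of s] by (auto simp: is_reflection_form_def radical_def ker_1_minus_def)

text \<open>The right hand side, transported by \<open>\<gamma>\<close>, has the properties that characterise the form of the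
  conjugate.\<close>

lemma reflection_form_conj:
  assumes g: "\<gamma> \<in> \<Gamma>" and s: "s \<in> \<Gamma>"
  shows "\<omega>s (\<gamma> \<circ> s \<circ> ginv \<gamma>) (\<gamma> x) (\<gamma> y) = \<omega>s s x y"
proof -
  let ?w = "\<lambda>x y. \<omega>s s (ginv \<gamma> x) (ginv \<gamma> y)"
  have r: "is_reflection_form scale \<omega> s (\<omega>s s)" by (rule reflection_form[OF s])
  have "is_reflection_form scale \<omega> (\<gamma> \<circ> s \<circ> ginv \<gamma>) ?w"
    unfolding is_reflection_form_def
  proof (intro conjI ballI)
    show "bilinear_form scale ?w"
      unfolding bilinear_form_def linear_form_iff using g by (simp add: reflection_form_bilinear[OF s])
    show "skew_symmetric ?w" using reflection_form_skew[OF s] unfolding skew_symmetric_def by blast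
    have "x \<in> radical ?w \<longleftrightarrow> ginv \<gamma> x \<in> radical (\<omega>s s)" for x
      using g by (auto simp: radical_def) (metis ginv_left)
    also have "\<dots> x \<longleftrightarrow> ginv \<gamma> x = s (ginv \<gamma> x)" for x
      using r by (auto simp: is_reflection_form_def ker_1_minus_def)
    also have "\<dots> x \<longleftrightarrow> x \<in> ker_1_minus (\<gamma> \<circ> s \<circ> ginv \<gamma>)" for x
      using g by (auto simp: ker_1_minus_def) (metis ginv_left)
    finally show "radical ?w = ker_1_minus (\<gamma> \<circ> s \<circ> ginv \<gamma>)" by blast
    have im: "ginv \<gamma> x \<in> im_1_minus s" if x: "x \<in> im_1_minus (\<gamma> \<circ> s \<circ> ginv \<gamma>)" for x
    proof -
      obtain v where "x = v - \<gamma> (s (ginv \<gamma> v))" using x by (auto simp: im_1_minus_def)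
      then have "ginv \<gamma> x = ginv \<gamma> v - s (ginv \<gamma> v)" using g by simp
      then show ?thesis by (auto simp: im_1_minus_def)
    qed
    fix x y assume "x \<in> im_1_minus (\<gamma> \<circ> s \<circ> ginv \<gamma>)" "y \<in> im_1_minus (\<gamma> \<circ> s \<circ> ginv \<gamma>)"
    then show "?w x y = \<omega> x y" using im r g by (auto simp: is_reflection_form_def)
  qed
  then have "\<omega>s (\<gamma> \<circ> s \<circ> ginv \<gamma>) = ?w" using g s by (intro reflection_form_eqI) auto
  then show ?thesis using g by simp
qed

lemma refl_conj:
  assumes g: "\<gamma> \<in> \<Gamma>" and s: "s \<in> refl"
  shows "\<gamma> \<circ> s \<circ> ginv \<gamma> \<in> refl"
proof -
  obtain B where "finite_dimensional_vector_space scale B" using finite_dimensional by blast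
  then interpret fd: finite_dimensional_vector_space scale B .
  interpret p: finite_dimensional_vector_space_pair_1 scale B scale by unfold_locales
  have "im_1_minus (\<gamma> \<circ> s \<circ> ginv \<gamma>) = \<gamma> ` im_1_minus s"
  proof -
    have "range (\<lambda>x. x - \<gamma> (s (ginv \<gamma> x))) = (\<lambda>x. \<gamma> (ginv \<gamma> x - s (ginv \<gamma> x))) ` UNIV"
      using g by simp
    also have "\<dots> = (\<lambda>x. \<gamma> (x - s x)) ` (ginv \<gamma> ` UNIV)" by (simp only: image_image)
    also have "ginv \<gamma> ` UNIV = UNIV" using g by (metis ginv_left surjI)
    finally show ?thesis unfolding im_1_minus_def by (simp only: image_image o_apply)
  qed
  moreover have "dim (\<gamma> ` im_1_minus s) = dim (im_1_minus s)"
    by (rule p.dim_image_eq[OF group_linear[OF g]]) (meson bij_is_inj g group_bij inj_on_subset subset_UNIV)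
  ultimately show ?thesis using s g by (auto simp: symplectic_reflections_def)
qed

lemma bij_betw_conj_refl: "\<gamma> \<in> \<Gamma> \<Longrightarrow> bij_betw (\<lambda>s. \<gamma> \<circ> s \<circ> ginv \<gamma>) refl refl"
  using refl_conj[of \<gamma>] refl_conj[of "ginv \<gamma>"]
  by (intro bij_betwI[where g = "\<lambda>\<delta>. ginv \<gamma> \<circ> \<delta> \<circ> \<gamma>"]) (auto simp: comp_assoc)

lemma c_conj: "\<gamma> \<in> \<Gamma> \<Longrightarrow> s \<in> refl \<Longrightarrow> c (\<gamma> \<circ> s \<circ> ginv \<gamma>) = c s"
  using invariant by (auto simp: conj_invariant_def)

lemma dependent_in_plane:
  assumes "dim U = 2" "x \<in> U" "y \<in> U" "z \<in> U"
  shows "\<exists>k l m. scale k x + scale l y + scale m z = 0 \<and> (k \<noteq> 0 \<or> l \<noteq> 0 \<or> m \<noteq> 0)"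
proof -
  obtain B where "finite_dimensional_vector_space scale B" using finite_dimensional by blast
  then interpret fd: finite_dimensional_vector_space scale B .
  consider "x = y" | "y = z" | "x = z" | "x \<noteq> y" "y \<noteq> z" "x \<noteq> z" by blast
  then show ?thesis
  proof cases
    case 1 then show ?thesis by (intro exI[of _ 1] exI[of _ "-1"] exI[of _ 0]) simp
  next
    case 2 then show ?thesis by (intro exI[of _ 0] exI[of _ 1] exI[of _ "-1"]) simp
  next
    case 3 then show ?thesis by (intro exI[of _ 1] exI[of _ 0] exI[of _ "-1"]) simp
  next
    case 4
    then have "card {x, y, z} = 3" by simp
    then have "dependent {x, y, z}"
      using fd.independent_card_le_dim[of "{x, y, z}" U] assms by fastforce
    then obtain u where "\<exists>v\<in>{x, y, z}. u v \<noteq> 0" "(\<Sum>v\<in>{x, y, z}. scale (u v) v) = 0"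
      using dependent_finite[of "{x, y, z}"] by auto
    then show ?thesis using 4
      by (intro exI[of _ "u x"] exI[of _ "u y"] exI[of _ "u z"]) (auto simp: add.assoc)
  qed
qed

text \<open>The left hand side is alternating and trilinear in the images of \<open>x\<close>, \<open>y\<close>, \<open>z\<close> in \<open>V / Ker(1 - s)\<close>,
  which is a plane. This is the Jacobi identity for three vectors, and the reason why the
  defining relations allow only reflections.\<close>

lemma reflection_form_jacobi:
  assumes s: "s \<in> refl"
  shows "scale (\<omega>s s x y) (s z - z) + scale (\<omega>s s y z) (s x - x) + scale (\<omega>s s z x) (s y - y) = 0"
proof -
  have sG: "s \<in> \<Gamma>" by (rule refl_group[OF s])
  let ?w = "\<omega>s s"
  have main: "scale (?w x y) (s z - z) + scale (?w y z) (s x - x) + scale (?w z x) (s y - y) = 0"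
    if m: "m \<noteq> 0" and dep: "scale k (s x - x) + scale l (s y - y) + scale m (s z - z) = 0" for x y z k l m
  proof -
    define f where "f = z + scale (k / m) x + scale (l / m) y"
    have "s f - f = scale (1 / m) (scale k (s x - x) + scale l (s y - y) + scale m (s z - z))"
      using m sG by (simp add: f_def scale_right_distrib scale_right_diff_distrib algebra_simps)
    then have fx: "s f = f" using dep by simp
    have f0: "?w f u = 0" "?w u f = 0" for u
      using reflection_form_fixed[OF sG fx] reflection_form_skew[OF sG, of u f] by auto
    have z: "z = f - scale (k / m) x - scale (l / m) y" by (simp add: f_def)
    have sz: "s z - z = - (scale (k / m) (s x - x)) - scale (l / m) (s y - y)"
      using fx sG unfolding z by (simp add: algebra_simps scale_right_diff_distrib)
    have xx: "?w u u = 0" for u using reflection_form_skew[OF sG, of u u] by simp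
    have w1: "?w y z = - (k / m) * ?w y x" "?w z x = - (l / m) * ?w y x"
      unfolding z by (simp_all add: reflection_form_bilinear[OF sG] f0 xx)
    have w2: "?w x y = - ?w y x" by (rule reflection_form_skew[OF sG])
    show ?thesis unfolding sz w1 w2
      by (simp add: algebra_simps scale_right_diff_distrib scale_minus_left)
  qed
  have "\<exists>k l m. scale k (x - s x) + scale l (y - s y) + scale m (z - s z) = 0 \<and> (k \<noteq> 0 \<or> l \<noteq> 0 \<or> m \<noteq> 0)"
    using s by (intro dependent_in_plane[of "im_1_minus s"]) (auto simp: symplectic_reflections_def im_1_minus_def)
  then obtain k l m where klm: "k \<noteq> 0 \<or> l \<noteq> 0 \<or> m \<noteq> 0"
    and dep: "scale k (x - s x) + scale l (y - s y) + scale m (z - s z) = 0" by blast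
  have dep': "scale k (s x - x) + scale l (s y - y) + scale m (s z - z) = 0"
  proof -
    have "scale k (s x - x) + scale l (s y - y) + scale m (s z - z)
      = - (scale k (x - s x) + scale l (y - s y) + scale m (z - s z))" by (simp add: algebra_simps)
    then show ?thesis using dep by simp
  qed
  from klm show ?thesis
  proof (elim disjE)
    assume "m \<noteq> 0" from main[OF this dep'] show ?thesis .
  next
    assume "k \<noteq> 0" from main[OF this, of l y m z x] dep' show ?thesis by (simp add: algebra_simps)
  next
    assume "l \<noteq> 0" from main[OF this, of m z k x y] dep' show ?thesis by (simp add: algebra_simps)
  qed
qed

end

section \<open>Polynomial functions on a symplectic vector space\<close>

context symplectic_reflection_data
begin

text \<open>Homogeneous polynomial functions. The form identifies \<open>V\<close> with its dual, so a vector \<open>v\<close> is the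
  linear function \<open>\<lambda>u. \<omega> u v\<close>. Degrees are integers so that
  derivatives and quotients need no case distinctions: polynomials of negative degree are zero.\<close>

inductive pol :: "int \<Rightarrow> ('v \<Rightarrow> complex) \<Rightarrow> bool" where
  pol_zero [simp]: "pol k (\<lambda>u. 0)"
| pol_const: "pol 0 (\<lambda>u. a)"
| pol_mult_form: "pol k f \<Longrightarrow> pol (k + 1) (\<lambda>u. \<omega> u v * f u)"
| pol_add: "pol k f \<Longrightarrow> pol k g \<Longrightarrow> pol k (\<lambda>u. f u + g u)"

lemma pol_cong: "pol k f \<Longrightarrow> k = l \<Longrightarrow> (\<And>u. f u = g u) \<Longrightarrow> pol l g"
  by (metis ext)

lemma pol_neg: "pol k f \<Longrightarrow> k < 0 \<Longrightarrow> f u = 0"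
  by (induction rule: pol.induct) auto

lemma pol_const' [simp]: "k = 0 \<Longrightarrow> pol k (\<lambda>u. a)"
  using pol_const by simp

lemma pol_scale: "pol k f \<Longrightarrow> pol k (\<lambda>u. a * f u)"
proof (induction rule: pol.induct)
  case (pol_mult_form k f v)
  then have "pol (k + 1) (\<lambda>u. \<omega> u v * (a * f u))" by (intro pol.pol_mult_form)
  then show ?case by (simp add: mult.left_commute)
next
  case (pol_add k f g)
  then show ?case by (simp add: distrib_left pol.pol_add)
qed auto

lemma pol_uminus: "pol k f \<Longrightarrow> pol k (\<lambda>u. - f u)"
  using pol_scale[of k f "-1"] by simp

lemma pol_diff: "pol k f \<Longrightarrow> pol k g \<Longrightarrow> pol k (\<lambda>u. f u - g u)"
  using pol_add[of k f "\<lambda>u. - g u"] pol_uminus[of k g] by simp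

lemma pol_sum: "(\<And>i. i \<in> I \<Longrightarrow> pol k (f i)) \<Longrightarrow> pol k (\<lambda>u. \<Sum>i\<in>I. f i u)"
  by (induction I rule: infinite_finite_induct) (auto intro: pol_add)

lemma pol_mult: "pol i f \<Longrightarrow> pol j g \<Longrightarrow> pol (i + j) (\<lambda>u. f u * g u)"
proof (induction rule: pol.induct)
  case (pol_const a)
  then show ?case by (simp add: pol_scale)
next
  case (pol_mult_form k f v)
  then have "pol (k + j + 1) (\<lambda>u. \<omega> u v * (f u * g u))" by (intro pol.pol_mult_form) auto
  then show ?case by (rule pol_cong) (auto simp: mult.assoc)
next
  case (pol_add k f f')
  then show ?case by (simp add: distrib_right pol.pol_add)
qed auto

lemma pol_form: "pol 1 (\<lambda>u. \<omega> u v)"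
  using pol_mult_form[OF pol_const[of 1], of v] by simp

lemma pol_power: "pol k f \<Longrightarrow> pol (int n * k) (\<lambda>u. f u ^ n)"
proof (induction n)
  case (Suc n)
  then show ?case using pol_mult[of k f "int n * k" "\<lambda>u. f u ^ n"]
    by (auto simp: algebra_simps)
qed simp

lemma pol_prod_forms: "finite I \<Longrightarrow> pol (int (card I)) (\<lambda>u. \<Prod>i\<in>I. \<omega> u (w i))"
proof (induction I rule: finite_induct)
  case (insert i I)
  then have "pol (int (card I) + 1) (\<lambda>u. \<omega> u (w i) * (\<Prod>i\<in>I. \<omega> u (w i)))" by (intro pol_mult_form)
  then show ?case using insert by (simp add: add.commute)
qed simp

lemma pol_group: "pol k f \<Longrightarrow> \<gamma> \<in> \<Gamma> \<Longrightarrow> pol k (\<lambda>u. f (ginv \<gamma> u))"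
  by (induction rule: pol.induct) (auto simp: omega_ginv intro: pol.intros)

subsection \<open>Directional derivatives\<close>

lemma line_poly_exists: "pol k f \<Longrightarrow> \<exists>p. \<forall>s. poly p s = f (u + scale s e)"
proof (induction rule: pol.induct)
  case (pol_zero k) then show ?case by (intro exI[of _ 0]) simp
next
  case (pol_const a) then show ?case by (intro exI[of _ "[:a:]"]) simp
next
  case (pol_mult_form k f v)
  then obtain p where "\<forall>s. poly p s = f (u + scale s e)" by blast
  then show ?case by (intro exI[of _ "[:\<omega> u v, \<omega> e v:] * p"]) (simp add: algebra_simps)
next
  case (pol_add k f g)
  then obtain p q where "\<forall>s. poly p s = f (u + scale s e)" "\<forall>s. poly q s = g (u + scale s e)" by blast
  then show ?case by (intro exI[of _ "p + q"]) simp
qed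

text \<open>The restriction of a polynomial function to a line is a polynomial in one variable, unique because
  the field is infinite. It serves to define derivatives and to reduce vanishing questions to one
  variable.\<close>

definition line_poly :: "('v \<Rightarrow> complex) \<Rightarrow> 'v \<Rightarrow> 'v \<Rightarrow> complex poly" where
  "line_poly f u e = (THE p. \<forall>s. poly p s = f (u + scale s e))"

lemma line_polyI: "(\<And>s. poly p s = f (u + scale s e)) \<Longrightarrow> line_poly f u e = p"
  unfolding line_poly_def
proof (rule the_equality)
  fix q assume "\<And>s. poly p s = f (u + scale s e)" "\<forall>s. poly q s = f (u + scale s e)"
  then have "poly p = poly q" by (auto simp: fun_eq_iff)
  then show "q = p" by (simp add: poly_eq_poly_eq_iff)
qed simp

lemma poly_line_poly: "pol k f \<Longrightarrow> poly (line_poly f u e) s = f (u + scale s e)"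
  using line_poly_exists[of k f u e] line_polyI by metis

definition dd :: "'v \<Rightarrow> ('v \<Rightarrow> complex) \<Rightarrow> 'v \<Rightarrow> complex" where
  "dd e f u = coeff (line_poly f u e) 1"

lemma coeff_0_line_poly: "pol k f \<Longrightarrow> coeff (line_poly f u e) 0 = f u"
  using poly_line_poly[of k f u e 0] by (simp add: poly_0_coeff_0)

lemma dd_const [simp]: "dd e (\<lambda>u. a) u = 0"
proof -
  have "line_poly (\<lambda>u. a) u e = [:a:]" by (rule line_polyI) simp
  then show ?thesis by (simp add: dd_def)
qed

lemma dd_add:
  assumes "pol k f" "pol k g"
  shows "dd e (\<lambda>u. f u + g u) u = dd e f u + dd e g u"
proof -
  have "line_poly (\<lambda>u. f u + g u) u e = line_poly f u e + line_poly g u e"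
    by (rule line_polyI) (simp add: poly_line_poly[OF assms(1)] poly_line_poly[OF assms(2)])
  then show ?thesis by (simp add: dd_def)
qed

lemma dd_scale:
  assumes "pol k f"
  shows "dd e (\<lambda>u. a * f u) u = a * dd e f u"
proof -
  have "line_poly (\<lambda>u. a * f u) u e = smult a (line_poly f u e)"
    by (rule line_polyI) (simp add: poly_line_poly[OF assms])
  then show ?thesis by (simp add: dd_def)
qed

lemma dd_mult_form:
  assumes "pol k f"
  shows "dd e (\<lambda>u. \<omega> u v * f u) u = \<omega> e v * f u + \<omega> u v * dd e f u"
proof -
  have "line_poly (\<lambda>u. \<omega> u v * f u) u e = [:\<omega> u v, \<omega> e v:] * line_poly f u e"
    by (rule line_polyI) (simp add: poly_line_poly[OF assms] algebra_simps)
  then show ?thesis by (simp add: dd_def coeff_0_line_poly[OF assms])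
qed

lemma pol_dd: "pol k f \<Longrightarrow> pol (k - 1) (dd e f)"
proof (induction rule: pol.induct)
  case (pol_zero k)
  have "pol (k - 1) (\<lambda>u. 0)" by simp
  then show ?case by (rule pol_cong) auto
next
  case (pol_const a)
  have "pol (0 - 1) (\<lambda>u. 0)" by simp
  then show ?case by (rule pol_cong) auto
next
  case (pol_mult_form k f v)
  have "pol (k - 1 + 1) (\<lambda>u. \<omega> u v * dd e f u)" by (rule pol.pol_mult_form) (fact pol_mult_form)
  then have "pol k (\<lambda>u. \<omega> e v * f u + \<omega> u v * dd e f u)"
    using pol_mult_form by (intro pol_add pol_scale) auto
  then show ?case by (rule pol_cong) (auto simp: dd_mult_form[OF pol_mult_form(1)])
next
  case (pol_add k f g)
  then have "pol (k - 1) (\<lambda>u. dd e f u + dd e g u)" by (intro pol.pol_add)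
  then show ?case by (rule pol_cong) (auto simp: dd_add[OF pol_add(1,2)])
qed

lemma dd_direction_add: "pol k f \<Longrightarrow> dd (e + e') f u = dd e f u + dd e' f u"
proof (induction rule: pol.induct)
  case (pol_mult_form k f v)
  then show ?case by (simp add: dd_mult_form[OF pol_mult_form(1)]) (simp add: algebra_simps)
qed (simp_all add: dd_add)

lemma dd_direction_scale: "pol k f \<Longrightarrow> dd (scale a e) f u = a * dd e f u"
proof (induction rule: pol.induct)
  case (pol_mult_form k f v)
  then show ?case by (simp add: dd_mult_form[OF pol_mult_form(1)]) (simp add: algebra_simps)
qed (simp_all add: dd_add distrib_left)

lemma dd_direction_zero: "pol k f \<Longrightarrow> dd 0 f u = 0"
  using dd_direction_scale[of k f 0 0 u] by simp

lemma dd_direction_sum: "pol k f \<Longrightarrow> dd (\<Sum>i\<in>I. g i) f u = (\<Sum>i\<in>I. dd (g i) f u)"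
  by (induction I rule: infinite_finite_induct) (auto simp: dd_direction_add dd_direction_zero)

lemma dd_group: "\<gamma> \<in> \<Gamma> \<Longrightarrow> dd e (\<lambda>u. f (ginv \<gamma> u)) u = dd (ginv \<gamma> e) f (ginv \<gamma> u)"
  unfolding dd_def line_poly_def by simp

text \<open>The operator on the left is the derivation that fixes every linear form. The identity recovers a
  polynomial of nonzero degree from its derivatives; it drives all recursions on the degree below.\<close>

lemma euler: "pol k f \<Longrightarrow> (\<Sum>(b, e)\<in>dual_basis. \<omega> u b * dd e f u) = of_int k * f u"
proof (induction rule: pol.induct)
  case (pol_mult_form k f v)
  have "(\<Sum>(b, e)\<in>dual_basis. \<omega> u b * dd e (\<lambda>u. \<omega> u v * f u) u) =
      (\<Sum>(b, e)\<in>dual_basis. \<omega> u (scale (\<omega> e v) b) * f u + \<omega> u v * (\<omega> u b * dd e f u))"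
    by (intro sum.cong refl) (simp add: dd_mult_form[OF pol_mult_form(1)] split_beta ring_distribs)
  also have "\<dots> = \<omega> u (\<Sum>(b, e)\<in>dual_basis. scale (\<omega> e v) b) * f u
      + \<omega> u v * (\<Sum>(b, e)\<in>dual_basis. \<omega> u b * dd e f u)"
    by (simp add: case_prod_unfold sum.distrib omega_sum_right sum_distrib_left sum_distrib_right)
  also have "\<dots> = of_int (k + 1) * (\<omega> u v * f u)"
    unfolding dual_basis_left pol_mult_form.IH by (simp add: algebra_simps)
  finally show ?case .
next
  case (pol_add k f g)
  have "(\<Sum>(b, e)\<in>dual_basis. \<omega> u b * dd e (\<lambda>u. f u + g u) u) =
      (\<Sum>(b, e)\<in>dual_basis. \<omega> u b * dd e f u) + (\<Sum>(b, e)\<in>dual_basis. \<omega> u b * dd e g u)"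
    unfolding sum.distrib[symmetric]
    by (intro sum.cong) (auto simp: dd_add[OF pol_add(1,2)] algebra_simps)
  then show ?case using pol_add by (simp add: algebra_simps)
qed auto

subsection \<open>Divisibility by linear forms\<close>

lemma pol_eq_0_on_line:
  assumes "pol k f" "finite {s. f (u + scale s e) \<noteq> 0}"
  shows "f u = 0"
proof (rule ccontr)
  assume "f u \<noteq> 0"
  let ?p = "line_poly f u e"
  have p: "poly ?p s = f (u + scale s e)" for s by (rule poly_line_poly[OF assms(1)])
  have "?p \<noteq> 0" using p[of 0] \<open>f u \<noteq> 0\<close> by auto
  then have "finite {s. poly ?p s = 0}" by (rule poly_roots_finite)
  then have "finite ({s. f (u + scale s e) = 0} \<union> {s. f (u + scale s e) \<noteq> 0})"
    using assms(2) by (simp add: p)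
  moreover have "{s. f (u + scale s e) = 0} \<union> {s. f (u + scale s e) \<noteq> 0} = UNIV" by blast
  ultimately show False using infinite_UNIV_char_0[where 'a = complex] by simp
qed

lemma finite_affine_zero:
  assumes "b \<noteq> (0::complex)" shows "finite {s. a + s * b = 0}"
proof -
  have "{s. a + s * b = 0} \<subseteq> {- a / b}" using assms by (auto simp: field_simps eq_neg_iff_add_eq_0 add.commute)
  then show ?thesis by (rule finite_subset) simp
qed

lemma form_value_one: "w \<noteq> 0 \<Longrightarrow> \<exists>e. \<omega> e w = 1"
proof -
  assume "w \<noteq> 0"
  then obtain y where "\<omega> w y \<noteq> 0" using omega_nondegenerate by blast
  then have "\<omega> y w \<noteq> 0" using omega_skew[of y w] by simp
  then show ?thesis by (intro exI[of _ "scale (1 / \<omega> y w) y"]) simp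
qed

lemma form_cancel:
  assumes "pol k f" "w \<noteq> 0" "\<And>u. \<omega> u w * f u = 0"
  shows "f u = 0"
proof -
  obtain e where e: "\<omega> e w = 1" using form_value_one assms(2) by blast
  have "{s. f (u + scale s e) \<noteq> 0} \<subseteq> {s. \<omega> u w + s * 1 = 0}"
    using assms(3)[of "u + scale _ e"] e by auto
  then have "finite {s. f (u + scale s e) \<noteq> 0}"
    by (rule finite_subset) (rule finite_affine_zero, simp)
  then show ?thesis by (rule pol_eq_0_on_line[OF assms(1)])
qed

lemma form_divides:
  assumes f: "pol k f" and w: "w \<noteq> 0" and van: "\<And>u. \<omega> u w = 0 \<Longrightarrow> f u = 0"
  shows "\<exists>q. pol (k - 1) q \<and> f = (\<lambda>u. \<omega> u w * q u)"
proof -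
  obtain e where e: "\<omega> e w = 1" using form_value_one w by blast
  \<comment> \<open>Division with remainder, the remainder being constant along \<open>e\<close>.\<close>
  have "\<exists>q r. pol (k - 1) q \<and> pol k r \<and> (\<forall>u s. r (u + scale s e) = r u) \<and> (\<forall>u. f u = \<omega> u w * q u + r u)"
    using f
  proof (induction rule: pol.induct)
    case (pol_zero k)
    show ?case by (intro exI[of _ "\<lambda>u. 0"]) auto
  next
    case (pol_const a)
    show ?case by (intro exI[of _ "\<lambda>u. 0"] exI[of _ "\<lambda>u. a"]) auto
  next
    case (pol_mult_form k f v)
    then obtain q r where qr: "pol (k - 1) q" "pol k r" "\<And>u s. r (u + scale s e) = r u"
      "\<And>u. f u = \<omega> u w * q u + r u" by blast
    define v0 where "v0 = v - scale (\<omega> e v) w"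
    have "pol (k - 1 + 1) (\<lambda>u. \<omega> u v * q u)" by (intro pol.pol_mult_form qr)
    then have "pol k (\<lambda>u. \<omega> u v * q u + \<omega> e v * r u)" using qr(2) by (intro pol.pol_add pol_scale) auto
    moreover have "pol (k + 1) (\<lambda>u. \<omega> u v0 * r u)" by (intro pol.pol_mult_form qr)
    moreover have "\<omega> u v * f u = \<omega> u w * (\<omega> u v * q u + \<omega> e v * r u) + \<omega> u v0 * r u" for u
      by (simp add: v0_def qr(4) algebra_simps)
    moreover have "\<omega> (u + scale s e) v0 * r (u + scale s e) = \<omega> u v0 * r u" for u s
      by (simp add: v0_def e qr(3) algebra_simps)
    ultimately show ?case by (intro exI[of _ "\<lambda>u. \<omega> u v * q u + \<omega> e v * r u"] exI[of _ "\<lambda>u. \<omega> u v0 * r u"]) auto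
  next
    case (pol_add k f g)
    then obtain q r q' r' where qr: "pol (k - 1) q" "pol k r" "\<And>u s. r (u + scale s e) = r u"
      "\<And>u. f u = \<omega> u w * q u + r u" "pol (k - 1) q'" "pol k r'" "\<And>u s. r' (u + scale s e) = r' u"
      "\<And>u. g u = \<omega> u w * q' u + r' u" by blast
    then show ?case
      by (intro exI[of _ "\<lambda>u. q u + q' u"] exI[of _ "\<lambda>u. r u + r' u"])
        (auto intro: pol.pol_add simp: algebra_simps)
  qed
  then obtain q r where qr: "pol (k - 1) q" "\<And>u s. r (u + scale s e) = r u"
    "\<And>u. f u = \<omega> u w * q u + r u" by blast
  have "r u = 0" for u
  proof -
    let ?u = "u + scale (- \<omega> u w) e"
    have "\<omega> ?u w = 0" by (simp add: e)
    with van[of ?u] qr(3)[of ?u] have "r ?u = 0" by (simp del: omega_simps)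
    then show ?thesis by (simp only: qr(2))
  qed
  then show ?thesis using qr by (intro exI[of _ q]) auto
qed

text \<open>Coprimality of independent linear forms: on the hyperplane \<open>w1 = 0\<close> the form \<open>w2\<close> is not constant
  in a suitable direction, so \<open>f\<close> vanishes at all but one point of each line in that direction.\<close>

lemma form_prime:
  assumes f: "pol k f" and w: "w1 \<noteq> 0" "\<And>a. w2 \<noteq> scale a w1"
    and van: "\<And>u. \<omega> u w1 = 0 \<Longrightarrow> \<omega> u w2 * f u = 0" and u: "\<omega> u w1 = 0"
  shows "f u = 0"
proof -
  have "\<exists>e. \<omega> e w1 = 0 \<and> \<omega> e w2 \<noteq> 0"
  proof (rule ccontr)
    assume no: "\<not> ?thesis"
    obtain e1 where e1: "\<omega> e1 w1 = 1" using form_value_one w by blast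
    have "\<omega> w2 y = \<omega> (scale (\<omega> e1 w2) w1) y" for y
    proof -
      have "\<omega> (y - scale (\<omega> y w1) e1) w1 = 0" by (simp add: e1)
      then have "\<omega> (y - scale (\<omega> y w1) e1) w2 = 0" using no by blast
      then show ?thesis using omega_skew[of w2 y] omega_skew[of w1 y] by simp
    qed
    then show False using w(2) omega_eqI by blast
  qed
  then obtain e where e: "\<omega> e w1 = 0" "\<omega> e w2 \<noteq> 0" by blast
  have "{s. f (u + scale s e) \<noteq> 0} \<subseteq> {s. \<omega> u w2 + s * \<omega> e w2 = 0}"
    using van[of "u + scale _ e"] e(1) u by auto
  then have "finite {s. f (u + scale s e) \<noteq> 0}"
    by (rule finite_subset) (rule finite_affine_zero, fact)
  then show ?thesis by (rule pol_eq_0_on_line[OF f])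
qed

lemma forms_prime:
  assumes J: "finite J" and f: "pol k f" and w: "w \<noteq> 0" "\<And>j a. j \<in> J \<Longrightarrow> w' j \<noteq> scale a w"
    and van: "\<And>u. \<omega> u w = 0 \<Longrightarrow> (\<Prod>j\<in>J. \<omega> u (w' j)) * f u = 0" and u: "\<omega> u w = 0"
  shows "f u = 0"
  using J w(2) van
proof (induction J rule: finite_induct)
  case empty
  then show ?case using u by simp
next
  case (insert j J)
  show ?case
  proof (rule insert.IH)
    show "w' i \<noteq> scale a w" if "i \<in> J" for i a using that insert by blast
    fix x assume x: "\<omega> x w = 0"
    show "(\<Prod>i\<in>J. \<omega> x (w' i)) * f x = 0"
      by (rule form_prime[where f = "\<lambda>u. (\<Prod>i\<in>J. \<omega> u (w' i)) * f u" and ?w1.0 = w and ?w2.0 = "w' j"])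
        (use insert x w(1) f in \<open>auto intro: pol_mult pol_prod_forms simp: mult.assoc\<close>)
  qed
qed

text \<open>Unique factorisation, for products of linear forms: the factors \<open>w i\<close> are split off one after the
  other, since none of them divides the right hand product.\<close>

lemma forms_divide:
  assumes I: "finite I" and J: "finite J"
    and wI: "\<And>i. i \<in> I \<Longrightarrow> w i \<noteq> 0" and wJ: "\<And>i j a. i \<in> I \<Longrightarrow> j \<in> J \<Longrightarrow> w' j \<noteq> scale a (w i)"
    and q: "pol k q" and f: "pol m f" and deg: "k + int (card I) = m + int (card J)"
    and eq: "\<And>u. (\<Prod>i\<in>I. \<omega> u (w i)) * q u = (\<Prod>j\<in>J. \<omega> u (w' j)) * f u"
  shows "\<exists>r. pol (m - int (card I)) r \<and> f = (\<lambda>u. (\<Prod>i\<in>I. \<omega> u (w i)) * r u)"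
  using I wI wJ f deg eq
proof (induction I arbitrary: f m rule: finite_induct)
  case empty
  then show ?case by (intro exI[of _ f]) auto
next
  case (insert i I)
  have wi: "w i \<noteq> 0" using insert by blast
  have "\<exists>g. pol (m - 1) g \<and> f = (\<lambda>u. \<omega> u (w i) * g u)"
  proof (rule form_divides[OF _ wi])
    fix u assume u: "\<omega> u (w i) = 0"
    have "w' j \<noteq> scale a (w i)" if "j \<in> J" for j a using insert.prems(2) that by blast
    moreover have "(\<Prod>j\<in>J. \<omega> x (w' j)) * f x = 0" if "\<omega> x (w i) = 0" for x
      using insert.prems(5)[of x] insert.hyps that by simp
    ultimately show "f u = 0"
      using forms_prime[OF J insert.prems(3) wi, of w' u] u by blast
  qed fact
  then obtain g where g: "pol (m - 1) g" and fg: "f = (\<lambda>u. \<omega> u (w i) * g u)" by blast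
  have "(\<Prod>i\<in>I. \<omega> u (w i)) * q u - (\<Prod>j\<in>J. \<omega> u (w' j)) * g u = 0" for u
  proof (rule form_cancel[OF _ wi])
    have "pol (int (card I) + k) (\<lambda>u. (\<Prod>i\<in>I. \<omega> u (w i)) * q u)"
      using insert by (intro pol_mult pol_prod_forms q) auto
    moreover have "int (card I) + k = int (card J) + (m - 1)" using insert by simp
    moreover have "pol (int (card J) + (m - 1)) (\<lambda>u. (\<Prod>j\<in>J. \<omega> u (w' j)) * g u)"
      by (intro pol_mult pol_prod_forms g J)
    ultimately show "pol (int (card J) + (m - 1)) (\<lambda>u. (\<Prod>i\<in>I. \<omega> u (w i)) * q u - (\<Prod>j\<in>J. \<omega> u (w' j)) * g u)"
      by (intro pol_diff) auto
    show "\<omega> u (w i) * ((\<Prod>i\<in>I. \<omega> u (w i)) * q u - (\<Prod>j\<in>J. \<omega> u (w' j)) * g u) = 0" for u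
      using insert.prems(5)[of u] insert.hyps by (simp add: fg algebra_simps)
  qed
  then have "\<exists>r. pol (m - 1 - int (card I)) r \<and> g = (\<lambda>u. (\<Prod>i\<in>I. \<omega> u (w i)) * r u)"
    using insert by (intro insert.IH g) auto
  then obtain r where r: "pol (m - 1 - int (card I)) r" "g = (\<lambda>u. (\<Prod>i\<in>I. \<omega> u (w i)) * r u)" by blast
  show ?case
  proof (intro exI conjI)
    show "pol (m - int (card (insert i I))) r" using r(1) insert.hyps by (simp add: algebra_simps)
    show "f = (\<lambda>u. (\<Prod>i\<in>insert i I. \<omega> u (w i)) * r u)"
      using insert.hyps by (simp add: fg r(2) mult.assoc)
  qed
qed

subsection \<open>Generic vectors\<close>

text \<open>A line through \<open>v\<close> meets a subspace that does not contain \<open>v\<close> in at most one point.\<close>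

lemma generic_translate:
  assumes fin: "finite \<U>" and sub: "\<And>U. U \<in> \<U> \<Longrightarrow> subspace U" and v: "\<And>U. U \<in> \<U> \<Longrightarrow> v \<notin> U"
  shows "\<exists>s. s \<noteq> 0 \<and> (\<forall>U\<in>\<U>. v + scale s w \<notin> U)"
proof -
  have one: "finite {s. v + scale s w \<in> U}" if U: "U \<in> \<U>" for U
  proof -
    have "s = s'" if s: "v + scale s w \<in> U" "v + scale s' w \<in> U" for s s'
    proof (rule ccontr)
      assume ne: "s \<noteq> s'"
      have "scale (1 / (s - s')) ((v + scale s w) - (v + scale s' w)) \<in> U"
        using s sub[OF U] by (intro subspace_scale subspace_diff)
      then have "w \<in> U" using ne by (simp flip: scale_left_diff_distrib)
      then have "(v + scale s w) - scale s w \<in> U" using s sub[OF U] by (intro subspace_scale subspace_diff)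
      then show False using v[OF U] by simp
    qed
    then have "{s. v + scale s w \<in> U} \<subseteq> {SOME s. v + scale s w \<in> U}"
      by (metis (mono_tags, lifting) insertI1 mem_Collect_eq someI subsetI)
    then show ?thesis by (rule finite_subset) simp
  qed
  have "finite (insert 0 (\<Union>U\<in>\<U>. {s. v + scale s w \<in> U}))" using fin one by auto
  then obtain s where "s \<notin> insert 0 (\<Union>U\<in>\<U>. {s. v + scale s w \<in> U})"
    using ex_new_if_finite[OF infinite_UNIV_char_0[where 'a = complex]] by blast
  then show ?thesis by auto
qed

lemma generic_exists:
  assumes "finite \<U>" "\<And>U. U \<in> \<U> \<Longrightarrow> subspace U \<and> U \<noteq> UNIV"
  shows "\<exists>v. \<forall>U\<in>\<U>. v \<notin> U"
  using assms
proof (induction \<U> rule: finite_induct)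
  case (insert U \<U>)
  then obtain v where v: "\<forall>U\<in>\<U>. v \<notin> U" by blast
  show ?case
  proof (cases "v \<in> U")
    case True
    have sU: "subspace U" "U \<noteq> UNIV" using insert by auto
    then obtain w where w: "w \<notin> U" by blast
    obtain s where s: "s \<noteq> 0" "\<forall>U\<in>\<U>. v + scale s w \<notin> U"
      using generic_translate[of \<U> v w] insert v by blast
    have "v + scale s w \<notin> U"
    proof
      assume "v + scale s w \<in> U"
      then have "scale (1 / s) ((v + scale s w) - v) \<in> U" using True sU by (intro subspace_scale subspace_diff)
      then show False using w s by simp
    qed
    then show ?thesis using s by blast
  qed (use v in blast)
qed simp

text \<open>A linear function is determined by its values off finitely many proper subspaces, because
  \<open>w\<close> is a combination of the generic vectors \<open>v\<close> and \<open>v + s w\<close>.\<close>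

lemma vanish_if_vanish_generic:
  assumes fin: "finite \<U>" and sub: "\<And>U. U \<in> \<U> \<Longrightarrow> subspace U \<and> U \<noteq> UNIV"
    and van: "\<And>v. (\<And>U. U \<in> \<U> \<Longrightarrow> v \<notin> U) \<Longrightarrow> F v = (0::complex)"
    and add: "\<And>x y. F (x + y) = F x + F y" and sc: "\<And>a x. F (scale a x) = a * F x"
  shows "F w = 0"
proof -
  obtain v where v: "\<forall>U\<in>\<U>. v \<notin> U" using generic_exists[OF fin sub] by blast
  then obtain s where s: "s \<noteq> 0" "\<forall>U\<in>\<U>. v + scale s w \<notin> U"
    using generic_translate[of \<U> v w] fin sub by blast
  have "F v = 0" "F (v + scale s w) = 0" using v s by (auto intro: van)
  then show ?thesis using s by (simp add: add sc)
qed

definition generic :: "'v \<Rightarrow> bool" where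
  "generic v \<longleftrightarrow> (\<forall>\<gamma>\<in>\<Gamma> - {id}. \<gamma> v \<noteq> v)"

text \<open>This condition makes the linear forms \<open>v - \<gamma> v\<close> coprime to the linear forms \<open>w - \<delta> w\<close>.\<close>

definition generic_pair :: "'v \<Rightarrow> 'v \<Rightarrow> bool" where
  "generic_pair v w \<longleftrightarrow> (\<forall>\<gamma>\<in>\<Gamma> - {id}. \<forall>\<delta>\<in>\<Gamma> - {id}. \<forall>a. w - \<delta> w \<noteq> scale a (v - \<gamma> v))"

lemma vanish_if_vanish_on_generic:
  assumes "\<And>v. generic v \<Longrightarrow> F v = (0::complex)"
    and "\<And>x y. F (x + y) = F x + F y" and "\<And>a x. F (scale a x) = a * F x"
  shows "F w = 0"
proof (rule vanish_if_vanish_generic)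
  show "finite ((\<lambda>\<gamma>. {v. \<gamma> v = v}) ` (\<Gamma> - {id}))" using finite_group by simp
  show "subspace U \<and> U \<noteq> UNIV" if "U \<in> (\<lambda>\<gamma>. {v. \<gamma> v = v}) ` (\<Gamma> - {id})" for U
  proof -
    obtain \<gamma> where g: "\<gamma> \<in> \<Gamma>" "\<gamma> \<noteq> id" and U: "U = {v. \<gamma> v = v}" using \<open>U \<in> _\<close> by blast
    then obtain x where "x \<notin> U" by (auto simp: fun_eq_iff)
    moreover have "subspace U" using g by (auto simp: U subspace_def)
    ultimately show ?thesis by blast
  qed
  show "F v = 0" if "\<And>U. U \<in> (\<lambda>\<gamma>. {v. \<gamma> v = v}) ` (\<Gamma> - {id}) \<Longrightarrow> v \<notin> U" for v
    using that by (intro assms(1)) (auto simp: generic_def)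
qed (fact assms)+

text \<open>For given \<open>\<gamma>\<close>, \<open>\<delta>\<close> the excluded vectors \<open>w\<close> form a subspace; it is proper because \<open>\<delta>\<close> displaces
  vectors in two directions.\<close>

lemma vanish_if_vanish_on_generic_pair:
  assumes "\<And>w. generic w \<Longrightarrow> generic_pair v w \<Longrightarrow> F w = (0::complex)"
    and "\<And>x y. F (x + y) = F x + F y" and "\<And>a x. F (scale a x) = a * F x"
  shows "F w = 0"
proof (rule vanish_if_vanish_generic)
  let ?U = "\<lambda>p. {w. \<exists>a. w - snd p w = scale a (v - fst p v)}"
  show "finite (?U ` ((\<Gamma> - {id}) \<times> (\<Gamma> - {id})))" using finite_group by simp
  show "subspace U \<and> U \<noteq> UNIV" if UU: "U \<in> ?U ` ((\<Gamma> - {id}) \<times> (\<Gamma> - {id}))" for U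
  proof -
    obtain p where p: "p \<in> (\<Gamma> - {id}) \<times> (\<Gamma> - {id})" "U = ?U p" using UU by blast
    obtain \<gamma> \<delta> where "p = (\<gamma>, \<delta>)" by (cases p)
    then have g: "\<gamma> \<in> \<Gamma>" "\<gamma> \<noteq> id" "\<delta> \<in> \<Gamma>" "\<delta> \<noteq> id" and U: "U = ?U (\<gamma>, \<delta>)" using p by auto
    obtain x where x: "\<And>k. \<delta> x - x \<noteq> scale k (v - \<gamma> v)" using displacement_not_in_line[OF g(3,4)] by blast
    have "x \<notin> U"
    proof
      assume "x \<in> U"
      then obtain a where "x - \<delta> x = scale a (v - \<gamma> v)" by (auto simp: U)
      then have "\<delta> x - x = scale (- a) (v - \<gamma> v)" by (metis minus_diff_eq scale_minus_left)
      then show False using x by blast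
    qed
    moreover have "subspace U"
    proof (rule subspaceI)
      show "0 \<in> U" using g by (auto simp: U intro: exI[of _ 0])
      show "x + y \<in> U" if xy: "x \<in> U" "y \<in> U" for x y
      proof -
        obtain a b where "x - \<delta> x = scale a (v - \<gamma> v)" "y - \<delta> y = scale b (v - \<gamma> v)"
          using xy by (auto simp: U)
        then have "(x + y) - \<delta> (x + y) = scale (a + b) (v - \<gamma> v)"
          using g by (simp add: scale_left_distrib del: scale_right_diff_distrib) (metis add_diff_add)
        then show ?thesis by (auto simp: U)
      qed
      show "scale b x \<in> U" if xy: "x \<in> U" for x b
      proof -
        obtain a where "x - \<delta> x = scale a (v - \<gamma> v)" using xy by (auto simp: U)
        then have "scale b x - \<delta> (scale b x) = scale (b * a) (v - \<gamma> v)"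
          using g by (metis group_scale scale_right_diff_distrib scale_scale)
        then show ?thesis by (auto simp: U)
      qed
    qed
    ultimately show ?thesis by blast
  qed
  show "F w = 0" if w: "\<And>U. U \<in> ?U ` ((\<Gamma> - {id}) \<times> (\<Gamma> - {id})) \<Longrightarrow> w \<notin> U" for w
  proof (rule assms(1))
    have ne: "w - \<delta> w \<noteq> scale a (v - \<gamma> v)" if "\<gamma> \<in> \<Gamma>" "\<gamma> \<noteq> id" "\<delta> \<in> \<Gamma>" "\<delta> \<noteq> id" for \<gamma> \<delta> a
    proof -
      have "?U (\<gamma>, \<delta>) \<in> ?U ` ((\<Gamma> - {id}) \<times> (\<Gamma> - {id}))" using that by (intro imageI) auto
      from w[OF this] show ?thesis by auto
    qed
    then show "generic_pair v w" by (auto simp: generic_pair_def)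
    show "generic w" using ne[of _ _ 0] by (force simp: generic_def)
  qed
qed (fact assms)+

subsection \<open>The characteristic polynomial of a vector\<close>

text \<open>The polynomial \<open>\<Prod> (X - \<gamma> v)\<close> over \<open>\<complex>[V]\<close>, evaluated at the point \<open>u\<close>. Its coefficients are invariant and
  \<open>v\<close> is a root, so it exhibits \<open>v\<close> as integral over the invariants.\<close>

definition char_poly_at :: "'v \<Rightarrow> 'v \<Rightarrow> complex poly" where
  "char_poly_at v u = (\<Prod>\<gamma>\<in>\<Gamma>. [:- \<omega> u (\<gamma> v), 1:])"

definition char_coeff :: "'v \<Rightarrow> nat \<Rightarrow> 'v \<Rightarrow> complex" where
  "char_coeff v i u = coeff (char_poly_at v u) i"

lemma pol_char_coeff: "pol (int (card \<Gamma>) - int i) (char_coeff v i)"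
proof -
  have "pol (int (card T) - int i) (\<lambda>u. coeff (\<Prod>\<gamma>\<in>T. [:- \<omega> u (\<gamma> v), 1:]) i)" if "finite T" for T
    using that
  proof (induction T arbitrary: i rule: finite_induct)
    case empty
    show ?case by (cases i) auto
  next
    case (insert \<gamma> T)
    have "pol (int (card T) - int i + 1) (\<lambda>u. \<omega> u (\<gamma> v) * coeff (\<Prod>\<gamma>\<in>T. [:- \<omega> u (\<gamma> v), 1:]) i)"
      by (intro pol_mult_form insert)
    then have 1: "pol (int (card (insert \<gamma> T)) - int i) (\<lambda>u. - (\<omega> u (\<gamma> v) * coeff (\<Prod>\<gamma>\<in>T. [:- \<omega> u (\<gamma> v), 1:]) i))"
      using insert.hyps by (intro pol_uminus) (simp add: algebra_simps)
    show ?case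
    proof (cases i)
      case 0
      then show ?thesis using 1 insert.hyps by simp
    next
      case (Suc j)
      have "pol (int (card (insert \<gamma> T)) - int i) (\<lambda>u. coeff (\<Prod>\<gamma>\<in>T. [:- \<omega> u (\<gamma> v), 1:]) j)"
        using insert.IH[of j] insert.hyps Suc by simp
      from pol_add[OF 1 this] show ?thesis using insert.hyps Suc by simp
    qed
  qed
  from this[OF finite_group] show ?thesis by (simp add: char_coeff_def[abs_def] char_poly_at_def)
qed

lemma char_poly_at_group: "\<gamma> \<in> \<Gamma> \<Longrightarrow> char_poly_at v (ginv \<gamma> u) = char_poly_at v u"
  unfolding char_poly_at_def
  using prod.reindex_bij_betw[OF bij_betw_comp_left[of \<gamma>], of "\<lambda>\<delta>. [:- \<omega> u (\<delta> v), 1:]"]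
  by (simp add: omega_ginv)

lemma char_coeff_group: "\<gamma> \<in> \<Gamma> \<Longrightarrow> char_coeff v i (ginv \<gamma> u) = char_coeff v i u"
  by (simp add: char_coeff_def char_poly_at_group)

lemma degree_char_poly_at: "degree (char_poly_at v u) = card \<Gamma>"
  unfolding char_poly_at_def by (subst degree_prod_eq_sum_degree) auto

lemma char_coeff_top: "char_coeff v (card \<Gamma>) u = 1"
proof -
  have "lead_coeff (char_poly_at v u) = 1" unfolding char_poly_at_def lead_coeff_prod by simp
  then show ?thesis by (simp add: char_coeff_def degree_char_poly_at)
qed

lemma char_coeff_root: "(\<Sum>i\<le>card \<Gamma>. char_coeff v i u * \<omega> u v ^ i) = 0"
proof -
  have "poly (char_poly_at v u) (\<omega> u v) = 0"
    unfolding char_poly_at_def poly_prod using finite_group by (intro prod_zero) (auto intro!: bexI[of _ id])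
  then show ?thesis by (simp add: poly_altdef degree_char_poly_at char_coeff_def)
qed

text \<open>The derivative of a product of linear factors, evaluated at the root of one of them, is the product
  of the other factors.\<close>

lemma char_coeff_derivative:
  "(\<Sum>i\<le>card \<Gamma>. char_coeff v i u * (of_nat i * \<omega> u v ^ (i - 1))) = (\<Prod>\<gamma>\<in>\<Gamma> - {id}. \<omega> u (v - \<gamma> v))"
proof -
  let ?p = "char_poly_at v u"
  let ?x = "\<omega> u v"
  have "?p = [:- ?x, 1:] * (\<Prod>\<gamma>\<in>\<Gamma> - {id}. [:- \<omega> u (\<gamma> v), 1:])"
    unfolding char_poly_at_def by (subst prod.remove[of _ id]) (auto simp: finite_group)
  then have 1: "poly (pderiv ?p) ?x = (\<Prod>\<gamma>\<in>\<Gamma> - {id}. \<omega> u (v - \<gamma> v))"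
    by (simp only: pderiv_mult) (simp add: pderiv_pCons poly_prod)
  have "?p = (\<Sum>i\<le>card \<Gamma>. monom (coeff ?p i) i)"
    using poly_as_sum_of_monoms[of ?p] by (simp add: degree_char_poly_at)
  then have "pderiv ?p = pderiv (\<Sum>i\<le>card \<Gamma>. monom (coeff ?p i) i)" by simp
  also have "\<dots> = (\<Sum>i\<le>card \<Gamma>. pderiv (monom (coeff ?p i) i))"
    using higher_pderiv_sum[of 1 "\<lambda>i. monom (coeff ?p i) i" "{..card \<Gamma>}"] by simp
  also have "\<dots> = (\<Sum>i\<le>card \<Gamma>. monom (of_nat i * coeff ?p i) (i - 1))"
    by (simp add: pderiv_monom)
  finally have "poly (pderiv ?p) ?x = (\<Sum>i\<le>card \<Gamma>. char_coeff v i u * (of_nat i * ?x ^ (i - 1)))"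
    by (simp add: poly_sum poly_monom char_coeff_def algebra_simps)
  then show ?thesis using 1 by simp
qed

declare group_lin [simp del] group_omega [simp del] ginv_right [simp del]

end

section \<open>The PBW theorem\<close>

text \<open>A vector of the PBW module \<open>S(V) \<otimes> \<complex>\<Gamma>\<close> is given by its coordinates: for a degree, a group
  element and a point of \<open>V\<close>, the value at that point of the homogeneous polynomial in question. The
  type does not depend on the data; the conditions that cut out the module are in \<open>graded\<close> below.\<close>

typedef 'v pbw = "UNIV :: (int \<Rightarrow> ('v \<Rightarrow> 'v) \<Rightarrow> 'v \<Rightarrow> complex) set"
  morphisms coord pbw ..

lemma coord_pbw [simp]: "coord (pbw f) = f"
  by (simp add: pbw_inverse)

lemma pbw_eqI: "(\<And>k \<delta> u. coord \<mu> k \<delta> u = coord \<nu> k \<delta> u) \<Longrightarrow> \<mu> = \<nu>"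
  by (metis coord_inject ext)

instantiation pbw :: (type) ab_group_add
begin

definition zero_pbw :: "'a pbw" where "0 = pbw (\<lambda>k \<delta> u. 0)"
definition plus_pbw :: "'a pbw \<Rightarrow> 'a pbw \<Rightarrow> 'a pbw" where
  "\<mu> + \<nu> = pbw (\<lambda>k \<delta> u. coord \<mu> k \<delta> u + coord \<nu> k \<delta> u)"
definition minus_pbw :: "'a pbw \<Rightarrow> 'a pbw \<Rightarrow> 'a pbw" where
  "\<mu> - \<nu> = pbw (\<lambda>k \<delta> u. coord \<mu> k \<delta> u - coord \<nu> k \<delta> u)"
definition uminus_pbw :: "'a pbw \<Rightarrow> 'a pbw" where
  "- \<mu> = pbw (\<lambda>k \<delta> u. - coord \<mu> k \<delta> u)"

instance
  by standard (auto simp: zero_pbw_def plus_pbw_def minus_pbw_def uminus_pbw_def intro!: pbw_eqI)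

end

lemma coord_simps [simp]: "coord 0 k \<delta> u = 0" "coord (\<mu> + \<nu>) k \<delta> u = coord \<mu> k \<delta> u + coord \<nu> k \<delta> u"
  "coord (\<mu> - \<nu>) k \<delta> u = coord \<mu> k \<delta> u - coord \<nu> k \<delta> u" "coord (- \<mu>) k \<delta> u = - coord \<mu> k \<delta> u"
  by (simp_all add: zero_pbw_def plus_pbw_def minus_pbw_def uminus_pbw_def)

lemma coord_sum: "coord (\<Sum>i\<in>I. f i) k \<delta> u = (\<Sum>i\<in>I. coord (f i) k \<delta> u)"
  by (induction I rule: infinite_finite_induct) auto

definition smul :: "complex \<Rightarrow> 'v pbw \<Rightarrow> 'v pbw" where
  "smul a \<mu> = pbw (\<lambda>k \<delta> u. a * coord \<mu> k \<delta> u)"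

lemma coord_smul [simp]: "coord (smul a \<mu>) k \<delta> u = a * coord \<mu> k \<delta> u"
  by (simp add: smul_def)

lemma smul_simps [simp]: "smul a (\<mu> + \<nu>) = smul a \<mu> + smul a \<nu>" "smul a (\<mu> - \<nu>) = smul a \<mu> - smul a \<nu>"
  "smul a (smul b \<mu>) = smul (a * b) \<mu>" "smul 1 \<mu> = \<mu>" "smul 0 \<mu> = 0" "smul a 0 = 0" "smul a (- \<mu>) = - smul a \<mu>"
  by (auto intro!: pbw_eqI simp: algebra_simps)

lemma smul_left: "smul (a + b) \<mu> = smul a \<mu> + smul b \<mu>" "smul (a - b) \<mu> = smul a \<mu> - smul b \<mu>"
  "smul (- a) \<mu> = - smul a \<mu>"
  by (auto intro!: pbw_eqI simp: algebra_simps)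

lemma smul_sum: "smul a (\<Sum>i\<in>I. f i) = (\<Sum>i\<in>I. smul a (f i))"
  by (induction I rule: infinite_finite_induct) auto

lemma additive_sum:
  fixes T :: "'b::ab_group_add \<Rightarrow> 'c::ab_group_add"
  assumes "\<And>\<mu> \<nu>. Q \<mu> \<Longrightarrow> Q \<nu> \<Longrightarrow> T (\<mu> + \<nu>) = T \<mu> + T \<nu>"
    and "Q 0" "\<And>\<mu> \<nu>. Q \<mu> \<Longrightarrow> Q \<nu> \<Longrightarrow> Q (\<mu> + \<nu>)" "\<And>i. i \<in> I \<Longrightarrow> Q (f i)"
  shows "T (\<Sum>i\<in>I. f i) = (\<Sum>i\<in>I. T (f i))"
proof -
  have z: "T 0 = 0" using assms(1)[of 0 0] assms(2) by simp
  have "Q (\<Sum>i\<in>I. f i) \<and> T (\<Sum>i\<in>I. f i) = (\<Sum>i\<in>I. T (f i))"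
    using assms(4) by (induction I rule: infinite_finite_induct) (auto simp: z assms)
  then show ?thesis ..
qed

context symplectic_reflection_data
begin

text \<open>The conditions that cut out \<open>\<complex>[V] \<otimes> \<complex>\<Gamma>\<close>, except that infinitely many degrees may occur.\<close>

definition graded :: "'v pbw \<Rightarrow> bool" where
  "graded \<mu> \<longleftrightarrow> (\<forall>k \<delta>. pol k (coord \<mu> k \<delta>)) \<and> (\<forall>k \<delta> u. \<delta> \<notin> \<Gamma> \<longrightarrow> coord \<mu> k \<delta> u = 0)"

definition below :: "nat \<Rightarrow> 'v pbw \<Rightarrow> bool" where
  "below N \<mu> \<longleftrightarrow> (\<forall>k\<ge>int N. \<forall>\<delta> u. coord \<mu> k \<delta> u = 0)"

text \<open>The operators from which the action is built: multiplication by a vector, the action of \<open>\<Gamma>\<close>,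
  derivatives, projections to a degree, and finally \<open>K\<close>, which the commutator of two vectors has to be.\<close>

definition X :: "'v \<Rightarrow> 'v pbw \<Rightarrow> 'v pbw" where
  "X x \<mu> = pbw (\<lambda>k \<delta> u. \<omega> u x * coord \<mu> (k - 1) \<delta> u)"

definition G :: "('v \<Rightarrow> 'v) \<Rightarrow> 'v pbw \<Rightarrow> 'v pbw" where
  "G \<gamma> \<mu> = pbw (\<lambda>k \<delta> u. coord \<mu> k (ginv \<gamma> \<circ> \<delta>) (ginv \<gamma> u))"

definition D :: "'v \<Rightarrow> 'v pbw \<Rightarrow> 'v pbw" where
  "D e \<mu> = pbw (\<lambda>k \<delta>. dd e (coord \<mu> (k + 1) \<delta>))"

definition P :: "nat \<Rightarrow> 'v pbw \<Rightarrow> 'v pbw" where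
  "P n \<mu> = pbw (\<lambda>k \<delta> u. if k = int n then coord \<mu> k \<delta> u else 0)"

definition K :: "'v \<Rightarrow> 'v \<Rightarrow> 'v pbw \<Rightarrow> 'v pbw" where
  "K x y \<mu> = smul (t * \<omega> x y) \<mu> + (\<Sum>s\<in>refl. smul (c s * \<omega>s s x y) (G s \<mu>))"

text \<open>\<open>x\<close> acts as \<open>X x + \<Sum>\<^sub>n C n x\<close>, where \<open>C n\<close> concerns the part of degree \<open>n\<close> and takes values in degrees
  below \<open>n\<close>. The commutation relation in degree \<open>n\<close> reads
  \<open>C (n+1) x (y \<mu>) - C (n+1) y (x \<mu>) = B n x y \<mu>\<close>, where \<open>B\<close>, defined below and unfolded here, involves only \<open>C m\<close> with
  \<open>m \<le> n\<close>. This says that the Koszul coboundary of \<open>C (n+1)\<close> is \<open>B n\<close>, and the solution chosen is the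
  standard homotopy, contraction with the Euler field, divided by its weight \<open>n + 2\<close>.\<close>

fun C :: "nat \<Rightarrow> 'v \<Rightarrow> 'v pbw \<Rightarrow> 'v pbw" where
  "C 0 x \<mu> = 0"
| "C (Suc n) x \<mu> = smul (1 / of_nat (n + 2)) (\<Sum>p\<in>dual_basis.
     K x (fst p) (P n (D (snd p) \<mu>))
     - (X x (C n (fst p) (D (snd p) \<mu>)) + (\<Sum>m<n. C m x (C n (fst p) (D (snd p) \<mu>))))
     + (X (fst p) (C n x (D (snd p) \<mu>)) + (\<Sum>m<n. C m (fst p) (C n x (D (snd p) \<mu>)))))"

definition Lt :: "nat \<Rightarrow> 'v \<Rightarrow> 'v pbw \<Rightarrow> 'v pbw" where
  "Lt n x \<mu> = X x \<mu> + (\<Sum>m<n. C m x \<mu>)"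

definition B :: "nat \<Rightarrow> 'v \<Rightarrow> 'v \<Rightarrow> 'v pbw \<Rightarrow> 'v pbw" where
  "B n x y \<mu> = K x y (P n \<mu>) - Lt n x (C n y \<mu>) + Lt n y (C n x \<mu>)"

lemma C_Suc: "C (Suc n) x \<mu> = smul (1 / of_nat (n + 2)) (\<Sum>p\<in>dual_basis. B n x (fst p) (D (snd p) \<mu>))"
  by (simp add: B_def Lt_def)

declare C.simps(2) [simp del]

subsection \<open>Elementary operators\<close>

lemma coord_X [simp]: "coord (X x \<mu>) k \<delta> u = \<omega> u x * coord \<mu> (k - 1) \<delta> u"
  and coord_G [simp]: "coord (G \<gamma> \<mu>) k \<delta> u = coord \<mu> k (ginv \<gamma> \<circ> \<delta>) (ginv \<gamma> u)"
  and coord_D [simp]: "coord (D e \<mu>) k \<delta> u = dd e (coord \<mu> (k + 1) \<delta>) u"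
  and coord_P [simp]: "coord (P n \<mu>) k \<delta> u = (if k = int n then coord \<mu> k \<delta> u else 0)"
  by (simp_all add: X_def G_def D_def P_def)

lemma graded_pol: "graded \<mu> \<Longrightarrow> pol k (coord \<mu> k \<delta>)"
  by (simp add: graded_def)

lemma gradedI: "(\<And>k \<delta>. pol k (\<lambda>u. coord \<mu> k \<delta> u)) \<Longrightarrow> (\<And>k \<delta> u. \<delta> \<notin> \<Gamma> \<Longrightarrow> coord \<mu> k \<delta> u = 0) \<Longrightarrow> graded \<mu>"
  by (simp add: graded_def)

lemma graded_outside: "graded \<mu> \<Longrightarrow> \<delta> \<notin> \<Gamma> \<Longrightarrow> coord \<mu> k \<delta> u = 0"
  by (simp add: graded_def)

lemma graded_0 [simp]: "graded 0"
  by (rule gradedI) auto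

lemma graded_add [intro]: "graded \<mu> \<Longrightarrow> graded \<nu> \<Longrightarrow> graded (\<mu> + \<nu>)"
  by (rule gradedI) (auto intro: pol_add graded_pol simp: graded_outside)

lemma graded_smul [intro]: "graded \<mu> \<Longrightarrow> graded (smul a \<mu>)"
  by (rule gradedI) (auto intro: pol_scale graded_pol simp: graded_outside)

lemma graded_diff [intro]: "graded \<mu> \<Longrightarrow> graded \<nu> \<Longrightarrow> graded (\<mu> - \<nu>)"
  using graded_add[of \<mu> "smul (-1) \<nu>"] graded_smul[of \<nu> "-1"] by (simp add: smul_left)

lemma graded_sum [intro]: "(\<And>i. i \<in> I \<Longrightarrow> graded (f i)) \<Longrightarrow> graded (\<Sum>i\<in>I. f i)"
  by (induction I rule: infinite_finite_induct) auto

lemma graded_X [intro]: "graded \<mu> \<Longrightarrow> graded (X x \<mu>)"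
proof (rule gradedI)
  fix k \<delta> assume "graded \<mu>"
  then have "pol (k - 1 + 1) (\<lambda>u. \<omega> u x * coord \<mu> (k - 1) \<delta> u)" by (intro pol_mult_form graded_pol)
  then show "pol k (\<lambda>u. coord (X x \<mu>) k \<delta> u)" by simp
qed (simp add: graded_outside)

lemma graded_G [intro]: "graded \<mu> \<Longrightarrow> \<gamma> \<in> \<Gamma> \<Longrightarrow> graded (G \<gamma> \<mu>)"
  by (rule gradedI) (auto intro: pol_group graded_pol simp: graded_outside)

lemma graded_D [intro]: "graded \<mu> \<Longrightarrow> graded (D e \<mu>)"
proof (rule gradedI)
  fix k \<delta> assume "graded \<mu>"
  then have "pol (k + 1 - 1) (dd e (coord \<mu> (k + 1) \<delta>))" by (intro pol_dd graded_pol)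
  then show "pol k (\<lambda>u. coord (D e \<mu>) k \<delta> u)" by simp
next
  fix k \<delta> u assume "graded \<mu>" "\<delta> \<notin> \<Gamma>"
  then have "coord \<mu> (k + 1) \<delta> = (\<lambda>u. 0)" by (auto simp: graded_outside)
  then show "coord (D e \<mu>) k \<delta> u = 0" by simp
qed

lemma graded_P [intro]: "graded \<mu> \<Longrightarrow> graded (P n \<mu>)"
proof (rule gradedI)
  show "pol k (\<lambda>u. coord (P n \<mu>) k \<delta> u)" if "graded \<mu>" for k \<delta>
    using graded_pol[OF that, of k \<delta>] by (cases "k = int n") auto
qed (auto simp: graded_outside)

lemma graded_K [intro]: "graded \<mu> \<Longrightarrow> graded (K x y \<mu>)"
  unfolding K_def by (intro graded_add graded_sum graded_smul graded_G) (auto simp: refl_group)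

lemma below_mono: "below N \<mu> \<Longrightarrow> N \<le> N' \<Longrightarrow> below N' \<mu>"
  by (auto simp: below_def)

lemma below_0 [simp]: "below N 0"
  and below_add [intro]: "below N \<mu> \<Longrightarrow> below N \<nu> \<Longrightarrow> below N (\<mu> + \<nu>)"
  and below_smul [intro]: "below N \<mu> \<Longrightarrow> below N (smul a \<mu>)"
  and below_diff [intro]: "below N \<mu> \<Longrightarrow> below N \<nu> \<Longrightarrow> below N (\<mu> - \<nu>)"
  and below_X [intro]: "below N \<mu> \<Longrightarrow> below (Suc N) (X x \<mu>)"
  and below_G [intro]: "below N \<mu> \<Longrightarrow> below N (G \<gamma> \<mu>)"
  and below_P [intro]: "below (Suc n) (P n \<mu>)"
  by (simp_all add: below_def)

lemma below_sum [intro]: "(\<And>i. i \<in> I \<Longrightarrow> below N (f i)) \<Longrightarrow> below N (\<Sum>i\<in>I. f i)"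
  by (induction I rule: infinite_finite_induct) auto

lemma below_K [intro]: "below N \<mu> \<Longrightarrow> below N (K x y \<mu>)" unfolding K_def by auto

lemma X_simps [simp]: "X x (\<mu> + \<nu>) = X x \<mu> + X x \<nu>" "X x (\<mu> - \<nu>) = X x \<mu> - X x \<nu>" "X x (smul a \<mu>) = smul a (X x \<mu>)"
  "X x 0 = 0" "X (x + y) \<mu> = X x \<mu> + X y \<mu>" "X (scale a x) \<mu> = smul a (X x \<mu>)"
  by (auto intro!: pbw_eqI simp: algebra_simps)

lemma X_commute: "X x (X y \<mu>) = X y (X x \<mu>)"
  by (auto intro!: pbw_eqI)

lemma G_simps [simp]: "G \<gamma> (\<mu> + \<nu>) = G \<gamma> \<mu> + G \<gamma> \<nu>" "G \<gamma> (\<mu> - \<nu>) = G \<gamma> \<mu> - G \<gamma> \<nu>" "G \<gamma> (smul a \<mu>) = smul a (G \<gamma> \<mu>)"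
  "G \<gamma> 0 = 0"
  by (auto intro!: pbw_eqI)

lemma G_sum: "G \<gamma> (\<Sum>i\<in>I. f i) = (\<Sum>i\<in>I. G \<gamma> (f i))"
  by (induction I rule: infinite_finite_induct) auto

lemma G_G: "\<gamma> \<in> \<Gamma> \<Longrightarrow> \<delta> \<in> \<Gamma> \<Longrightarrow> G \<gamma> (G \<delta> \<mu>) = G (\<gamma> \<circ> \<delta>) \<mu>"
  by (auto intro!: pbw_eqI simp: comp_assoc)

lemma G_id: "G id \<mu> = \<mu>"
  by (auto intro!: pbw_eqI simp: inv_id)

lemma G_X: "\<gamma> \<in> \<Gamma> \<Longrightarrow> G \<gamma> (X x \<mu>) = X (\<gamma> x) (G \<gamma> \<mu>)"
  by (auto intro!: pbw_eqI simp: omega_ginv)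

lemma G_P: "G \<gamma> (P n \<mu>) = P n (G \<gamma> \<mu>)"
  by (auto intro!: pbw_eqI)

lemma G_D: "\<gamma> \<in> \<Gamma> \<Longrightarrow> G \<gamma> (D e \<mu>) = D (\<gamma> e) (G \<gamma> \<mu>)"
proof (rule pbw_eqI)
  fix k \<delta> u assume g: "\<gamma> \<in> \<Gamma>"
  have "coord (G \<gamma> \<mu>) (k + 1) \<delta> = (\<lambda>u. coord \<mu> (k + 1) (ginv \<gamma> \<circ> \<delta>) (ginv \<gamma> u))" by auto
  then show "coord (G \<gamma> (D e \<mu>)) k \<delta> u = coord (D (\<gamma> e) (G \<gamma> \<mu>)) k \<delta> u" using g by (simp add: dd_group)
qed

lemma P_simps [simp]: "P n (\<mu> + \<nu>) = P n \<mu> + P n \<nu>" "P n (smul a \<mu>) = smul a (P n \<mu>)" "P n 0 = 0"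
  by (auto intro!: pbw_eqI)

lemma P_X: "P (Suc n) (X x \<mu>) = X x (P n \<mu>)"
  by (auto intro!: pbw_eqI)

lemma graded_neg: "graded \<mu> \<Longrightarrow> k < 0 \<Longrightarrow> coord \<mu> k \<delta> u = 0"
  using pol_neg[OF graded_pol] by blast

lemma sum_P: "graded \<mu> \<Longrightarrow> below N \<mu> \<Longrightarrow> (\<Sum>m<N. P m \<mu>) = \<mu>"
proof (rule pbw_eqI)
  fix k \<delta> u assume g: "graded \<mu>" and b: "below N \<mu>"
  show "coord (\<Sum>m<N. P m \<mu>) k \<delta> u = coord \<mu> k \<delta> u"
  proof (cases "0 \<le> k \<and> k < int N")
    case True
    then have "coord (\<Sum>m<N. P m \<mu>) k \<delta> u = (\<Sum>m<N. if m = nat k then coord \<mu> k \<delta> u else 0)"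
      unfolding coord_sum by (intro sum.cong) auto
    then show ?thesis using True by (simp add: nat_less_iff)
  next
    case False
    then have "coord \<mu> k \<delta> u = 0" using graded_neg[OF g] b by (auto simp: below_def)
    then show ?thesis unfolding coord_sum by (auto intro!: sum.neutral)
  qed
qed

lemma K_simps [simp]: "K x y (\<mu> + \<nu>) = K x y \<mu> + K x y \<nu>" "K x y (smul a \<mu>) = smul a (K x y \<mu>)"
  "K x y (\<mu> - \<nu>) = K x y \<mu> - K x y \<nu>" "K x y 0 = 0"
  by (auto simp: K_def sum.distrib sum_subtractf smul_sum mult.commute)

lemma K_sum: "K x y (\<Sum>i\<in>I. f i) = (\<Sum>i\<in>I. K x y (f i))"
  by (induction I rule: infinite_finite_induct) auto

lemma K_add_right: "K x (y + y') \<mu> = K x y \<mu> + K x y' \<mu>"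
  by (simp add: K_def refl_group reflection_form_bilinear smul_left distrib_left sum.distrib)

lemma K_scale_right: "K x (scale a y) \<mu> = smul a (K x y \<mu>)"
  by (simp add: K_def refl_group reflection_form_bilinear smul_sum mult.left_commute)

lemma K_skew: "K x y \<mu> = - K y x \<mu>"
proof -
  have "K x y \<mu> = smul (t * - \<omega> y x) \<mu> + (\<Sum>s\<in>refl. smul (c s * - \<omega>s s y x) (G s \<mu>))"
    unfolding K_def omega_skew[of x y]
    by (intro arg_cong2[where f = "(+)"] refl sum.cong) (simp add: reflection_form_skew[of _ x y] refl_group)
  then show ?thesis by (simp add: K_def smul_left sum_negf)
qed

lemma G_K: "\<gamma> \<in> \<Gamma> \<Longrightarrow> G \<gamma> (K x y \<mu>) = K (\<gamma> x) (\<gamma> y) (G \<gamma> \<mu>)"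
proof -
  assume g: "\<gamma> \<in> \<Gamma>"
  have "(\<Sum>s\<in>refl. smul (c s * \<omega>s s (\<gamma> x) (\<gamma> y)) (G s (G \<gamma> \<mu>)))
      = (\<Sum>s\<in>refl. smul (c (\<gamma> \<circ> s \<circ> ginv \<gamma>) * \<omega>s (\<gamma> \<circ> s \<circ> ginv \<gamma>) (\<gamma> x) (\<gamma> y)) (G (\<gamma> \<circ> s \<circ> ginv \<gamma>) (G \<gamma> \<mu>)))"
    by (rule sum.reindex_bij_betw[OF bij_betw_conj_refl[OF g], symmetric])
  also have "\<dots> = (\<Sum>s\<in>refl. smul (c s * \<omega>s s x y) (G \<gamma> (G s \<mu>)))"
    using g by (intro sum.cong refl)
      (simp add: c_conj reflection_form_conj refl_group G_G, simp add: refl_group comp_assoc)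
  finally show ?thesis using g by (simp add: K_def G_sum group_omega)
qed

lemma D_simps:
  assumes "graded \<mu>"
  shows "graded \<nu> \<Longrightarrow> D e (\<mu> + \<nu>) = D e \<mu> + D e \<nu>" "D e (smul a \<mu>) = smul a (D e \<mu>)"
    "D (e + e') \<mu> = D e \<mu> + D e' \<mu>" "D (scale a e) \<mu> = smul a (D e \<mu>)"
proof -
  have p: "pol k (\<lambda>u. coord \<mu> k \<delta> u)" for k \<delta> using graded_pol[OF assms] by simp
  show "D e (\<mu> + \<nu>) = D e \<mu> + D e \<nu>" if "graded \<nu>"
  proof (rule pbw_eqI)
    fix k \<delta> u
    have "coord (\<mu> + \<nu>) (k + 1) \<delta> = (\<lambda>u. coord \<mu> (k + 1) \<delta> u + coord \<nu> (k + 1) \<delta> u)" by auto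
    then show "coord (D e (\<mu> + \<nu>)) k \<delta> u = coord (D e \<mu> + D e \<nu>) k \<delta> u"
      using dd_add[OF graded_pol[OF assms] graded_pol[OF that]] by simp
  qed
  show "D e (smul a \<mu>) = smul a (D e \<mu>)"
  proof (rule pbw_eqI)
    fix k \<delta> u
    have "coord (smul a \<mu>) (k + 1) \<delta> = (\<lambda>u. a * coord \<mu> (k + 1) \<delta> u)" by auto
    then show "coord (D e (smul a \<mu>)) k \<delta> u = coord (smul a (D e \<mu>)) k \<delta> u"
      using dd_scale[OF graded_pol[OF assms]] by simp
  qed
  show "D (e + e') \<mu> = D e \<mu> + D e' \<mu>" "D (scale a e) \<mu> = smul a (D e \<mu>)"
    using dd_direction_add[OF p] dd_direction_scale[OF p] by (auto intro!: pbw_eqI)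
qed

lemma D_X: "graded \<mu> \<Longrightarrow> D e (X y \<mu>) = smul (\<omega> e y) \<mu> + X y (D e \<mu>)"
proof (rule pbw_eqI)
  fix k \<delta> u assume g: "graded \<mu>"
  have "coord (X y \<mu>) (k + 1) \<delta> = (\<lambda>u. \<omega> u y * coord \<mu> k \<delta> u)" by auto
  then show "coord (D e (X y \<mu>)) k \<delta> u = coord (smul (\<omega> e y) \<mu> + X y (D e \<mu>)) k \<delta> u"
    using dd_mult_form[OF graded_pol[OF g]] by simp
qed

lemma euler_graded: "graded \<mu> \<Longrightarrow>
    coord (\<Sum>p\<in>dual_basis. X (fst p) (D (snd p) \<mu>)) k \<delta> u = of_int k * coord \<mu> k \<delta> u"
  using euler[OF graded_pol, of \<mu> u k \<delta>] by (simp add: coord_sum case_prod_unfold)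

subsection \<open>The correction operators\<close>

lemma graded_below_C:
  assumes "graded \<mu>"
  shows "graded (C n x \<mu>)" "below n (C n x \<mu>)"
proof -
  have "graded (C n x \<mu>) \<and> below n (C n x \<mu>)" using assms
  proof (induction n arbitrary: x \<mu> rule: less_induct)
    case (less n)
    show ?case
    proof (cases n)
      case (Suc m)
      have IH: "graded (C j y \<nu>)" "below j (C j y \<nu>)" if "j \<le> m" "graded \<nu>" for j y \<nu>
        using less.IH[of j \<nu> y] that Suc by auto
      have Lt: "graded (Lt m y (C m z \<nu>))" "below n (Lt m y (C m z \<nu>))" if "graded \<nu>" for y z \<nu>
      proof -
        show "graded (Lt m y (C m z \<nu>))"
          unfolding Lt_def using IH that by (intro graded_add graded_X graded_sum) auto
        have "below n (C j y (C m z \<nu>))" if j: "j < m" for j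
          using IH \<open>graded \<nu>\<close> j Suc by (intro below_mono[OF IH(2)]) auto
        then show "below n (Lt m y (C m z \<nu>))"
          unfolding Lt_def using IH that Suc by (intro below_add below_sum) auto
      qed
      have "graded (B m y z \<nu>)" "below n (B m y z \<nu>)" if "graded \<nu>" for y z \<nu>
      proof -
        show "graded (B m y z \<nu>)"
          unfolding B_def by (rule graded_add[OF graded_diff[OF graded_K[OF graded_P[OF that]] Lt(1)[OF that]] Lt(1)[OF that]])
        show "below n (B m y z \<nu>)"
          using below_add[OF below_diff[OF below_K[OF below_P] Lt(2)[OF that, unfolded Suc]] Lt(2)[OF that, unfolded Suc]]
          unfolding B_def Suc .
      qed
      then have "graded (\<Sum>p\<in>dual_basis. B m x (fst p) (D (snd p) \<mu>))"
        "below n (\<Sum>p\<in>dual_basis. B m x (fst p) (D (snd p) \<mu>))"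
        using graded_D[OF less.prems] by (intro graded_sum below_sum; simp)+
      then show ?thesis unfolding Suc C_Suc by (intro conjI graded_smul below_smul)
    qed auto
  qed
  then show "graded (C n x \<mu>)" "below n (C n x \<mu>)" by auto
qed

lemmas graded_C [intro] = graded_below_C(1)
lemmas below_C = graded_below_C(2)

lemma graded_Lt [intro]: "graded \<mu> \<Longrightarrow> graded (Lt n x \<mu>)"
  unfolding Lt_def by auto

lemma C_linear:
  assumes "graded \<mu>"
  shows "graded \<nu> \<Longrightarrow> C n x (\<mu> + \<nu>) = C n x \<mu> + C n x \<nu>" "C n x (smul a \<mu>) = smul a (C n x \<mu>)"
proof -
  have "(graded \<nu> \<longrightarrow> C n x (\<mu> + \<nu>) = C n x \<mu> + C n x \<nu>) \<and> C n x (smul a \<mu>) = smul a (C n x \<mu>)"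
    using assms
  proof (induction n arbitrary: x \<mu> \<nu> rule: less_induct)
    case (less n)
    show ?case
    proof (cases n)
      case (Suc m)
      have a: "C j y (\<mu> + \<nu>) = C j y \<mu> + C j y \<nu>" if "j \<le> m" "graded \<mu>" "graded \<nu>" for j y \<mu> \<nu>
        using less.IH[of j \<mu> \<nu> y] that Suc by auto
      have s: "C j y (smul a \<mu>) = smul a (C j y \<mu>)" if "j \<le> m" "graded \<mu>" for j y \<mu>
        using less.IH[of j \<mu> 0 y] that Suc by auto
      have La: "Lt m y (\<mu> + \<nu>) = Lt m y \<mu> + Lt m y \<nu>" if "graded \<mu>" "graded \<nu>" for y \<mu> \<nu>
        using that by (simp add: Lt_def a sum.distrib)
      have Ls: "Lt m y (smul a \<mu>) = smul a (Lt m y \<mu>)" if "graded \<mu>" for y \<mu>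
        using that by (simp add: Lt_def s smul_sum)
      have Ba: "B m y z (\<mu> + \<nu>) = B m y z \<mu> + B m y z \<nu>" if "graded \<mu>" "graded \<nu>" for y z \<mu> \<nu>
        using that by (simp add: B_def a La graded_C)
      have Bs: "B m y z (smul a \<mu>) = smul a (B m y z \<mu>)" if "graded \<mu>" for y z \<mu>
        using that by (simp add: B_def s Ls graded_C)
      show ?thesis unfolding Suc C_Suc using less.prems
        by (auto simp: D_simps Ba Bs graded_D sum.distrib smul_sum mult.commute)
    qed auto
  qed
  then show "graded \<nu> \<Longrightarrow> C n x (\<mu> + \<nu>) = C n x \<mu> + C n x \<nu>" "C n x (smul a \<mu>) = smul a (C n x \<mu>)" by auto
qed

lemma C_diff: "graded \<mu> \<Longrightarrow> graded \<nu> \<Longrightarrow> C n x (\<mu> - \<nu>) = C n x \<mu> - C n x \<nu>"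
  using C_linear(1)[of \<mu> "smul (-1) \<nu>" n x] C_linear(2)[of \<nu> n x "-1"] graded_smul[of \<nu> "-1"]
  by (simp add: smul_left)

lemma C_0 [simp]: "C n x 0 = 0"
  using C_linear(2)[of 0 n x 0] by simp

lemma Lt_linear:
  assumes "graded \<mu>"
  shows "graded \<nu> \<Longrightarrow> Lt n x (\<mu> + \<nu>) = Lt n x \<mu> + Lt n x \<nu>" "Lt n x (smul a \<mu>) = smul a (Lt n x \<mu>)"
    "graded \<nu> \<Longrightarrow> Lt n x (\<mu> - \<nu>) = Lt n x \<mu> - Lt n x \<nu>"
  using assms by (auto simp: Lt_def C_linear C_diff sum.distrib sum_subtractf smul_sum)

lemma B_linear:
  assumes "graded \<mu>"
  shows "graded \<nu> \<Longrightarrow> B n x y (\<mu> + \<nu>) = B n x y \<mu> + B n x y \<nu>" "B n x y (smul a \<mu>) = smul a (B n x y \<mu>)"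
  using assms by (auto simp: B_def Lt_linear C_linear graded_C)

lemma C_direction:
  assumes "graded \<mu>"
  shows "C n (x + y) \<mu> = C n x \<mu> + C n y \<mu>" "C n (scale a x) \<mu> = smul a (C n x \<mu>)"
proof -
  have "C n (x + y) \<mu> = C n x \<mu> + C n y \<mu> \<and> C n (scale a x) \<mu> = smul a (C n x \<mu>)"
    using assms
  proof (induction n arbitrary: x y \<mu> rule: less_induct)
    case (less n)
    show ?case
    proof (cases n)
      case (Suc m)
      have a: "C j (x + y) \<mu> = C j x \<mu> + C j y \<mu>" "C j (scale a x) \<mu> = smul a (C j x \<mu>)"
        if "j \<le> m" "graded \<mu>" for j x y \<mu>
        using less.IH[of j \<mu> x y] that Suc by auto
      have La: "Lt m (x + y) \<mu> = Lt m x \<mu> + Lt m y \<mu>" "Lt m (scale a x) \<mu> = smul a (Lt m x \<mu>)"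
        if "graded \<mu>" for x y \<mu>
        using that by (auto simp: Lt_def a sum.distrib smul_sum)
      have Ka: "K (x + y) z \<mu> = K x z \<mu> + K y z \<mu>" "K (scale a x) z \<mu> = smul a (K x z \<mu>)" for x y z \<mu>
        using K_skew[of _ z \<mu>] by (simp_all add: K_add_right K_scale_right)
      have Ba: "B m (x + y) z \<mu> = B m x z \<mu> + B m y z \<mu>" "B m (scale a x) z \<mu> = smul a (B m x z \<mu>)"
        if "graded \<mu>" for x y z \<mu>
        using that by (auto simp: B_def a La Lt_linear graded_C Ka)
      show ?thesis unfolding Suc C_Suc using less.prems
        by (auto simp: Ba graded_D sum.distrib smul_sum mult.commute)
    qed auto
  qed
  then show "C n (x + y) \<mu> = C n x \<mu> + C n y \<mu>" "C n (scale a x) \<mu> = smul a (C n x \<mu>)" by auto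
qed

lemma Lt_direction:
  assumes "graded \<mu>"
  shows "Lt n (x + y) \<mu> = Lt n x \<mu> + Lt n y \<mu>" "Lt n (scale a x) \<mu> = smul a (Lt n x \<mu>)"
  using assms by (auto simp: Lt_def C_direction sum.distrib smul_sum)

lemma B_skew: "B n x y \<mu> = - B n y x \<mu>"
  unfolding B_def by (subst K_skew) simp

lemma B_direction:
  assumes "graded \<mu>"
  shows "B n x (y + y') \<mu> = B n x y \<mu> + B n x y' \<mu>" "B n x (scale a y) \<mu> = smul a (B n x y \<mu>)"
  using assms by (auto simp: B_def C_direction Lt_direction Lt_linear graded_C K_add_right K_scale_right)

text \<open>In each step of the recursion the index drops by one, and a derivative lowers the degree by one.\<close>

lemma C_cong: "(\<And>\<delta> u. coord \<mu> (int n) \<delta> u = coord \<nu> (int n) \<delta> u) \<Longrightarrow> C n x \<mu> = C n x \<nu>"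
proof (induction n arbitrary: x \<mu> \<nu> rule: less_induct)
  case (less n)
  show ?case
  proof (cases n)
    case (Suc m)
    have "coord \<mu> (int m + 1) \<delta> = coord \<nu> (int m + 1) \<delta>" for \<delta>
      using less.prems Suc by (auto simp: fun_eq_iff add.commute)
    then have d: "coord (D e \<mu>) (int m) \<delta> u = coord (D e \<nu>) (int m) \<delta> u" for e \<delta> u by simp
    then have "C m y (D e \<mu>) = C m y (D e \<nu>)" for y e
      using less.IH[of m] Suc by auto
    moreover have "P m (D e \<mu>) = P m (D e \<nu>)" for e
      using d by (auto intro!: pbw_eqI simp del: coord_D)
    ultimately have "B m x b (D e \<mu>) = B m x b (D e \<nu>)" for b e
      by (simp add: B_def)
    then show ?thesis unfolding Suc C_Suc by simp
  qed simp
qed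

lemma C_eq_0: "(\<And>\<delta> u. coord \<mu> (int n) \<delta> u = 0) \<Longrightarrow> C n x \<mu> = 0"
  using C_cong[of \<mu> n 0 x] by simp

lemma B_cong:
  assumes "\<And>\<delta> u. coord \<mu> (int n) \<delta> u = coord \<nu> (int n) \<delta> u"
  shows "B n x y \<mu> = B n x y \<nu>"
proof -
  have "P n \<mu> = P n \<nu>" by (rule pbw_eqI) (simp add: assms)
  then show ?thesis using C_cong[OF assms] by (simp add: B_def)
qed

subsection \<open>Equivariance\<close>

text \<open>The tensor \<open>\<Sum> b \<otimes> e\<close> corresponds to the form \<open>\<omega>\<close>, which \<open>\<Gamma>\<close> preserves.\<close>

lemma dual_basis_change:
  fixes T :: "'v \<Rightarrow> 'v \<Rightarrow> 'b pbw"
  assumes g: "\<gamma> \<in> \<Gamma>"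
    and T1: "\<And>x y z. T (x + y) z = T x z + T y z" "\<And>a x z. T (scale a x) z = smul a (T x z)"
    and T2: "\<And>x y z. T z (x + y) = T z x + T z y" "\<And>a x z. T z (scale a x) = smul a (T z x)"
  shows "(\<Sum>p\<in>dual_basis. T (\<gamma> (fst p)) (\<gamma> (snd p))) = (\<Sum>p\<in>dual_basis. T (fst p) (snd p))"
proof -
  have S1: "T (\<Sum>i\<in>I. f i) z = (\<Sum>i\<in>I. T (f i) z)" for f z and I :: "('v \<times> 'v) set"
    using additive_sum[of "\<lambda>_. True" "\<lambda>x. T x z"] T1 by simp
  have S2: "T z (\<Sum>i\<in>I. f i) = (\<Sum>i\<in>I. T z (f i))" for f z and I :: "('v \<times> 'v) set"
    using additive_sum[of "\<lambda>_. True" "T z"] T2 by simp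
  have b: "\<gamma> x = (\<Sum>q\<in>dual_basis. scale (\<omega> (snd q) (\<gamma> x)) (fst q))" for x
    using dual_basis_left[of "\<gamma> x"] by (simp add: case_prod_unfold)
  have "(\<Sum>p\<in>dual_basis. T (\<gamma> (fst p)) (\<gamma> (snd p)))
      = (\<Sum>p\<in>dual_basis. \<Sum>q\<in>dual_basis. smul (\<omega> (snd q) (\<gamma> (fst p))) (T (fst q) (\<gamma> (snd p))))"
    by (intro sum.cong refl) (subst b, simp add: S1 T1)
  also have "\<dots> = (\<Sum>q\<in>dual_basis. \<Sum>p\<in>dual_basis. smul (\<omega> (snd q) (\<gamma> (fst p))) (T (fst q) (\<gamma> (snd p))))"
    by (rule sum.swap)
  also have "\<dots> = (\<Sum>q\<in>dual_basis. T (fst q) (snd q))"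
  proof (intro sum.cong refl)
    fix q :: "'v \<times> 'v"
    have "snd q = \<gamma> (\<Sum>p\<in>dual_basis. scale (\<omega> (ginv \<gamma> (snd q)) (fst p)) (snd p))"
      using dual_basis_right[of "ginv \<gamma> (snd q)"] g by (simp only: case_prod_unfold ginv_right)
    also have "\<dots> = (\<Sum>p\<in>dual_basis. scale (\<omega> (snd q) (\<gamma> (fst p))) (\<gamma> (snd p)))"
      using g by (simp add: omega_ginv group_lin)
    finally show "(\<Sum>p\<in>dual_basis. smul (\<omega> (snd q) (\<gamma> (fst p))) (T (fst q) (\<gamma> (snd p)))) = T (fst q) (snd q)"
      by (metis (no_types, lifting) S2 T2(2) sum.cong)
  qed
  finally show ?thesis .
qed

lemma G_C: "graded \<mu> \<Longrightarrow> \<gamma> \<in> \<Gamma> \<Longrightarrow> G \<gamma> (C n x \<mu>) = C n (\<gamma> x) (G \<gamma> \<mu>)"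
proof (induction n arbitrary: x \<mu> rule: less_induct)
  case (less n)
  show ?case
  proof (cases n)
    case (Suc m)
    have IH: "G \<gamma> (C j y \<nu>) = C j (\<gamma> y) (G \<gamma> \<nu>)" if "j \<le> m" "graded \<nu>" for j y \<nu>
      using less.IH[of j \<nu> y] that Suc less.prems by auto
    have "G \<gamma> (Lt m y (C m z \<nu>)) = Lt m (\<gamma> y) (C m (\<gamma> z) (G \<gamma> \<nu>))" if "graded \<nu>" for y z \<nu>
      using that less.prems by (simp add: Lt_def G_X G_sum IH graded_C)
    then have B: "G \<gamma> (B m y z \<nu>) = B m (\<gamma> y) (\<gamma> z) (G \<gamma> \<nu>)" if "graded \<nu>" for y z \<nu>
      using that less.prems by (simp add: B_def G_K G_P)
    have gG: "graded (G \<gamma> \<mu>)" using less.prems by auto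
    have "G \<gamma> (\<Sum>p\<in>dual_basis. B m x (fst p) (D (snd p) \<mu>))
        = (\<Sum>p\<in>dual_basis. B m (\<gamma> x) (\<gamma> (fst p)) (D (\<gamma> (snd p)) (G \<gamma> \<mu>)))"
      using less.prems by (simp add: G_sum B G_D graded_D)
    also have "\<dots> = (\<Sum>p\<in>dual_basis. B m (\<gamma> x) (fst p) (D (snd p) (G \<gamma> \<mu>)))"
      using less.prems(2) gG
      by (intro dual_basis_change[where T = "\<lambda>y z. B m (\<gamma> x) y (D z (G \<gamma> \<mu>))"])
        (simp_all add: B_direction graded_D D_simps B_linear)
    finally show ?thesis by (simp add: Suc C_Suc)
  qed (use less.prems in simp)
qed

subsection \<open>The action of \<open>V\<close>\<close>

text \<open>Any bound \<open>N\<close> gives the same value (\<open>L_eq\<close>); the least one is a definite choice.\<close>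

definition L :: "'v \<Rightarrow> 'v pbw \<Rightarrow> 'v pbw" where
  "L x \<mu> = Lt (LEAST N. below N \<mu>) x \<mu>"

definition finite_graded :: "'v pbw \<Rightarrow> bool" where
  "finite_graded \<mu> \<longleftrightarrow> graded \<mu> \<and> (\<exists>N. below N \<mu>)"

lemma finite_gradedE: 
  assumes "finite_graded \<mu>" obtains N where "graded \<mu>" "below N \<mu>"
  using assms by (auto simp: finite_graded_def)

lemma finite_gradedI: "graded \<mu> \<Longrightarrow> below N \<mu> \<Longrightarrow> finite_graded \<mu>"
  by (auto simp: finite_graded_def)

lemma finite_graded_graded: "finite_graded \<mu> \<Longrightarrow> graded \<mu>"
  by (simp add: finite_graded_def)

lemma Lt_mono: "M \<le> N \<Longrightarrow> below M \<mu> \<Longrightarrow> Lt N x \<mu> = Lt M x \<mu>"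
proof -
  assume le: "M \<le> N" and b: "below M \<mu>"
  have "(\<Sum>m<N. C m x \<mu>) = (\<Sum>m<M. C m x \<mu>)"
  proof (rule sum.mono_neutral_right)
    show "\<forall>i\<in>{..<N} - {..<M}. C i x \<mu> = 0"
      using b by (intro ballI C_eq_0) (simp add: below_def)
  qed (use le in auto)
  then show ?thesis by (simp add: Lt_def)
qed

lemma L_eq: "below N \<mu> \<Longrightarrow> L x \<mu> = Lt N x \<mu>"
  unfolding L_def by (rule Lt_mono[symmetric]) (erule Least_le, erule LeastI)

lemma below_L: "graded \<mu> \<Longrightarrow> below N \<mu> \<Longrightarrow> below (Suc N) (L x \<mu>)"
proof -
  assume g: "graded \<mu>" and b: "below N \<mu>"
  have "below (Suc N) (\<Sum>m<N. C m x \<mu>)"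
    by (intro below_sum, rule below_mono[OF below_C[OF g]]) simp
  from below_add[OF below_X[OF b] this] show "below (Suc N) (L x \<mu>)" by (simp add: L_eq[OF b] Lt_def)
qed

lemma finite_graded_L [intro]: "finite_graded \<mu> \<Longrightarrow> finite_graded (L x \<mu>)"
proof (elim finite_gradedE)
  fix N assume g: "graded \<mu>" and b: "below N \<mu>"
  show ?thesis
    by (rule finite_gradedI[OF _ below_L[OF g b]]) (simp add: L_eq[OF b] graded_Lt[OF g])
qed

lemma coord_L_top: "graded \<mu> \<Longrightarrow> below N \<mu> \<Longrightarrow> k \<ge> int N \<Longrightarrow> coord (L x \<mu>) k \<delta> u = \<omega> u x * coord \<mu> (k - 1) \<delta> u"
proof -
  assume g: "graded \<mu>" and b: "below N \<mu>" and k: "k \<ge> int N"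
  have "coord (C m x \<mu>) k \<delta> u = 0" if "m < N" for m
    using below_C[OF g, of m x] that k by (auto simp: below_def)
  then show ?thesis by (simp add: L_eq[OF b] Lt_def coord_sum)
qed

lemma finite_graded_0 [simp]: "finite_graded 0"
  by (auto simp: finite_graded_def)

lemma finite_graded_add [intro]: "finite_graded \<mu> \<Longrightarrow> finite_graded \<nu> \<Longrightarrow> finite_graded (\<mu> + \<nu>)"
proof (elim finite_gradedE)
  fix N M assume "graded \<mu>" "below N \<mu>" "graded \<nu>" "below M \<nu>"
  then show ?thesis by (intro finite_gradedI[of _ "max N M"] graded_add below_add)
    (auto intro: below_mono)
qed

lemma finite_graded_smul [intro]: "finite_graded \<mu> \<Longrightarrow> finite_graded (smul a \<mu>)"
  by (auto simp: finite_graded_def)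

lemma finite_graded_diff [intro]: "finite_graded \<mu> \<Longrightarrow> finite_graded \<nu> \<Longrightarrow> finite_graded (\<mu> - \<nu>)"
  using finite_graded_add[of \<mu> "smul (-1) \<nu>"] finite_graded_smul[of \<nu> "-1"] by (simp add: smul_left)

lemma finite_graded_sum [intro]: "(\<And>i. i \<in> I \<Longrightarrow> finite_graded (f i)) \<Longrightarrow> finite_graded (\<Sum>i\<in>I. f i)"
  by (induction I rule: infinite_finite_induct) auto

lemma finite_graded_G [intro]: "finite_graded \<mu> \<Longrightarrow> \<gamma> \<in> \<Gamma> \<Longrightarrow> finite_graded (G \<gamma> \<mu>)"
  by (auto simp: finite_graded_def)

lemma finite_graded_C [intro]: "graded \<mu> \<Longrightarrow> finite_graded (C n x \<mu>)"
  using below_C by (auto simp: finite_graded_def)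

lemma finite_graded_P [intro]: "graded \<mu> \<Longrightarrow> finite_graded (P n \<mu>)"
  by (auto simp: finite_graded_def)

lemma finite_graded_K [intro]: "finite_graded \<mu> \<Longrightarrow> finite_graded (K x y \<mu>)"
  by (auto simp: finite_graded_def)

lemma L_linear:
  assumes "finite_graded \<mu>"
  shows "finite_graded \<nu> \<Longrightarrow> L x (\<mu> + \<nu>) = L x \<mu> + L x \<nu>" "L x (smul a \<mu>) = smul a (L x \<mu>)"
    "finite_graded \<nu> \<Longrightarrow> L x (\<mu> - \<nu>) = L x \<mu> - L x \<nu>"
    "L (x + y) \<mu> = L x \<mu> + L y \<mu>" "L (scale a x) \<mu> = smul a (L x \<mu>)"
proof -
  obtain N where N: "graded \<mu>" "below N \<mu>" using assms by (rule finite_gradedE)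
  show "L x (smul a \<mu>) = smul a (L x \<mu>)" "L (x + y) \<mu> = L x \<mu> + L y \<mu>" "L (scale a x) \<mu> = smul a (L x \<mu>)"
    using N below_smul[OF N(2), of a] by (simp_all add: L_eq Lt_linear Lt_direction)
  assume "finite_graded \<nu>"
  then obtain M where M: "graded \<nu>" "below M \<nu>" by (rule finite_gradedE)
  have b: "below (max N M) \<mu>" "below (max N M) \<nu>" using N M by (auto intro: below_mono)
  then show "L x (\<mu> + \<nu>) = L x \<mu> + L x \<nu>" "L x (\<mu> - \<nu>) = L x \<mu> - L x \<nu>"
    using N M below_add[OF b] below_diff[OF b] by (simp_all add: L_eq Lt_linear)
qed

lemma L_0 [simp]: "L x 0 = 0"
  using L_linear(2)[of 0 x 0] by simp

lemma L_sum: "(\<And>i. i \<in> I \<Longrightarrow> finite_graded (f i)) \<Longrightarrow> L x (\<Sum>i\<in>I. f i) = (\<Sum>i\<in>I. L x (f i))"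
  by (rule additive_sum[where Q = finite_graded]) (auto simp: L_linear)

lemma L_direction_diff: "finite_graded \<mu> \<Longrightarrow> L (x - y) \<mu> = L x \<mu> - L y \<mu>"
  using L_linear(4)[of \<mu> "x - y" y] by (simp add: algebra_simps)

lemma L_direction_0: "finite_graded \<mu> \<Longrightarrow> L 0 \<mu> = 0"
  using L_linear(5)[of \<mu> 0 0] by simp

lemma G_L: "finite_graded \<mu> \<Longrightarrow> \<gamma> \<in> \<Gamma> \<Longrightarrow> G \<gamma> (L x \<mu>) = L (\<gamma> x) (G \<gamma> \<mu>)"
proof (elim finite_gradedE)
  fix N assume "\<gamma> \<in> \<Gamma>" "graded \<mu>" "below N \<mu>"
  then show ?thesis using below_G[of N \<mu> \<gamma>] by (simp add: L_eq Lt_def G_X G_sum G_C)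
qed

lemma B_eq: "graded \<mu> \<Longrightarrow> B n x y \<mu> = K x y (P n \<mu>) - L x (C n y \<mu>) + L y (C n x \<mu>)"
  by (simp add: B_def L_eq[OF below_C])

text \<open>Moving the group elements to the right, each reflection contributes the vector of
  \<open>reflection_form_jacobi\<close>.\<close>

lemma K_jacobi:
  assumes f: "finite_graded \<mu>"
  shows "(K x y (L z \<mu>) - L z (K x y \<mu>)) + (K y z (L x \<mu>) - L x (K y z \<mu>)) + (K z x (L y \<mu>) - L y (K z x \<mu>)) = 0"
proof -
  have com: "K x y (L z \<mu>) - L z (K x y \<mu>)
      = (\<Sum>s\<in>refl. smul (c s) (L (scale (\<omega>s s x y) (s z - z)) (G s \<mu>)))" for x y z
  proof -
    have "L z (K x y \<mu>) = smul (t * \<omega> x y) (L z \<mu>) + (\<Sum>s\<in>refl. smul (c s * \<omega>s s x y) (L z (G s \<mu>)))"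
      unfolding K_def using f
      by (subst L_linear) (auto simp: refl_group L_linear L_sum finite_graded_smul finite_graded_G)
    then have "K x y (L z \<mu>) - L z (K x y \<mu>)
      = (\<Sum>s\<in>refl. smul (c s * \<omega>s s x y) (G s (L z \<mu>)) - smul (c s * \<omega>s s x y) (L z (G s \<mu>)))"
      by (simp add: K_def sum_subtractf)
    also have "\<dots> = (\<Sum>s\<in>refl. smul (c s) (L (scale (\<omega>s s x y) (s z - z)) (G s \<mu>)))"
      using f refl_group by (intro sum.cong refl)
        (simp add: G_L L_linear(5)[OF finite_graded_G] L_direction_diff[OF finite_graded_G])
    finally show ?thesis .
  qed
  have "L (scale (\<omega>s s x y) (s z - z)) (G s \<mu>) + L (scale (\<omega>s s y z) (s x - x)) (G s \<mu>)
      + L (scale (\<omega>s s z x) (s y - y)) (G s \<mu>) = 0" if s: "s \<in> refl" for s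
  proof -
    have g: "finite_graded (G s \<mu>)" using f s refl_group by blast
    show ?thesis unfolding L_linear(4)[OF g, symmetric] reflection_form_jacobi[OF s]
      by (rule L_direction_0[OF g])
  qed
  then show ?thesis unfolding com sum.distrib[symmetric] smul_simps(1)[symmetric]
    by (intro sum.neutral ballI) simp
qed

subsection \<open>The commutation relation\<close>

text \<open>The commutation relation in degree \<open>n\<close>, as a condition on the corrections in degree \<open>n + 1\<close>.\<close>

definition correction_eq :: "nat \<Rightarrow> bool" where
  "correction_eq n \<longleftrightarrow> (\<forall>x y \<mu>. graded \<mu> \<longrightarrow> C (Suc n) x (X y \<mu>) - C (Suc n) y (X x \<mu>) = B n x y \<mu>)"

text \<open>Both sides are expanded by degree; the terms of second order in the corrections are absorbed by the
  definition of \<open>B\<close>, and the projections \<open>P m\<close> add up to the identity.\<close>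

lemma commutator_if_correction_eq:
  assumes co: "\<And>m. m < N \<Longrightarrow> correction_eq m" and g: "graded \<mu>" and b: "below N \<mu>"
  shows "L x (L y \<mu>) - L y (L x \<mu>) = K x y \<mu>"
proof -
  have LL: "L x (L y \<mu>) = X x (X y \<mu>) + (\<Sum>m<N. C (Suc m) x (X y \<mu>)) + (\<Sum>m<N. L x (C m y \<mu>))" for x y
  proof -
    have X: "below (Suc N) (X y \<mu>)" using b by auto
    have "L x (L y \<mu>) = L x (X y \<mu>) + L x (\<Sum>m<N. C m y \<mu>)"
      unfolding L_eq[OF b] Lt_def
      by (rule L_linear(1)) (use X g in \<open>auto intro: finite_gradedI\<close>)
    also have "L x (\<Sum>m<N. C m y \<mu>) = (\<Sum>m<N. L x (C m y \<mu>))" using g by (intro L_sum) auto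
    also have "L x (X y \<mu>) = X x (X y \<mu>) + (\<Sum>m<N. C (Suc m) x (X y \<mu>))"
      unfolding L_eq[OF X] Lt_def by (subst sum.lessThan_Suc_shift) simp
    finally show ?thesis .
  qed
  have "L x (L y \<mu>) - L y (L x \<mu>)
      = (\<Sum>m<N. (C (Suc m) x (X y \<mu>) - C (Suc m) y (X x \<mu>)) + L x (C m y \<mu>) - L y (C m x \<mu>))"
    unfolding LL X_commute[of x y] by (simp add: sum.distrib sum_subtractf)
  also have "\<dots> = (\<Sum>m<N. K x y (P m \<mu>))"
    using co g by (intro sum.cong) (auto simp: correction_eq_def B_eq)
  also have "\<dots> = K x y \<mu>" by (simp add: K_sum[symmetric] sum_P[OF g b])
  finally show ?thesis .
qed

lemma L_P: "graded \<mu> \<Longrightarrow> L z (P k \<mu>) = X z (P k \<mu>) + C k z \<mu>"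
proof -
  assume g: "graded \<mu>"
  have "(\<Sum>m<Suc k. C m z (P k \<mu>)) = (\<Sum>m<k. C m z (P k \<mu>)) + C k z (P k \<mu>)" by simp
  also have "(\<Sum>m<k. C m z (P k \<mu>)) = 0" by (intro sum.neutral ballI C_eq_0) auto
  also have "C k z (P k \<mu>) = C k z \<mu>" by (rule C_cong) simp
  finally show ?thesis by (simp add: L_eq[OF below_P] Lt_def)
qed

text \<open>The right hand sides \<open>B\<close> form a cocycle of the Koszul complex. The Jacobi identity for \<open>K\<close> gives
  this once the commutation relation is available in lower degrees.\<close>

lemma cocycle:
  assumes co: "\<And>m. m < n \<Longrightarrow> correction_eq m" and g: "graded \<mu>"
  shows "B n x y (X z \<mu>) + B n y z (X x \<mu>) + B n z x (X y \<mu>) = 0"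
proof (cases n)
  case 0
  have "B n x y (X z \<mu>) = 0" for x y z
  proof -
    have "B n x y (X z \<mu>) = B n x y 0" by (rule B_cong) (simp add: 0 graded_neg[OF g])
    also have "\<dots> = 0" by (simp add: B_eq)
    finally show ?thesis .
  qed
  then show ?thesis by simp
next
  case (Suc k)
  define h where "h = P k \<mu>"
  have fh: "finite_graded h" unfolding h_def using g by auto
  have Bn: "B n x y (X z \<mu>) = K x y (L z h) - K x y (C k z \<mu>) - L x (C n y (X z \<mu>)) + L y (C n x (X z \<mu>))" for x y z
    using g by (simp add: B_eq graded_X Suc P_X h_def L_P)
  have A: "L x (C n y (X z \<mu>)) - L x (C n z (X y \<mu>)) = L x (K y z h) - L x (L y (C k z \<mu>)) + L x (L z (C k y \<mu>))" for x y z
  proof -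
    have "L x (C n y (X z \<mu>)) - L x (C n z (X y \<mu>)) = L x (B k y z \<mu>)"
      using co[of k] g Suc by (simp add: correction_eq_def L_linear(3)[symmetric] finite_graded_C graded_X)
    also have "\<dots> = L x (K y z h) - L x (L y (C k z \<mu>)) + L x (L z (C k y \<mu>))"
      using g fh by (simp add: B_eq h_def[symmetric] L_linear finite_graded_K finite_graded_L finite_graded_C finite_graded_diff)
    finally show ?thesis .
  qed
  have R: "L x (L y (C k z \<mu>)) - L y (L x (C k z \<mu>)) = K x y (C k z \<mu>)" for x y z
    using co Suc g by (intro commutator_if_correction_eq[of k] below_C) auto
  have "B n x y (X z \<mu>) + B n y z (X x \<mu>) + B n z x (X y \<mu>)
    = (K x y (L z h) - L z (K x y h)) + (K y z (L x h) - L x (K y z h)) + (K z x (L y h) - L y (K z x h))"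
    unfolding Bn A[of x y z, THEN diff_eq_eq[THEN iffD1]] A[of y z x, THEN diff_eq_eq[THEN iffD1]]
      A[of z x y, THEN diff_eq_eq[THEN iffD1]] R[symmetric]
    by (simp add: algebra_simps)
  then show ?thesis using K_jacobi[OF fh] by simp
qed

text \<open>The homotopy formula. The Leibniz rule for \<open>D e\<close> on \<open>y \<mu>\<close> contributes \<open>B n x y \<mu>\<close> twice, by
  antisymmetry; the cocycle condition and Euler's identity contribute it \<open>n\<close> times.\<close>

lemma correction_eq: "correction_eq n"
proof (induction n rule: less_induct)
  case (less n)
  show ?case unfolding correction_eq_def
  proof (intro allI impI)
    fix x y \<mu> assume g: "graded \<mu>"
    have half: "(\<Sum>p\<in>dual_basis. B n x (fst p) (D (snd p) (X y \<mu>)))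
        = B n x y \<mu> + (\<Sum>p\<in>dual_basis. B n x (fst p) (X y (D (snd p) \<mu>)))" for x y
    proof -
      have "(\<Sum>p\<in>dual_basis. B n x (fst p) (D (snd p) (X y \<mu>)))
        = (\<Sum>p\<in>dual_basis. B n x (scale (\<omega> (snd p) y) (fst p)) \<mu>) + (\<Sum>p\<in>dual_basis. B n x (fst p) (X y (D (snd p) \<mu>)))"
        unfolding sum.distrib[symmetric] using g
        by (intro sum.cong) (auto simp: D_X B_linear B_direction graded_X graded_D graded_smul)
      also have "(\<Sum>p\<in>dual_basis. B n x (scale (\<omega> (snd p) y) (fst p)) \<mu>)
          = B n x (\<Sum>p\<in>dual_basis. scale (\<omega> (snd p) y) (fst p)) \<mu>"
        by (rule additive_sum[where Q = "\<lambda>_. True" and T = "\<lambda>y. B n x y \<mu>", symmetric]) (auto simp: B_direction g)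
      also have "(\<Sum>p\<in>dual_basis. scale (\<omega> (snd p) y) (fst p)) = y"
        using dual_basis_left[of y] by (simp add: case_prod_unfold)
      finally show ?thesis .
    qed
    have "(\<Sum>p\<in>dual_basis. B n x (fst p) (X y (D (snd p) \<mu>))) - (\<Sum>p\<in>dual_basis. B n y (fst p) (X x (D (snd p) \<mu>)))
        = (\<Sum>p\<in>dual_basis. B n x y (X (fst p) (D (snd p) \<mu>)))"
      unfolding sum_subtractf[symmetric]
    proof (intro sum.cong refl)
      fix p
      have "B n x (fst p) (X y (D (snd p) \<mu>)) + B n (fst p) y (X x (D (snd p) \<mu>)) + B n y x (X (fst p) (D (snd p) \<mu>)) = 0"
        by (rule cocycle[OF less.IH]) (use g in auto)
      then show "B n x (fst p) (X y (D (snd p) \<mu>)) - B n y (fst p) (X x (D (snd p) \<mu>)) = B n x y (X (fst p) (D (snd p) \<mu>))"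
        using B_skew[of n "fst p" y] B_skew[of n y x] by (simp add: algebra_simps add_eq_0_iff)
    qed
    also have "\<dots> = B n x y (\<Sum>p\<in>dual_basis. X (fst p) (D (snd p) \<mu>))"
      by (rule additive_sum[where Q = graded, symmetric]) (use g in \<open>auto simp: B_linear\<close>)
    also have "\<dots> = B n x y (smul (of_nat n) \<mu>)"
      by (rule B_cong) (simp add: euler_graded[OF g])
    also have "\<dots> = smul (of_nat n) (B n x y \<mu>)" by (simp add: B_linear g)
    finally have e: "(\<Sum>p\<in>dual_basis. B n x (fst p) (X y (D (snd p) \<mu>)))
      = (\<Sum>p\<in>dual_basis. B n y (fst p) (X x (D (snd p) \<mu>))) + smul (of_nat n) (B n x y \<mu>)"
      by (simp add: algebra_simps)
    have "C (Suc n) x (X y \<mu>) - C (Suc n) y (X x \<mu>)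
      = smul (1 / of_nat (n + 2)) (B n x y \<mu> - B n y x \<mu> + smul (of_nat n) (B n x y \<mu>))"
      unfolding C_Suc half e smul_simps(2)[symmetric] by (simp add: algebra_simps)
    also have "B n x y \<mu> - B n y x \<mu> + smul (of_nat n) (B n x y \<mu>) = smul (of_nat (n + 2)) (B n x y \<mu>)"
    proof -
      have "B n x y \<mu> - B n y x \<mu> = smul 2 (B n x y \<mu>)"
        using B_skew[of n y x \<mu>] smul_left(1)[of 1 1 "B n x y \<mu>"] by simp
      then show ?thesis by (simp add: smul_left)
    qed
    also have "smul (1 / of_nat (n + 2)) (smul (of_nat (n + 2)) (B n x y \<mu>)) = B n x y \<mu>"
      unfolding smul_simps(3) using of_nat_neq_0[where 'a = complex, of "Suc n"] by simp
    finally show "C (Suc n) x (X y \<mu>) - C (Suc n) y (X x \<mu>) = B n x y \<mu>" .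
  qed
qed

theorem commutator_L: "finite_graded \<mu> \<Longrightarrow> L x (L y \<mu>) - L y (L x \<mu>) = K x y \<mu>"
  using commutator_if_correction_eq correction_eq by (metis finite_graded_def)

end

subsection \<open>The action of the free algebra\<close>

lemma nc_poly_sum_monomials:
  fixes p :: "'g nc_poly"
  shows "p = (\<Sum>w\<in>Poly_Mapping.keys p. Poly_Mapping.single w (Poly_Mapping.lookup p w))"
  by (rule poly_mapping_eqI) (auto simp: lookup_sum lookup_single when_def sum.delta in_keys_iff)

lemma scalar_comm:
  fixes p :: "'g nc_poly"
  shows "scalar a * p = p * scalar a"
proof -
  have "scalar a * Poly_Mapping.single w b = Poly_Mapping.single w b * scalar a" for w :: "'g free_monoid" and b
    by (simp add: scalar_def mult_single mult.commute)
  then have "scalar a * (\<Sum>w\<in>W. Poly_Mapping.single w (f w)) = (\<Sum>w\<in>W. Poly_Mapping.single w (f w)) * scalar a"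
    for W :: "'g free_monoid set" and f
    by (simp only: sum_distrib_left sum_distrib_right)
  from this[of "Poly_Mapping.lookup p" "Poly_Mapping.keys p"] show ?thesis
    unfolding nc_poly_sum_monomials[symmetric] .
qed

lemma scalar_left_comm: "p * (scalar a * q) = scalar a * (p * q)"
  by (metis scalar_comm mult.assoc)

lemma scalar_simps: "scalar (a + b) = scalar a + scalar b" "scalar a * scalar b = scalar (a * b)" "scalar 1 = 1"
  "scalar 0 = 0" "scalar (- a) = - scalar a" "scalar (a - b) = scalar a - scalar b"
  by (simp_all add: scalar_def single_add mult_single single_one single_uminus single_diff)

lemma scalar_mult_cancel: "a \<noteq> 0 \<Longrightarrow> scalar (1 / a) * (scalar a * p) = p"
  by (simp add: mult.assoc[symmetric] scalar_simps)

context symplectic_reflection_data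
begin

abbreviation Car :: "'v sra_gen nc_poly set" where "Car \<equiv> carrier (sra_free \<Gamma>)"

abbreviation Rel :: "'v sra_gen nc_poly set" where "Rel \<equiv> sra_ideal scale \<omega> \<Gamma> t c"

lemma Car_iff: "p \<in> Car \<longleftrightarrow> (\<forall>w\<in>Poly_Mapping.keys p. set (letters w) \<subseteq> range Vec \<union> Grp ` \<Gamma>)"
  by (simp add: sra_free_def free_algebra_def)

lemma free_ops: "monoid.mult (sra_free \<Gamma>) = (*)" "add (sra_free \<Gamma>) = (+)" "monoid.one (sra_free \<Gamma>) = 1" "ring.zero (sra_free \<Gamma>) = 0"
  by (simp_all add: sra_free_def free_algebra_def)

lemma ring_free: "ring (sra_free \<Gamma>)"
  unfolding sra_free_def by (rule free_algebra_ring)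

lemma Car_mult [simp, intro]: "p \<in> Car \<Longrightarrow> q \<in> Car \<Longrightarrow> p * q \<in> Car"
  and Car_add [simp, intro]: "p \<in> Car \<Longrightarrow> q \<in> Car \<Longrightarrow> p + q \<in> Car"
  using ring.ring_simprules(5)[OF ring_free] ring.ring_simprules(1)[OF ring_free] by (simp_all add: free_ops)

lemma Car_scalar [simp]: "scalar a \<in> Car"
  by (simp add: Car_iff scalar_def zero_free_monoid_def)

lemma Car_1 [simp]: "1 \<in> Car" and Car_0 [simp]: "0 \<in> Car"
  using Car_scalar[of 1] Car_scalar[of 0] by (simp_all add: scalar_simps)

lemma Car_uminus [simp]: "p \<in> Car \<Longrightarrow> - p \<in> Car" by (simp add: Car_iff)

lemma Car_diff [simp]: "p \<in> Car \<Longrightarrow> q \<in> Car \<Longrightarrow> p - q \<in> Car"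
  using Car_add[of p "- q"] by simp

lemma Car_sum [intro]: "(\<And>i. i \<in> I \<Longrightarrow> f i \<in> Car) \<Longrightarrow> sum f I \<in> Car"
  by (induction I rule: infinite_finite_induct) auto

lemma Car_vec [simp]: "vec x \<in> Car" and Car_grp [simp]: "\<gamma> \<in> \<Gamma> \<Longrightarrow> grp \<gamma> \<in> Car"
  by (simp_all add: Car_iff generator_def)

lemma Car_induct [consumes 1, case_names scalar vec grp add]:
  assumes p: "p \<in> Car"
    and sc: "\<And>a. Q (scalar a)"
    and v: "\<And>x p. p \<in> Car \<Longrightarrow> Q p \<Longrightarrow> Q (vec x * p)"
    and g: "\<And>\<gamma> p. \<gamma> \<in> \<Gamma> \<Longrightarrow> p \<in> Car \<Longrightarrow> Q p \<Longrightarrow> Q (grp \<gamma> * p)"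
    and ad: "\<And>p q. p \<in> Car \<Longrightarrow> q \<in> Car \<Longrightarrow> Q p \<Longrightarrow> Q q \<Longrightarrow> Q (p + q)"
  shows "Q p"
proof -
  have w: "Poly_Mapping.single (Word gs) a \<in> Car \<and> Q (Poly_Mapping.single (Word gs) a)"
    if "set gs \<subseteq> range Vec \<union> Grp ` \<Gamma>" for gs a
    using that
  proof (induction gs)
    case Nil
    then show ?case using sc[of a] Car_scalar[of a] by (simp add: scalar_def zero_free_monoid_def)
  next
    case (Cons h gs)
    have "Poly_Mapping.single (Word (h # gs)) a = generator h * Poly_Mapping.single (Word gs) a"
      by (simp add: generator_def mult_single plus_free_monoid_def)
    then show ?case using Cons v[of "Poly_Mapping.single (Word gs) a"] g[of _ "Poly_Mapping.single (Word gs) a"] by auto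
  qed
  have "sum (\<lambda>w. Poly_Mapping.single w (Poly_Mapping.lookup p w)) W \<in> Car \<and>
      Q (sum (\<lambda>w. Poly_Mapping.single w (Poly_Mapping.lookup p w)) W)" if "finite W" "W \<subseteq> Poly_Mapping.keys p" for W
    using that
  proof (induction W rule: finite_induct)
    case empty
    then show ?case using sc[of 0] by (simp add: scalar_simps)
  next
    case (insert w W)
    have "set (letters w) \<subseteq> range Vec \<union> Grp ` \<Gamma>" using insert.prems p by (simp add: Car_iff)
    from w[OF this, of "Poly_Mapping.lookup p w"] show ?case using insert ad by auto
  qed
  from this[of "Poly_Mapping.keys p"] show ?thesis using nc_poly_sum_monomials[of p] by simp
qed

primrec act :: "'v sra_gen list \<Rightarrow> 'v pbw \<Rightarrow> 'v pbw" where
  "act [] \<mu> = \<mu>"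
| "act (g # gs) \<mu> = (case g of Vec x \<Rightarrow> L x (act gs \<mu>) | Grp \<gamma> \<Rightarrow> G \<gamma> (act gs \<mu>))"

definition rho :: "'v sra_gen nc_poly \<Rightarrow> 'v pbw \<Rightarrow> 'v pbw" where
  "rho p \<mu> = (\<Sum>w\<in>Poly_Mapping.keys p. smul (Poly_Mapping.lookup p w) (act (letters w) \<mu>))"

lemma rho_superset: "finite W \<Longrightarrow> Poly_Mapping.keys p \<subseteq> W \<Longrightarrow>
    rho p \<mu> = (\<Sum>w\<in>W. smul (Poly_Mapping.lookup p w) (act (letters w) \<mu>))"
  unfolding rho_def by (rule sum.mono_neutral_left) (auto simp: in_keys_iff)

lemma rho_add: "rho (p + q) \<mu> = rho p \<mu> + rho q \<mu>"
proof -
  let ?W = "Poly_Mapping.keys p \<union> Poly_Mapping.keys q"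
  have "rho (p + q) \<mu> = (\<Sum>w\<in>?W. smul (Poly_Mapping.lookup (p + q) w) (act (letters w) \<mu>))"
    using Poly_Mapping.keys_add[of p q] by (intro rho_superset) auto
  also have "\<dots> = rho p \<mu> + rho q \<mu>"
    by (simp add: lookup_add smul_left sum.distrib rho_superset[of ?W])
  finally show ?thesis .
qed

lemma rho_scalar_mult: "rho (scalar a * p) \<mu> = smul a (rho p \<mu>)"
proof -
  have l: "Poly_Mapping.lookup (scalar a * p) w = a * Poly_Mapping.lookup p w" for w
  proof -
    have "scalar a * p = (\<Sum>w\<in>Poly_Mapping.keys p. Poly_Mapping.single w (a * Poly_Mapping.lookup p w))"
      by (rule trans[OF arg_cong[OF nc_poly_sum_monomials]]) (simp add: sum_distrib_left scalar_def mult_single)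
    then show ?thesis by (auto simp: lookup_sum lookup_single when_def sum.delta in_keys_iff)
  qed
  have "rho (scalar a * p) \<mu> = (\<Sum>w\<in>Poly_Mapping.keys p. smul (Poly_Mapping.lookup (scalar a * p) w) (act (letters w) \<mu>))"
    by (rule rho_superset) (auto simp: in_keys_iff l)
  then show ?thesis by (simp add: l smul_sum rho_def)
qed

lemma rho_scalar: "rho (scalar a) \<mu> = smul a \<mu>"
proof (cases "a = 0")
  case True
  then show ?thesis by (simp add: rho_def scalar_def)
next
  case False
  then show ?thesis by (simp add: rho_def scalar_def zero_free_monoid_def)
qed

lemma rho_1: "rho 1 \<mu> = \<mu>" and rho_0: "rho 0 \<mu> = 0"
  using rho_scalar[of 1 \<mu>] rho_scalar[of 0 \<mu>] by (simp_all add: scalar_simps)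

lemma rho_uminus: "rho (- p) \<mu> = - rho p \<mu>"
  using rho_add[of p "- p" \<mu>] by (simp add: rho_0 eq_neg_iff_add_eq_0 add.commute)

lemma rho_diff: "rho (p - q) \<mu> = rho p \<mu> - rho q \<mu>"
  using rho_add[of p "- q" \<mu>] by (simp add: rho_uminus)

lemma rho_sum: "rho (\<Sum>i\<in>I. f i) \<mu> = (\<Sum>i\<in>I. rho (f i) \<mu>)"
  by (induction I rule: infinite_finite_induct) (auto simp: rho_0 rho_add)

lemma finite_graded_act: "set gs \<subseteq> range Vec \<union> Grp ` \<Gamma> \<Longrightarrow> finite_graded \<mu> \<Longrightarrow> finite_graded (act gs \<mu>)"
  by (induction gs) auto

lemma rho_generator_mult:
  "rho (generator g * p) \<mu> = (\<Sum>w\<in>Poly_Mapping.keys p. smul (Poly_Mapping.lookup p w) (act (g # letters w) \<mu>))"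
proof -
  have "generator g * p = (\<Sum>w\<in>Poly_Mapping.keys p. Poly_Mapping.single (Word (g # letters w)) (Poly_Mapping.lookup p w))"
    by (rule trans[OF arg_cong[OF nc_poly_sum_monomials]])
      (simp add: sum_distrib_left generator_def mult_single plus_free_monoid_def)
  moreover have "rho (Poly_Mapping.single w a) \<mu> = smul a (act (letters w) \<mu>)" for w a
    by (cases "a = 0") (simp_all add: rho_def)
  ultimately show ?thesis by (simp add: rho_sum)
qed

lemma rho_vec_mult: "p \<in> Car \<Longrightarrow> finite_graded \<mu> \<Longrightarrow> rho (vec x * p) \<mu> = L x (rho p \<mu>)"
  unfolding rho_generator_mult rho_def[of p]
  by (subst L_sum) (auto simp: Car_iff finite_graded_act L_linear finite_graded_smul intro!: sum.cong)

lemma rho_grp_mult: "rho (grp \<gamma> * p) \<mu> = G \<gamma> (rho p \<mu>)"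
  unfolding rho_generator_mult by (simp add: rho_def G_sum)

lemma finite_graded_rho [intro]: "p \<in> Car \<Longrightarrow> finite_graded \<mu> \<Longrightarrow> finite_graded (rho p \<mu>)"
  unfolding rho_def by (intro finite_graded_sum finite_graded_smul finite_graded_act) (auto simp: Car_iff)

lemma rho_mult: "p \<in> Car \<Longrightarrow> q \<in> Car \<Longrightarrow> finite_graded \<mu> \<Longrightarrow> rho (p * q) \<mu> = rho p (rho q \<mu>)"
proof (induction p rule: Car_induct)
  case (scalar a)
  then show ?case by (simp add: rho_scalar rho_scalar_mult)
next
  case (vec x p)
  then show ?case by (simp add: mult.assoc rho_vec_mult finite_graded_rho)
next
  case (grp \<gamma> p)
  then show ?case by (simp add: mult.assoc rho_grp_mult)
next
  case (add p q)
  then show ?case by (simp add: distrib_right rho_add)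
qed

lemma rho_0_right: "p \<in> Car \<Longrightarrow> rho p 0 = 0"
  by (induction p rule: Car_induct) (auto simp: rho_scalar rho_vec_mult rho_grp_mult rho_add)

lemma rho_vec: "finite_graded \<mu> \<Longrightarrow> rho (vec x) \<mu> = L x \<mu>" and rho_grp: "rho (grp \<gamma>) \<mu> = G \<gamma> \<mu>"
  using rho_vec_mult[of 1 \<mu> x] rho_grp_mult[of \<gamma> 1 \<mu>] by (simp_all add: rho_1)

lemma ideal_Rel: "ideal Rel (sra_free \<Gamma>)"
  by (rule sra_ideal_ideal[OF vector_space_axioms subgroup])

text \<open>The elements that act as zero form an ideal, and the relators belong to it: the commutation relation
  by \<open>commutator_L\<close>, the others by construction.\<close>

lemma rho_ideal: "p \<in> Rel \<Longrightarrow> finite_graded \<mu> \<Longrightarrow> rho p \<mu> = 0"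
proof -
  let ?J = "{p \<in> Car. \<forall>\<mu>. finite_graded \<mu> \<longrightarrow> rho p \<mu> = 0}"
  have J: "ideal ?J (sra_free \<Gamma>)"
  proof (rule idealI[OF ring_free])
    interpret R: ring "sra_free \<Gamma>" by (rule ring_free)
    show "subgroup ?J (add_monoid (sra_free \<Gamma>))"
    proof (rule R.add.subgroupI)
      show "?J \<noteq> {}" using rho_0 by (auto intro!: exI[of _ 0])
      show "\<ominus>\<^bsub>sra_free \<Gamma>\<^esub> a \<in> ?J" if a: "a \<in> ?J" for a
      proof -
        have "\<ominus>\<^bsub>sra_free \<Gamma>\<^esub> a = - a"
          by (rule R.minus_equality) (use a in \<open>auto simp: free_ops\<close>)
        then show ?thesis using a by (simp add: rho_uminus)
      qed
    qed (auto simp: free_ops rho_add)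
  qed (auto simp: free_ops rho_mult rho_0_right finite_graded_rho)
  have "sra_relators scale \<omega> \<Gamma> t c \<subseteq> ?J"
  proof
    fix r assume r: "r \<in> sra_relators scale \<omega> \<Gamma> t c"
    have rC: "r \<in> Car" using sra_relators_carrier[OF vector_space_axioms subgroup] r by blast
    have "rho r \<mu> = 0" if m: "finite_graded \<mu>" for \<mu>
      using r unfolding sra_relators_def
    proof (elim UnE CollectE exE conjE)
      fix x y assume "r = vec (x + y) - (vec x + vec y)"
      then show ?thesis using m by (simp add: rho_diff rho_add rho_vec L_linear)
    next
      fix k x assume "r = vec (scale k x) - scalar k * vec x"
      then show ?thesis using m by (simp add: rho_diff rho_scalar_mult rho_vec L_linear)
    next
      fix \<gamma> \<delta> assume "r = grp (\<gamma> \<circ> \<delta>) - grp \<gamma> * grp \<delta>" "\<gamma> \<in> \<Gamma>" "\<delta> \<in> \<Gamma>"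
      then show ?thesis by (simp add: rho_diff rho_grp_mult rho_grp G_G)
    next
      assume "r \<in> {grp id - 1}"
      then show ?thesis by (simp add: rho_diff rho_grp rho_1 G_id)
    next
      fix \<gamma> x assume "r = grp \<gamma> * vec x * grp (ginv \<gamma>) - vec (\<gamma> x)" "\<gamma> \<in> \<Gamma>"
      then show ?thesis using m
        by (simp add: rho_diff mult.assoc rho_grp_mult rho_vec_mult rho_grp rho_vec G_L finite_graded_G G_G G_id)
    next
      fix x y assume r: "r = vec x * vec y - vec y * vec x - (scalar (t * \<omega> x y) * grp id +
          (\<Sum>s\<in>refl. scalar (c s * \<omega>s s x y) * grp s))"
      show ?thesis using m commutator_L[OF m, of x y]
        by (simp add: r rho_diff rho_add rho_sum rho_scalar_mult rho_vec_mult rho_vec rho_grp G_id K_def)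
    qed
    then show "r \<in> ?J" using rC by blast
  qed
  then have "Rel \<subseteq> ?J" unfolding sra_ideal_def by (rule ring.genideal_minimal[OF ring_free J])
  then show "p \<in> Rel \<Longrightarrow> finite_graded \<mu> \<Longrightarrow> rho p \<mu> = 0" by blast
qed

subsection \<open>Computing modulo the ideal\<close>

lemma Rel_Car [simp]: "p \<in> Rel \<Longrightarrow> p \<in> Car"
  by (rule ideal.Icarr[OF ideal_Rel])

lemma Rel_add [intro]: "p \<in> Rel \<Longrightarrow> q \<in> Rel \<Longrightarrow> p + q \<in> Rel"
  using additive_subgroup.a_closed[OF ideal.axioms(1)[OF ideal_Rel]] by (simp add: free_ops)

lemma Rel_0 [simp]: "0 \<in> Rel"
  using additive_subgroup.zero_closed[OF ideal.axioms(1)[OF ideal_Rel]] by (simp add: free_ops)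

lemma Rel_left [intro]: "p \<in> Rel \<Longrightarrow> q \<in> Car \<Longrightarrow> q * p \<in> Rel"
  and Rel_right [intro]: "p \<in> Rel \<Longrightarrow> q \<in> Car \<Longrightarrow> p * q \<in> Rel"
  using ideal.I_l_closed[OF ideal_Rel] ideal.I_r_closed[OF ideal_Rel] by (simp_all add: free_ops)

lemma Rel_uminus [intro]: "p \<in> Rel \<Longrightarrow> - p \<in> Rel"
  using Rel_left[of p "scalar (-1)"] by (simp add: scalar_simps)

lemma Rel_diff [intro]: "p \<in> Rel \<Longrightarrow> q \<in> Rel \<Longrightarrow> p - q \<in> Rel"
  using Rel_add[of p "- q"] by auto

lemma Rel_sum: "(\<And>i. i \<in> I \<Longrightarrow> f i \<in> Rel) \<Longrightarrow> sum f I \<in> Rel"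
  by (induction I rule: infinite_finite_induct) auto

lemma relator_Rel: "r \<in> sra_relators scale \<omega> \<Gamma> t c \<Longrightarrow> r \<in> Rel"
  unfolding sra_ideal_def
  using ring.genideal_self[OF ring_free sra_relators_carrier[OF vector_space_axioms subgroup]] by blast

definition kappa :: "'v \<Rightarrow> 'v \<Rightarrow> 'v sra_gen nc_poly" where
  "kappa x y = scalar (t * \<omega> x y) * grp id + (\<Sum>s\<in>refl. scalar (c s * \<omega>s s x y) * grp s)"

lemma Rel_vec_add: "vec (x + y) - (vec x + vec y) \<in> Rel"
  and Rel_vec_scale: "vec (scale a x) - scalar a * vec x \<in> Rel"
  and Rel_grp_comp: "\<gamma> \<in> \<Gamma> \<Longrightarrow> \<delta> \<in> \<Gamma> \<Longrightarrow> grp (\<gamma> \<circ> \<delta>) - grp \<gamma> * grp \<delta> \<in> Rel"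
  and Rel_grp_id: "grp id - 1 \<in> Rel"
  and Rel_conj: "\<gamma> \<in> \<Gamma> \<Longrightarrow> grp \<gamma> * vec x * grp (ginv \<gamma>) - vec (\<gamma> x) \<in> Rel"
  and Rel_commutator: "vec x * vec y - vec y * vec x - kappa x y \<in> Rel"
  by (rule relator_Rel, unfold sra_relators_def kappa_def, blast)+

lemma Rel_grp_vec: "\<gamma> \<in> \<Gamma> \<Longrightarrow> grp \<gamma> * vec x - vec (\<gamma> x) * grp \<gamma> \<in> Rel"
proof -
  assume g: "\<gamma> \<in> \<Gamma>"
  have "(grp \<gamma> * vec x * grp (ginv \<gamma>) - vec (\<gamma> x)) * grp \<gamma>
    + grp \<gamma> * vec x * ((grp (ginv \<gamma> \<circ> \<gamma>) - grp (ginv \<gamma>) * grp \<gamma>) - (grp id - 1)) \<in> Rel"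
    using g by (intro Rel_add Rel_right[OF Rel_conj] Rel_left Rel_diff Rel_grp_comp Rel_grp_id) auto
  moreover have "(grp \<gamma> * vec x * grp (ginv \<gamma>) - vec (\<gamma> x)) * grp \<gamma>
    + grp \<gamma> * vec x * ((grp (ginv \<gamma> \<circ> \<gamma>) - grp (ginv \<gamma>) * grp \<gamma>) - (grp id - 1))
    = grp \<gamma> * vec x - vec (\<gamma> x) * grp \<gamma>" using g by (simp add: algebra_simps)
  ultimately show ?thesis by simp
qed

lemma Rel_vec_sum: "vec (\<Sum>i\<in>I. scale (a i) (f i)) - (\<Sum>i\<in>I. scalar (a i) * vec (f i)) \<in> Rel"
proof (induction I rule: infinite_finite_induct)
  case (insert i I)
  let ?s = "\<Sum>i\<in>I. scale (a i) (f i)"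
  have "(vec (scale (a i) (f i) + ?s) - (vec (scale (a i) (f i)) + vec ?s)) + (vec (scale (a i) (f i)) - scalar (a i) * vec (f i))
     + (vec ?s - (\<Sum>i\<in>I. scalar (a i) * vec (f i))) \<in> Rel"
    by (intro Rel_add Rel_vec_add Rel_vec_scale insert.IH)
  then show ?case using insert.hyps by (simp add: algebra_simps)
qed (use Rel_vec_scale[of 0 0] in \<open>simp_all add: scalar_simps\<close>)

end

section \<open>Filtration and symbols\<close>

lemma generator_scalar_comm: "generator g * (scalar a * q) = scalar a * (generator g * q)"
  by (rule scalar_left_comm)

lemma scalar_scalar_mult: "scalar a * (scalar b * q) = scalar (a * b) * q"
  by (simp add: mult.assoc[symmetric] scalar_simps)

context symplectic_reflection_data
begin

text \<open>The vector \<open>1 \<otimes> 1\<close>, which generates the PBW module.\<close>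

definition vac :: "'v pbw" where
  "vac = pbw (\<lambda>k \<delta> u. if k = 0 \<and> \<delta> = id then 1 else 0)"

text \<open>Read off from the action on \<open>vac\<close>. For \<open>p\<close> of filtration degree \<open>m\<close> this is the leading term of \<open>p\<close>;
  the components in lower degrees depend on the corrections.\<close>

definition symbol :: "int \<Rightarrow> 'v sra_gen nc_poly \<Rightarrow> ('v \<Rightarrow> 'v) \<Rightarrow> 'v \<Rightarrow> complex" where
  "symbol m p = coord (rho p vac) m"

text \<open>The filtration by degree in \<open>V\<close>, on the free algebra, with the ideal of relations contained in every
  step. In negative degrees nothing else is left, so inductions on the degree end in the ideal.\<close>

inductive fil :: "int \<Rightarrow> 'v sra_gen nc_poly \<Rightarrow> bool" where
  fil_ideal: "p \<in> Rel \<Longrightarrow> fil m p"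
| fil_scalar: "m \<ge> 0 \<Longrightarrow> fil m (scalar a)"
| fil_grp_mult: "\<gamma> \<in> \<Gamma> \<Longrightarrow> fil m p \<Longrightarrow> fil m (grp \<gamma> * p)"
| fil_vec_mult: "fil m p \<Longrightarrow> fil (m + 1) (vec x * p)"
| fil_add: "fil m p \<Longrightarrow> fil m q \<Longrightarrow> fil m (p + q)"

lemma fil_Car: "fil m p \<Longrightarrow> p \<in> Car"
  by (induction rule: fil.induct) auto

lemma fil_mono: "fil m p \<Longrightarrow> m \<le> n \<Longrightarrow> fil n p"
proof (induction arbitrary: n rule: fil.induct)
  case (fil_vec_mult m p x)
  then have "fil (n - 1 + 1) (vec x * p)" by (intro fil.fil_vec_mult) auto
  then show ?case by simp
qed (auto intro: fil.intros)

lemma fil_neg: "fil m p \<Longrightarrow> m < 0 \<Longrightarrow> p \<in> Rel"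
  by (induction rule: fil.induct) auto

lemma fil_0 [simp]: "fil m 0"
  by (rule fil_ideal) simp

lemma fil_scalar_mult: "fil m p \<Longrightarrow> fil m (scalar a * p)"
proof (induction rule: fil.induct)
  case (fil_ideal p m)
  then show ?case by (intro fil.fil_ideal Rel_left) auto
next
  case (fil_scalar m b)
  then show ?case by (simp add: scalar_simps fil.fil_scalar)
next
  case (fil_grp_mult \<gamma> m p)
  then show ?case using fil.fil_grp_mult[of \<gamma> m "scalar a * p"] by (simp add: scalar_left_comm)
next
  case (fil_vec_mult m p x)
  then show ?case using fil.fil_vec_mult[of m "scalar a * p" x] by (simp add: scalar_left_comm)
next
  case (fil_add m p q)
  then show ?case by (simp add: distrib_left fil.fil_add)
qed

lemma fil_uminus: "fil m p \<Longrightarrow> fil m (- p)"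
  using fil_scalar_mult[of m p "-1"] by (simp add: scalar_simps)

lemma fil_diff: "fil m p \<Longrightarrow> fil m q \<Longrightarrow> fil m (p - q)"
  using fil_add[of m p "- q"] fil_uminus[of m q] by simp

lemma fil_sum: "(\<And>i. i \<in> I \<Longrightarrow> fil m (f i)) \<Longrightarrow> fil m (\<Sum>i\<in>I. f i)"
  by (induction I rule: infinite_finite_induct) (auto intro: fil_add)

lemma fil_cong: "fil m (p - q) \<Longrightarrow> fil m p \<longleftrightarrow> fil m q"
  using fil_add[of m "p - q" q] fil_diff[of m p "p - q"] by auto

lemma fil_trans: "fil m (p - q) \<Longrightarrow> fil m (q - r) \<Longrightarrow> fil m (p - r)"
  using fil_add[of m "p - q" "q - r"] by simp

lemma fil_sym: "fil m (p - q) \<Longrightarrow> fil m (q - p)"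
  using fil_uminus[of m "p - q"] by simp

lemma fil_mult: "fil m p \<Longrightarrow> fil n q \<Longrightarrow> fil (m + n) (p * q)"
proof (induction rule: fil.induct)
  case (fil_ideal p m)
  then show ?case using fil_Car by (intro fil.fil_ideal Rel_right) auto
next
  case (fil_scalar m a)
  then show ?case by (intro fil_mono[OF fil_scalar_mult]) auto
next
  case (fil_vec_mult m p x)
  have "fil (m + n + 1) (vec x * (p * q))" by (intro fil.fil_vec_mult) (use fil_vec_mult in auto)
  then show ?case by (simp add: algebra_simps)
qed (auto intro: fil.intros simp: mult.assoc distrib_right)

lemma fil_1: "m \<ge> 0 \<Longrightarrow> fil m 1"
  using fil_scalar[of m 1] by (simp add: scalar_simps)

lemma fil_vec: "fil 1 (vec x)"
  using fil_vec_mult[OF fil_1[of 0], of x] by simp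

lemma fil_grp: "\<gamma> \<in> \<Gamma> \<Longrightarrow> fil 0 (grp \<gamma>)"
  using fil_grp_mult[OF _ fil_1[of 0], of \<gamma>] by simp

lemma fil_grp_mult_right: "fil m p \<Longrightarrow> \<gamma> \<in> \<Gamma> \<Longrightarrow> fil m (p * grp \<gamma>)"
  using fil_mult[OF _ fil_grp, of m p \<gamma>] by simp

lemma fil_kappa: "fil 0 (kappa x y)"
  unfolding kappa_def by (intro fil_add fil_sum fil_scalar_mult fil_grp) (auto simp: refl_group)

lemma fil_exhaust: "p \<in> Car \<Longrightarrow> \<exists>m\<ge>0. fil m p"
proof (induction p rule: Car_induct)
  case (scalar a)
  then show ?case by (intro exI[of _ 0]) (simp add: fil_scalar)
next
  case (vec x p)
  then obtain m where "m \<ge> 0" "fil m p" by blast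
  then show ?case by (intro exI[of _ "m + 1"]) (simp add: fil_vec_mult)
next
  case (grp \<gamma> p)
  then show ?case by (meson fil_grp_mult)
next
  case (add p q)
  then obtain m n where "m \<ge> 0" "fil m p" "n \<ge> 0" "fil n q" by blast
  then show ?case by (intro exI[of _ "max m n"]) (auto intro!: fil_add intro: fil_mono)
qed

subsection \<open>Symbols\<close>

lemma graded_vac: "graded vac"
proof (rule gradedI)
  fix k \<delta>
  show "pol k (\<lambda>u. coord vac k \<delta> u)"
    by (cases "k = 0 \<and> \<delta> = id") (auto simp: vac_def)
qed (auto simp: vac_def)

lemma finite_graded_vac [simp]: "finite_graded vac"
  by (rule finite_gradedI[OF graded_vac, of 1]) (auto simp: below_def vac_def)

lemma graded_rho_vac: "p \<in> Car \<Longrightarrow> graded (rho p vac)"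
  by (rule finite_graded_graded) auto

lemma pol_symbol: "p \<in> Car \<Longrightarrow> pol m (symbol m p \<delta>)"
  unfolding symbol_def by (rule graded_pol[OF graded_rho_vac])

lemma symbol_outside: "p \<in> Car \<Longrightarrow> \<delta> \<notin> \<Gamma> \<Longrightarrow> symbol m p \<delta> u = 0"
  unfolding symbol_def by (rule graded_outside[OF graded_rho_vac])

lemma symbol_neg: "p \<in> Car \<Longrightarrow> m < 0 \<Longrightarrow> symbol m p \<delta> u = 0"
  using pol_neg[OF pol_symbol] by blast

lemma symbol_add: "symbol m (p + q) \<delta> u = symbol m p \<delta> u + symbol m q \<delta> u"
  and symbol_diff: "symbol m (p - q) \<delta> u = symbol m p \<delta> u - symbol m q \<delta> u"
  and symbol_uminus: "symbol m (- p) \<delta> u = - symbol m p \<delta> u"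
  and symbol_scalar_mult: "symbol m (scalar a * p) \<delta> u = a * symbol m p \<delta> u"
  and symbol_0: "symbol m 0 \<delta> u = 0"
  by (simp_all add: symbol_def rho_add rho_diff rho_uminus rho_scalar_mult rho_0)

lemma symbol_sum: "symbol m (\<Sum>i\<in>I. f i) \<delta> u = (\<Sum>i\<in>I. symbol m (f i) \<delta> u)"
  by (simp add: symbol_def rho_sum coord_sum)

lemma symbol_ideal: "p \<in> Rel \<Longrightarrow> symbol m p \<delta> u = 0"
  by (simp add: symbol_def rho_ideal)

lemma symbol_scalar: "symbol m (scalar a) \<delta> u = (if m = 0 \<and> \<delta> = id then a else 0)"
  by (simp add: symbol_def rho_scalar vac_def)

lemma symbol_grp_mult: "symbol m (grp \<gamma> * p) \<delta> u = symbol m p (ginv \<gamma> \<circ> \<delta>) (ginv \<gamma> u)"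
  by (simp add: symbol_def rho_grp_mult)

lemma symbol_above_vec_mult:
  assumes p: "fil m p" and van: "\<And>k \<delta> u. k > m \<Longrightarrow> symbol k p \<delta> u = 0"
  shows "k \<ge> m + 1 \<Longrightarrow> symbol k (vec x * p) \<delta> u = \<omega> u x * symbol (k - 1) p \<delta> u"
proof -
  assume k: "k \<ge> m + 1"
  have C: "p \<in> Car" using p by (rule fil_Car)
  show ?thesis
  proof (cases "k < 0")
    case True
    then show ?thesis using C by (simp add: symbol_neg)
  next
    case False
    have "below (nat (m + 1)) (rho p vac)" unfolding below_def
    proof (intro allI impI)
      fix j \<delta> u assume "int (nat (m + 1)) \<le> j"
      then have "j > m" by (simp split: if_splits)
      from van[OF this] show "coord (rho p vac) j \<delta> u = 0" by (simp add: symbol_def)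
    qed
    then show ?thesis using False k C
      by (simp add: symbol_def rho_vec_mult coord_L_top[OF graded_rho_vac])
  qed
qed

lemma symbol_above: "fil m p \<Longrightarrow> k > m \<Longrightarrow> symbol k p \<delta> u = 0"
proof (induction arbitrary: k \<delta> u rule: fil.induct)
  case (fil_vec_mult m p x)
  have "symbol k (vec x * p) \<delta> u = \<omega> u x * symbol (k - 1) p \<delta> u"
    by (rule symbol_above_vec_mult[OF fil_vec_mult(1)]) (use fil_vec_mult in auto)
  then show ?case using fil_vec_mult by simp
qed (simp_all add: symbol_ideal symbol_scalar symbol_grp_mult symbol_add)

lemma symbol_vec_mult: "fil m p \<Longrightarrow> symbol (m + 1) (vec x * p) \<delta> u = \<omega> u x * symbol m p \<delta> u"
  using symbol_above_vec_mult[of m p "m + 1"] symbol_above by simp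

text \<open>This is the product of the smash product \<open>\<complex>[V] # \<Gamma>\<close>. The corrections in the action of a vector lower
  degrees, so they do not affect leading terms.\<close>

lemma symbol_mult:
  assumes "fil m p" and q: "fil n q"
  shows "symbol (m + n) (p * q) \<gamma> u = (\<Sum>\<delta>\<in>\<Gamma>. symbol m p \<delta> u * symbol n q (ginv \<delta> \<circ> \<gamma>) (ginv \<delta> u))"
  using assms(1)
proof (induction arbitrary: \<gamma> u rule: fil.induct)
  case (fil_ideal p m)
  then show ?case using fil_Car[OF q] by (simp add: symbol_ideal Rel_right)
next
  case (fil_scalar m a)
  show ?case
  proof (cases "m = 0")
    case True
    have "(\<Sum>\<delta>\<in>\<Gamma>. symbol m (scalar a) \<delta> u * symbol n q (ginv \<delta> \<circ> \<gamma>) (ginv \<delta> u))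
      = (\<Sum>\<delta>\<in>\<Gamma>. if \<delta> = id then a * symbol n q \<gamma> u else 0)"
      using True by (intro sum.cong) (auto simp: symbol_scalar inv_id)
    also have "\<dots> = symbol (m + n) (scalar a * q) \<gamma> u"
      using True by (simp add: symbol_scalar_mult finite_group)
    finally show ?thesis by (rule sym)
  next
    case False
    then have "symbol (m + n) (scalar a * q) \<gamma> u = 0"
      using fil_scalar by (simp add: symbol_scalar_mult symbol_above[OF q])
    then show ?thesis using False by (simp add: symbol_scalar)
  qed
next
  case (fil_grp_mult \<alpha> m p)
  have "symbol (m + n) (grp \<alpha> * p * q) \<gamma> u
    = (\<Sum>\<delta>\<in>\<Gamma>. symbol m p \<delta> (ginv \<alpha> u) * symbol n q (ginv \<delta> \<circ> (ginv \<alpha> \<circ> \<gamma>)) (ginv \<delta> (ginv \<alpha> u)))"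
    unfolding mult.assoc symbol_grp_mult fil_grp_mult.IH ..
  also have "\<dots> = (\<Sum>\<delta>\<in>\<Gamma>. symbol m p (ginv \<alpha> \<circ> (\<alpha> \<circ> \<delta>)) (ginv \<alpha> u) * symbol n q (ginv (\<alpha> \<circ> \<delta>) \<circ> \<gamma>) (ginv (\<alpha> \<circ> \<delta>) u))"
    using fil_grp_mult.hyps by (intro sum.cong) (auto simp: comp_assoc)
  also have "\<dots> = (\<Sum>\<delta>\<in>\<Gamma>. symbol m p (ginv \<alpha> \<circ> \<delta>) (ginv \<alpha> u) * symbol n q (ginv \<delta> \<circ> \<gamma>) (ginv \<delta> u))"
    by (rule sum.reindex_bij_betw[OF bij_betw_comp_left[OF fil_grp_mult.hyps(1)]])
  finally show ?case unfolding symbol_grp_mult .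
next
  case (fil_vec_mult m p x)
  have "symbol (m + n + 1) (vec x * (p * q)) \<gamma> u = \<omega> u x * symbol (m + n) (p * q) \<gamma> u"
    by (intro symbol_vec_mult fil_mult fil_vec_mult q)
  also have "m + n + 1 = m + 1 + n" by simp
  finally show ?case
    unfolding mult.assoc[of "vec x"] fil_vec_mult.IH symbol_vec_mult[OF fil_vec_mult.hyps] sum_distrib_left
    by (simp only: mult.assoc)
next
  case (fil_add m p r)
  then show ?case by (simp add: distrib_right symbol_add sum.distrib)
qed

subsection \<open>The symmetrising section\<close>

text \<open>The symmetrisation map, right inverse to taking symbols. The recursion is Euler's identity, with the
  linear forms replaced by vectors of the algebra; in degree \<open>0\<close>, \<open>f 0\<close> is the constant \<open>f\<close>.\<close>

fun sec :: "nat \<Rightarrow> ('v \<Rightarrow> complex) \<Rightarrow> 'v sra_gen nc_poly" where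
  "sec 0 f = scalar (f 0)"
| "sec (Suc n) f = scalar (1 / of_nat (Suc n)) * (\<Sum>p\<in>dual_basis. vec (fst p) * sec n (dd (snd p) f))"

declare sec.simps(2) [simp del]

lemma sec_cong: "(\<And>u. f u = g u) \<Longrightarrow> sec n f = sec n g"
  by (metis ext)

lemma fil_sec: "fil (int n) (sec n f)"
proof (induction n arbitrary: f)
  case (Suc n)
  have "fil (int n + 1) (vec b * sec n (dd e f))" for b e by (intro fil_vec_mult Suc)
  then show ?case unfolding sec.simps by (intro fil_scalar_mult fil_sum) (simp add: add.commute)
qed (simp add: fil_scalar)

lemma sec_Car [simp]: "sec n f \<in> Car"
  by (rule fil_Car[OF fil_sec])

lemma sec_add: "pol k f \<Longrightarrow> pol k g \<Longrightarrow> sec n (\<lambda>u. f u + g u) = sec n f + sec n g"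
proof (induction n arbitrary: k f g)
  case (Suc n)
  have "dd e (\<lambda>u. f u + g u) = (\<lambda>u. dd e f u + dd e g u)" for e
    by (rule ext) (rule dd_add[OF Suc.prems])
  then have "sec n (dd e (\<lambda>u. f u + g u)) = sec n (dd e f) + sec n (dd e g)" for e
    by (simp only: Suc.IH[OF pol_dd[OF Suc.prems(1)] pol_dd[OF Suc.prems(2)]])
  then show ?case by (simp only: sec.simps distrib_left sum.distrib)
qed (simp add: scalar_simps)

lemma sec_scale: "pol k f \<Longrightarrow> sec n (\<lambda>u. a * f u) = scalar a * sec n f"
proof (induction n arbitrary: k f)
  case (Suc n)
  have "dd e (\<lambda>u. a * f u) = (\<lambda>u. a * dd e f u)" for e
    by (rule ext) (rule dd_scale[OF Suc.prems])
  then have "sec n (dd e (\<lambda>u. a * f u)) = scalar a * sec n (dd e f)" for e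
    by (simp only: Suc.IH[OF pol_dd[OF Suc.prems(1)]])
  then have "sec (Suc n) (\<lambda>u. a * f u) = scalar (1 / of_nat (Suc n)) * (scalar a * (\<Sum>p\<in>dual_basis. vec (fst p) * sec n (dd (snd p) f)))"
    by (simp only: sec.simps generator_scalar_comm sum_distrib_left)
  then show ?case by (simp only: sec.simps scalar_left_comm[of "scalar (1 / of_nat (Suc n))" a])
qed (simp add: scalar_simps)

lemma sec_zero [simp]: "sec n (\<lambda>u. 0) = 0"
  using sec_scale[of 0 "\<lambda>u. 0" n 0] by (simp add: scalar_simps)

lemma of_nat_scalar: "of_nat m = (scalar (of_nat m) :: 'v sra_gen nc_poly)"
  by (induction m) (simp_all add: scalar_simps)

lemma sec_euler:
  assumes "n > 0"
  shows "of_nat n * sec n f = (\<Sum>p\<in>dual_basis. vec (fst p) * sec (n - 1) (dd (snd p) f))"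
proof -
  obtain m where n: "n = Suc m" using assms by (cases n) auto
  have "of_nat (Suc m) \<noteq> (0::complex)" by (rule of_nat_neq_0)
  then have "scalar (of_nat (Suc m)) * (scalar (1 / of_nat (Suc m)) * q) = q" for q :: "'v sra_gen nc_poly"
    unfolding scalar_scalar_mult by (simp add: scalar_simps del: of_nat_Suc)
  then show ?thesis unfolding n of_nat_scalar sec.simps diff_Suc_1 .
qed

lemma pol_0_const: "pol k f \<Longrightarrow> k = 0 \<Longrightarrow> f u = f 0"
proof (induction rule: pol.induct)
  case (pol_mult_form k f v)
  then show ?case using pol_neg[of k f] by simp
qed auto

lemma fil_vec_commute: "fil n q \<Longrightarrow> fil n (vec x * (vec y * q) - vec y * (vec x * q))"
proof -
  assume q: "fil n q"
  have "fil (0 + n) ((vec x * vec y - vec y * vec x) * q)"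
  proof (rule fil_mult[OF _ q])
    show "fil 0 (vec x * vec y - vec y * vec x)"
      using fil_add[OF fil_ideal[OF Rel_commutator, of 0 x y] fil_kappa[of x y]] by simp
  qed
  then show ?thesis by (simp add: left_diff_distrib mult.assoc)
qed

text \<open>By the recursion and the Leibniz rule, \<open>n + 1\<close> times the second term is the sum of \<open>v\<close> times \<open>sec n f\<close>,
  where \<open>v\<close> is differentiated, and of the products of \<open>b\<close> with \<open>sec (v \<partial>\<^sub>e f)\<close>, which by induction
  is \<open>v\<close> times \<open>sec (\<partial>\<^sub>e f)\<close> up to lower degree. Exchanging \<open>b\<close> and \<open>v\<close> costs terms of lower degree, and the products then
  add up to \<open>n\<close> times \<open>v\<close> times \<open>sec n f\<close>.\<close>

lemma sec_vec_mult: "pol (int n) f \<Longrightarrow> fil (int n) (vec v * sec n f - sec (Suc n) (\<lambda>u. \<omega> u v * f u))"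
proof (induction n arbitrary: f)
  have vs: "(\<Sum>p\<in>dual_basis. scalar (\<omega> (snd p) v) * vec (fst p)) - vec v \<in> Rel"
    using Rel_uminus[OF Rel_vec_sum[where I = dual_basis and a = "\<lambda>p. \<omega> (snd p) v" and f = fst]] dual_basis_left[of v]
    by (simp add: case_prod_unfold)
  have split: "sec m (dd e (\<lambda>u. \<omega> u v * f u)) = scalar (\<omega> e v) * sec m f + sec m (\<lambda>u. \<omega> u v * dd e f u)"
    if f: "pol k f" for m e k f
  proof -
    have "pol (k - 1 + 1) (\<lambda>u. \<omega> u v * dd e f u)" by (intro pol_mult_form pol_dd f)
    then have p: "pol k (\<lambda>u. \<omega> u v * dd e f u)" by simp
    have "sec m (dd e (\<lambda>u. \<omega> u v * f u)) = sec m (\<lambda>u. \<omega> e v * f u + \<omega> u v * dd e f u)"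
      by (rule sec_cong) (simp add: dd_mult_form[OF f])
    then show ?thesis by (simp add: sec_add[OF pol_scale[OF f] p] sec_scale[OF f])
  qed
  {
    case 0
    have d: "dd e f u = 0" for e u using pol_neg[OF pol_dd[OF 0]] by simp
    have s0: "sec 0 (dd e (\<lambda>u. \<omega> u v * f u)) = scalar (\<omega> e v) * sec 0 f" for e
      using split[OF 0, of 0 e] by (simp only: d mult_zero_right sec_zero add_0_right)
    have "sec (Suc 0) (\<lambda>u. \<omega> u v * f u) = scalar 1 * (\<Sum>p\<in>dual_basis. vec (fst p) * (scalar (\<omega> (snd p) v) * sec 0 f))"
      by (simp only: sec.simps(2) s0) simp
    also have "\<dots> = (\<Sum>p\<in>dual_basis. scalar (\<omega> (snd p) v) * vec (fst p)) * sec 0 f"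
      by (simp only: scalar_simps mult_1_left sum_distrib_right generator_scalar_comm mult.assoc)
    finally have "sec (Suc 0) (\<lambda>u. \<omega> u v * f u) = (\<Sum>p\<in>dual_basis. scalar (\<omega> (snd p) v) * vec (fst p)) * sec 0 f" .
    then have "vec v * sec 0 f - sec (Suc 0) (\<lambda>u. \<omega> u v * f u)
        = - (((\<Sum>p\<in>dual_basis. scalar (\<omega> (snd p) v) * vec (fst p)) - vec v) * sec 0 f)"
      by (simp add: algebra_simps)
    then show ?case using Rel_uminus[OF Rel_right[OF vs sec_Car[of 0 f]]] by (simp only: fil_ideal)
  next
    case (Suc m)
    let ?n = "Suc m"
    have f: "pol (int ?n) f" by fact
    have df: "pol (int m) (dd e f)" for e using pol_dd[OF f] by simp
    let ?A = "(\<Sum>p\<in>dual_basis. scalar (\<omega> (snd p) v) * vec (fst p)) * sec ?n f"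
    let ?B = "\<Sum>p\<in>dual_basis. vec (fst p) * sec ?n (\<lambda>u. \<omega> u v * dd (snd p) f u)"
    let ?B' = "\<Sum>p\<in>dual_basis. vec (fst p) * (vec v * sec m (dd (snd p) f))"
    let ?B'' = "\<Sum>p\<in>dual_basis. vec v * (vec (fst p) * sec m (dd (snd p) f))"
    have e: "sec (Suc ?n) (\<lambda>u. \<omega> u v * f u) = scalar (1 / of_nat (Suc ?n)) * (?A + ?B)"
      by (simp only: sec.simps(2)[of "Suc m"] split[OF f] distrib_left sum.distrib)
        (simp only: generator_scalar_comm sum_distrib_right mult.assoc)
    have 1: "fil (int ?n) (?A - vec v * sec ?n f)"
      using fil_ideal[OF Rel_right[OF vs sec_Car[of ?n f]]] by (simp only: left_diff_distrib)
    have "fil (int m + 1) (vec b * (sec ?n (\<lambda>u. \<omega> u v * dd e f u) - vec v * sec m (dd e f)))" for b e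
      by (intro fil_vec_mult fil_sym[OF Suc.IH] df)
    then have 2: "fil (int ?n) (?B - ?B')"
      by (simp add: sum_subtractf[symmetric] right_diff_distrib[symmetric] add.commute fil_sum)
    have "fil (int ?n) (vec b * (vec v * sec m (dd e f)) - vec v * (vec b * sec m (dd e f)))" for b e
      by (rule fil_mono[OF fil_vec_commute[OF fil_sec]]) simp
    then have 3: "fil (int ?n) (?B' - ?B'')"
      by (simp add: sum_subtractf[symmetric] fil_sum)
    have 4: "?B'' = of_nat ?n * (vec v * sec ?n f)"
    proof -
      have "?B'' = vec v * (of_nat ?n * sec ?n f)"
        using sec_euler[of ?n f] by (simp only: sum_distrib_left diff_Suc_1 zero_less_Suc simp_thms)
      then show ?thesis by (simp only: of_nat_scalar generator_scalar_comm)
    qed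
    have "fil (int ?n) ((?A + ?B) - (vec v * sec ?n f + ?B''))"
      using fil_add[OF 1 fil_trans[OF 2 3]] by (simp only: algebra_simps)
    also have "vec v * sec ?n f + ?B'' = scalar (of_nat (Suc ?n)) * (vec v * sec ?n f)"
      unfolding 4 of_nat_scalar[symmetric] by (simp add: algebra_simps)
    finally have "fil (int ?n) (scalar (1 / of_nat (Suc ?n)) * ((?A + ?B) - scalar (of_nat (Suc ?n)) * (vec v * sec ?n f)))"
      by (rule fil_scalar_mult)
    then have "fil (int ?n) (sec (Suc ?n) (\<lambda>u. \<omega> u v * f u) - vec v * sec ?n f)"
      unfolding e right_diff_distrib by (simp only: scalar_mult_cancel[OF of_nat_neq_0])
    then show ?case by (rule fil_sym)
  }
qed

text \<open>The same map for integer degrees, where it is zero in negative degrees.\<close>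

definition isec :: "int \<Rightarrow> ('v \<Rightarrow> complex) \<Rightarrow> 'v sra_gen nc_poly" where
  "isec k f = (if k < 0 then 0 else sec (nat k) f)"

lemma fil_isec: "fil k (isec k f)"
  using fil_sec[of "nat k" f] by (auto simp: isec_def)

lemma isec_Car [simp]: "isec k f \<in> Car"
  by (simp add: isec_def)

lemma isec_zero: "(\<And>u. f u = 0) \<Longrightarrow> isec k f = 0"
  using sec_cong[of f "\<lambda>u. 0" "nat k"] by (simp add: isec_def)

lemma isec_cong: "(\<And>u. f u = g u) \<Longrightarrow> isec k f = isec k g"
  by (metis ext)

lemma isec_add: "pol k f \<Longrightarrow> pol k g \<Longrightarrow> isec k (\<lambda>u. f u + g u) = isec k f + isec k g"
  by (simp add: isec_def sec_add)

lemma isec_vec_mult: "pol k f \<Longrightarrow> fil k (vec v * isec k f - isec (k + 1) (\<lambda>u. \<omega> u v * f u))"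
proof (cases "k < 0")
  case True
  assume f: "pol k f"
  have "isec (k + 1) (\<lambda>u. \<omega> u v * f u) = 0" by (rule isec_zero) (simp add: pol_neg[OF f True])
  then show ?thesis using True by (simp add: isec_def)
next
  case False
  assume f: "pol k f"
  then show ?thesis using sec_vec_mult[of "nat k" f v] False by (simp add: isec_def nat_add_distrib)
qed

lemma isec_grp: "pol k f \<Longrightarrow> \<gamma> \<in> \<Gamma> \<Longrightarrow> fil (k - 1) (grp \<gamma> * isec k f - isec k (\<lambda>u. f (ginv \<gamma> u)) * grp \<gamma>)"
proof (induction rule: pol.induct)
  case (pol_zero k)
  then show ?case by (simp add: isec_zero)
next
  case (pol_const a)
  then show ?case by (simp add: isec_def scalar_comm)
next
  case (pol_mult_form k f v)
  note g = \<open>\<gamma> \<in> \<Gamma>\<close>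
  let ?f = "\<lambda>u. f (ginv \<gamma> u)"
  let ?s = "isec (k + 1) (\<lambda>u. \<omega> u v * f u)"
  have fG: "pol k ?f" using pol_mult_form.hyps g by (rule pol_group)
  have "fil k (grp \<gamma> * (?s - vec v * isec k f))"
    by (intro fil_grp_mult g fil_sym[OF isec_vec_mult] pol_mult_form.hyps)
  then have 1: "fil k (grp \<gamma> * ?s - grp \<gamma> * vec v * isec k f)" by (simp add: right_diff_distrib mult.assoc)
  have "fil k ((grp \<gamma> * vec v - vec (\<gamma> v) * grp \<gamma>) * isec k f)"
    using g by (intro fil_ideal Rel_right Rel_grp_vec) auto
  then have 2: "fil k (grp \<gamma> * vec v * isec k f - vec (\<gamma> v) * (grp \<gamma> * isec k f))"
    by (simp add: left_diff_distrib mult.assoc)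
  have "fil (k - 1 + 1) (vec (\<gamma> v) * (grp \<gamma> * isec k f - isec k ?f * grp \<gamma>))"
    by (intro fil_vec_mult) (use pol_mult_form g in auto)
  then have 3: "fil k (vec (\<gamma> v) * (grp \<gamma> * isec k f) - vec (\<gamma> v) * isec k ?f * grp \<gamma>)"
    by (simp add: right_diff_distrib mult.assoc)
  have "fil k ((vec (\<gamma> v) * isec k ?f - isec (k + 1) (\<lambda>u. \<omega> u (\<gamma> v) * ?f u)) * grp \<gamma>)"
    by (intro fil_grp_mult_right isec_vec_mult fG g)
  then have 4: "fil k (vec (\<gamma> v) * isec k ?f * grp \<gamma> - isec (k + 1) (\<lambda>u. \<omega> u (\<gamma> v) * ?f u) * grp \<gamma>)"
    by (simp add: left_diff_distrib)
  from fil_trans[OF 1 fil_trans[OF 2 fil_trans[OF 3 4]]]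
  show ?case using g by (simp add: omega_ginv)
next
  case (pol_add k f h)
  have "pol k (\<lambda>u. f (ginv \<gamma> u))" "pol k (\<lambda>u. h (ginv \<gamma> u))" using pol_add by (auto intro: pol_group)
  then have "grp \<gamma> * isec k (\<lambda>u. f u + h u) - isec k (\<lambda>u. f (ginv \<gamma> u) + h (ginv \<gamma> u)) * grp \<gamma>
    = (grp \<gamma> * isec k f - isec k (\<lambda>u. f (ginv \<gamma> u)) * grp \<gamma>) + (grp \<gamma> * isec k h - isec k (\<lambda>u. h (ginv \<gamma> u)) * grp \<gamma>)"
    using pol_add by (simp add: isec_add algebra_simps)
  then show ?case using fil_add pol_add by simp
qed

lemma symbol_isec: "pol k f \<Longrightarrow> symbol k (isec k f) \<delta> u = (if \<delta> = id then f u else 0)"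
proof -
  have main: "pol (int n) f \<Longrightarrow> symbol (int n) (sec n f) \<delta> u = (if \<delta> = id then f u else 0)" for n
  proof (induction n arbitrary: f)
    case 0
    then have "f u = f 0" by (intro pol_0_const) auto
    then show ?case unfolding sec.simps symbol_scalar by (simp only: of_nat_0 simp_thms)
  next
    case (Suc n)
    have d: "pol (int n) (dd e f)" for e using pol_dd[OF Suc.prems, of e] by simp
    have "symbol (int n + 1) (vec b * sec n (dd e f)) \<delta> u = (if \<delta> = id then \<omega> u b * dd e f u else 0)" for b e
      unfolding symbol_vec_mult[OF fil_sec] Suc.IH[OF d] by (simp only: mult_zero_right split: if_split) blast
    moreover have "int (Suc n) = int n + 1" by simp
    ultimately have "symbol (int (Suc n)) (sec (Suc n) f) \<delta> u
        = 1 / of_nat (Suc n) * (\<Sum>p\<in>dual_basis. if \<delta> = id then \<omega> u (fst p) * dd (snd p) f u else 0)"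
      by (simp only: sec.simps symbol_scalar_mult symbol_sum)
    also have "\<dots> = (if \<delta> = id then 1 / of_nat (Suc n) * (\<Sum>p\<in>dual_basis. \<omega> u (fst p) * dd (snd p) f u) else 0)"
      by (cases "\<delta> = id") (simp_all del: of_nat_Suc)
    also have "(\<Sum>p\<in>dual_basis. \<omega> u (fst p) * dd (snd p) f u) = of_nat (Suc n) * f u"
      using euler[OF Suc.prems, of u] by (simp add: case_prod_unfold del: of_nat_Suc)
    also have "1 / of_nat (Suc n) * (of_nat (Suc n) * f u) = f u"
      by (simp del: of_nat_Suc)
    finally show ?case .
  qed
  assume f: "pol k f"
  show ?thesis
  proof (cases "k < 0")
    case True
    then show ?thesis using pol_neg[OF f True] by (simp add: isec_def symbol_0)
  next
    case False
    then have k: "int (nat k) = k" and i: "isec k f = sec (nat k) f" by (simp_all add: isec_def)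
    show ?thesis unfolding i using main[of "nat k"] f unfolding k .
  qed
qed

text \<open>The section of the symbol map on all families of polynomials indexed by \<open>\<Gamma>\<close>.\<close>

definition lift :: "int \<Rightarrow> (('v \<Rightarrow> 'v) \<Rightarrow> 'v \<Rightarrow> complex) \<Rightarrow> 'v sra_gen nc_poly" where
  "lift m h = (\<Sum>\<gamma>\<in>\<Gamma>. isec m (h \<gamma>) * grp \<gamma>)"

lemma fil_lift: "fil m (lift m h)"
  unfolding lift_def by (intro fil_sum fil_grp_mult_right fil_isec)

lemma lift_zero: "(\<And>\<gamma> u. \<gamma> \<in> \<Gamma> \<Longrightarrow> h \<gamma> u = 0) \<Longrightarrow> lift m h = 0"
  unfolding lift_def by (intro sum.neutral) (simp add: isec_zero)

lemma symbol_grp: "symbol m (grp \<gamma>) \<delta> u = (if m = 0 \<and> \<gamma> = \<delta> then 1 else 0)" if "\<gamma> \<in> \<Gamma>"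
proof -
  have "symbol m (grp \<gamma> * scalar 1) \<delta> u = (if m = 0 \<and> ginv \<gamma> \<circ> \<delta> = id then 1 else 0)"
    by (simp only: symbol_grp_mult symbol_scalar)
  then show ?thesis using ginv_comp_eq_iff[OF that, of \<delta> id] by (auto simp: scalar_simps)
qed

lemma symbol_mult_grp: "fil m p \<Longrightarrow> \<gamma> \<in> \<Gamma> \<Longrightarrow> symbol m (p * grp \<gamma>) \<delta> u = symbol m p (\<delta> \<circ> ginv \<gamma>) u"
proof -
  assume p: "fil m p" and g: "\<gamma> \<in> \<Gamma>"
  have "symbol (m + 0) (p * grp \<gamma>) \<delta> u = (\<Sum>\<epsilon>\<in>\<Gamma>. symbol m p \<epsilon> u * symbol 0 (grp \<gamma>) (ginv \<epsilon> \<circ> \<delta>) (ginv \<epsilon> u))"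
    by (rule symbol_mult[OF p fil_grp[OF g]])
  also have "\<dots> = (\<Sum>\<epsilon>\<in>\<Gamma>. if \<epsilon> = \<delta> \<circ> ginv \<gamma> then symbol m p \<epsilon> u else 0)"
  proof (intro sum.cong refl)
    fix \<epsilon> assume e: "\<epsilon> \<in> \<Gamma>"
    have "\<gamma> = ginv \<epsilon> \<circ> \<delta> \<longleftrightarrow> \<epsilon> = \<delta> \<circ> ginv \<gamma>"
      using g e by (metis comp_assoc comp_id ginv_comp ginv_comp_assoc)
    then show "symbol m p \<epsilon> u * symbol 0 (grp \<gamma>) (ginv \<epsilon> \<circ> \<delta>) (ginv \<epsilon> u) = (if \<epsilon> = \<delta> \<circ> ginv \<gamma> then symbol m p \<epsilon> u else 0)"
      using g by (simp add: symbol_grp)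
  qed
  also have "\<dots> = symbol m p (\<delta> \<circ> ginv \<gamma>) u"
    using symbol_outside[OF fil_Car[OF p]] by (simp add: finite_group)
  finally show ?thesis by simp
qed

lemma symbol_lift: "(\<And>\<gamma>. \<gamma> \<in> \<Gamma> \<Longrightarrow> pol m (h \<gamma>)) \<Longrightarrow> \<delta> \<in> \<Gamma> \<Longrightarrow> symbol m (lift m h) \<delta> u = h \<delta> u"
proof -
  assume h: "\<And>\<gamma>. \<gamma> \<in> \<Gamma> \<Longrightarrow> pol m (h \<gamma>)" and d: "\<delta> \<in> \<Gamma>"
  have "symbol m (isec m (h \<gamma>) * grp \<gamma>) \<delta> u = (if \<gamma> = \<delta> then h \<gamma> u else 0)" if g: "\<gamma> \<in> \<Gamma>" for \<gamma>
  proof -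
    have "\<delta> \<circ> ginv \<gamma> = id \<longleftrightarrow> \<gamma> = \<delta>" using g d by (metis comp_assoc comp_id id_comp ginv_comp)
    then show ?thesis using g by (simp add: symbol_mult_grp[OF fil_isec] symbol_isec[OF h])
  qed
  then show ?thesis unfolding lift_def symbol_sum using d by (simp add: finite_group)
qed

text \<open>The filtration is generated by left multiplication by group elements and vectors, and up to lower
  degree these commute with the section.\<close>

lemma fil_lift_symbol: "fil m p \<Longrightarrow> fil (m - 1) (p - lift m (symbol m p))"
proof (induction rule: fil.induct)
  case (fil_ideal p m)
  then show ?case by (simp add: lift_zero symbol_ideal fil.fil_ideal)
next
  case (fil_scalar m a)
  show ?case
  proof (cases "m = 0")
    case True
    have "lift m (symbol m (scalar a)) = (\<Sum>\<gamma>\<in>\<Gamma>. if \<gamma> = id then scalar a * grp id else 0)"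
      unfolding lift_def using True
      by (intro sum.cong) (auto simp: isec_def symbol_scalar isec_zero scalar_simps)
    then have "scalar a - lift m (symbol m (scalar a)) = - (scalar a * (grp id - 1))"
      by (simp add: finite_group algebra_simps)
    then show ?thesis using Rel_left[OF Rel_grp_id, of "scalar a"] by (auto intro!: fil.fil_ideal)
  next
    case False
    then show ?thesis using fil_scalar by (simp add: lift_zero symbol_scalar fil.fil_scalar)
  qed
next
  case (fil_grp_mult \<alpha> m p)
  let ?h = "symbol m p"
  have C: "p \<in> Car" using fil_grp_mult fil_Car by blast
  have a: "\<alpha> \<in> \<Gamma>" by fact
  have ph: "pol m (?h \<gamma>)" for \<gamma> by (rule pol_symbol[OF C])
  have 1: "fil (m - 1) (grp \<alpha> * p - grp \<alpha> * lift m ?h)"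
    using fil.fil_grp_mult[OF a fil_grp_mult.IH] by (simp add: right_diff_distrib)
  have "fil (m - 1) (grp \<alpha> * (isec m (?h \<gamma>) * grp \<gamma>) - isec m (\<lambda>u. ?h \<gamma> (ginv \<alpha> u)) * grp (\<alpha> \<circ> \<gamma>))" if g: "\<gamma> \<in> \<Gamma>" for \<gamma>
  proof -
    have "fil (m - 1) ((grp \<alpha> * isec m (?h \<gamma>) - isec m (\<lambda>u. ?h \<gamma> (ginv \<alpha> u)) * grp \<alpha>) * grp \<gamma>)"
      by (intro fil_grp_mult_right isec_grp ph a g)
    moreover have "fil (m - 1) (isec m (\<lambda>u. ?h \<gamma> (ginv \<alpha> u)) * - (grp (\<alpha> \<circ> \<gamma>) - grp \<alpha> * grp \<gamma>))"
      by (intro fil_ideal Rel_left Rel_uminus Rel_grp_comp a g) simp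
    ultimately have "fil (m - 1) ((grp \<alpha> * isec m (?h \<gamma>) - isec m (\<lambda>u. ?h \<gamma> (ginv \<alpha> u)) * grp \<alpha>) * grp \<gamma>
        + isec m (\<lambda>u. ?h \<gamma> (ginv \<alpha> u)) * - (grp (\<alpha> \<circ> \<gamma>) - grp \<alpha> * grp \<gamma>))" by (rule fil_add)
    then show ?thesis by (simp add: algebra_simps)
  qed
  then have 2: "fil (m - 1) (grp \<alpha> * lift m ?h - (\<Sum>\<gamma>\<in>\<Gamma>. isec m (\<lambda>u. ?h \<gamma> (ginv \<alpha> u)) * grp (\<alpha> \<circ> \<gamma>)))"
    unfolding lift_def sum_distrib_left sum_subtractf[symmetric] by (rule fil_sum)
  have "(\<Sum>\<gamma>\<in>\<Gamma>. isec m (\<lambda>u. ?h \<gamma> (ginv \<alpha> u)) * grp (\<alpha> \<circ> \<gamma>))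
      = (\<Sum>\<gamma>\<in>\<Gamma>. isec m (symbol m (grp \<alpha> * p) (\<alpha> \<circ> \<gamma>)) * grp (\<alpha> \<circ> \<gamma>))"
    using a by (intro sum.cong refl arg_cong2[where f = "(*)"] isec_cong) (simp add: symbol_grp_mult)
  also have "\<dots> = lift m (symbol m (grp \<alpha> * p))"
    unfolding lift_def by (rule sum.reindex_bij_betw[OF bij_betw_comp_left[OF a]])
  finally show ?case using fil_trans[OF 1 2] by simp
next
  case (fil_vec_mult m p x)
  let ?h = "symbol m p"
  have C: "p \<in> Car" using fil_vec_mult fil_Car by blast
  have ph: "pol m (?h \<gamma>)" for \<gamma> by (rule pol_symbol[OF C])
  have 1: "fil m (vec x * p - vec x * lift m ?h)"
    using fil.fil_vec_mult[OF fil_vec_mult.IH] by (simp add: right_diff_distrib)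
  have "fil m ((vec x * isec m (?h \<gamma>) - isec (m + 1) (\<lambda>u. \<omega> u x * ?h \<gamma> u)) * grp \<gamma>)" if "\<gamma> \<in> \<Gamma>" for \<gamma>
    by (intro fil_grp_mult_right isec_vec_mult ph that)
  then have "fil m (vec x * lift m ?h - (\<Sum>\<gamma>\<in>\<Gamma>. isec (m + 1) (\<lambda>u. \<omega> u x * ?h \<gamma> u) * grp \<gamma>))"
    unfolding lift_def sum_distrib_left sum_subtractf[symmetric]
    by (intro fil_sum) (simp add: algebra_simps)
  also have "(\<Sum>\<gamma>\<in>\<Gamma>. isec (m + 1) (\<lambda>u. \<omega> u x * ?h \<gamma> u) * grp \<gamma>) = lift (m + 1) (symbol (m + 1) (vec x * p))"
    unfolding lift_def using fil_vec_mult
    by (intro sum.cong refl arg_cong2[where f = "(*)"] isec_cong) (simp add: symbol_vec_mult)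
  finally show ?case using fil_trans[OF 1] by simp
next
  case (fil_add m p q)
  have "p \<in> Car" "q \<in> Car" using fil_add fil_Car by auto
  then have "isec m (symbol m (p + q) \<gamma>) = isec m (symbol m p \<gamma>) + isec m (symbol m q \<gamma>)" for \<gamma>
    using isec_add[OF pol_symbol pol_symbol, of p q m \<gamma> \<gamma>] isec_cong[of "symbol m (p + q) \<gamma>" "\<lambda>u. symbol m p \<gamma> u + symbol m q \<gamma> u"]
    by (simp add: symbol_add)
  then have "p + q - lift m (symbol m (p + q)) = (p - lift m (symbol m p)) + (q - lift m (symbol m q))"
    by (simp add: lift_def algebra_simps sum.distrib)
  then show ?case using fil.fil_add[OF fil_add.IH] by (simp only:)
qed

text \<open>The PBW theorem in the form in which it is used: leading terms are detected by the symbol.\<close>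

lemma fil_if_symbol_0:
  assumes "fil m p" "\<And>\<gamma> u. \<gamma> \<in> \<Gamma> \<Longrightarrow> symbol m p \<gamma> u = 0"
  shows "fil (m - 1) p"
  using fil_lift_symbol[OF assms(1)] lift_zero[of "symbol m p" m] assms(2) by simp

end

section \<open>Commutators and symbols\<close>

context symplectic_reflection_data
begin

abbreviation comm :: "'v sra_gen nc_poly \<Rightarrow> 'v sra_gen nc_poly \<Rightarrow> 'v sra_gen nc_poly" where
  "comm p q \<equiv> p * q - q * p"

text \<open>Purity means that the leading term lies in \<open>\<complex>[V]\<close>, without group elements.\<close>

definition pure :: "int \<Rightarrow> 'v sra_gen nc_poly \<Rightarrow> bool" where
  "pure m p \<longleftrightarrow> fil m p \<and> (\<forall>\<gamma> u. \<gamma> \<noteq> id \<longrightarrow> symbol m p \<gamma> u = 0)"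

lemma pure_fil: "pure m p \<Longrightarrow> fil m p"
  by (simp add: pure_def)

lemma symbol_pure_mult:
  assumes p: "pure m p" and q: "fil n q"
  shows "symbol (m + n) (p * q) \<gamma> u = symbol m p id u * symbol n q \<gamma> u"
proof -
  have "symbol (m + n) (p * q) \<gamma> u = (\<Sum>\<delta>\<in>\<Gamma>. symbol m p \<delta> u * symbol n q (ginv \<delta> \<circ> \<gamma>) (ginv \<delta> u))"
    by (rule symbol_mult[OF pure_fil[OF p] q])
  also have "\<dots> = (\<Sum>\<delta>\<in>\<Gamma>. if \<delta> = id then symbol m p id u * symbol n q \<gamma> u else 0)"
    using p by (intro sum.cong refl) (simp add: pure_def inv_id)
  finally show ?thesis by (simp add: finite_group)
qed

lemma symbol_mult_pure:
  assumes p: "fil m p" and q: "pure n q" and g: "\<gamma> \<in> \<Gamma>"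
  shows "symbol (m + n) (p * q) \<gamma> u = symbol m p \<gamma> u * symbol n q id (ginv \<gamma> u)"
proof -
  have "symbol (m + n) (p * q) \<gamma> u = (\<Sum>\<delta>\<in>\<Gamma>. symbol m p \<delta> u * symbol n q (ginv \<delta> \<circ> \<gamma>) (ginv \<delta> u))"
    by (rule symbol_mult[OF p pure_fil[OF q]])
  also have "\<dots> = (\<Sum>\<delta>\<in>\<Gamma>. if \<delta> = \<gamma> then symbol m p \<gamma> u * symbol n q id (ginv \<gamma> u) else 0)"
  proof (intro sum.cong refl)
    fix \<delta> assume d: "\<delta> \<in> \<Gamma>"
    have "ginv \<delta> \<circ> \<gamma> = id \<longleftrightarrow> \<delta> = \<gamma>" using ginv_comp_eq_iff[OF d, of \<gamma> id] by auto
    then show "symbol m p \<delta> u * symbol n q (ginv \<delta> \<circ> \<gamma>) (ginv \<delta> u) = (if \<delta> = \<gamma> then symbol m p \<gamma> u * symbol n q id (ginv \<gamma> u) else 0)"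
      using q by (cases "\<delta> = \<gamma>") (auto simp: pure_def)
  qed
  finally show ?thesis using g by (simp add: finite_group)
qed

lemma symbol_1: "symbol m 1 \<delta> u = (if m = 0 \<and> \<delta> = id then 1 else 0)"
  using symbol_scalar[of m 1 \<delta> u] unfolding scalar_simps .

lemma symbol_vec: "symbol 1 (vec x) \<delta> u = (if \<delta> = id then \<omega> u x else 0)"
  using symbol_vec_mult[OF fil_1[of 0], of x \<delta> u] unfolding symbol_1 by (cases "\<delta> = id") simp_all

lemma pure_vec: "pure 1 (vec x)"
  unfolding pure_def symbol_vec using fil_vec by simp

lemma pure_isec: "pol k f \<Longrightarrow> pure k (isec k f)"
  unfolding pure_def by (simp add: fil_isec symbol_isec)

lemma symbol_isec_id: "pol k f \<Longrightarrow> symbol k (isec k f) id u = f u"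
  by (simp add: symbol_isec)

lemma fil_comm: "fil m p \<Longrightarrow> fil n q \<Longrightarrow> fil (m + n) (comm p q)"
  using fil_mult[of m p n q] fil_mult[of n q m p] by (auto intro: fil_diff simp: add.commute)

text \<open>In the smash product, \<open>[f \<gamma>, x] = f (\<gamma> x - x) \<gamma>\<close>.\<close>

lemma symbol_comm_vec:
  assumes p: "fil m p" and g: "\<gamma> \<in> \<Gamma>"
  shows "symbol (m + 1) (comm p (vec x)) \<gamma> u = symbol m p \<gamma> u * \<omega> u (\<gamma> x - x)"
proof -
  have "symbol (m + 1) (p * vec x) \<gamma> u = symbol m p \<gamma> u * \<omega> (ginv \<gamma> u) x"
    using symbol_mult_pure[OF p pure_vec g, of x u] by (simp only: symbol_vec simp_thms if_True)
  moreover have "symbol (m + 1) (vec x * p) \<gamma> u = \<omega> u x * symbol m p \<gamma> u"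
    by (rule symbol_vec_mult[OF p])
  ultimately show ?thesis using g by (simp add: symbol_diff omega_ginv algebra_simps)
qed

lemma comm_mult_right: "comm p (q * r) = comm p q * r + q * comm p r"
  and comm_mult_left: "comm (p * q) r = p * comm q r + comm p r * q"
  by (simp_all add: algebra_simps)

lemma comm_add_right: "comm p (q + r) = comm p q + comm p r"
  and comm_diff_left: "comm (p - q) r = comm p r - comm q r"
  and comm_diff_right: "comm p (q - r) = comm p q - comm p r"
  by (simp_all add: algebra_simps)

lemma comm_sum_right: "comm p (\<Sum>i\<in>I. f i) = (\<Sum>i\<in>I. comm p (f i))"
  by (simp add: sum_distrib_left sum_distrib_right sum_subtractf)

lemma comm_sum_left: "comm (\<Sum>i\<in>I. f i) p = (\<Sum>i\<in>I. comm (f i) p)"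
  by (simp add: sum_distrib_left sum_distrib_right sum_subtractf)

lemma comm_scalar_left: "comm (scalar a * p) q = scalar a * comm p q"
  by (simp only: right_diff_distrib mult.assoc scalar_left_comm)

lemma comm_scalar: "comm p (scalar a) = 0"
  by (simp add: scalar_comm)

definition central :: "'v sra_gen nc_poly \<Rightarrow> bool" where
  "central p \<longleftrightarrow> p \<in> Car \<and> (\<forall>q\<in>Car. comm p q \<in> Rel)"

definition gamma_central :: "'v sra_gen nc_poly \<Rightarrow> bool" where
  "gamma_central p \<longleftrightarrow> p \<in> Car \<and> (\<forall>\<gamma>\<in>\<Gamma>. comm p (grp \<gamma>) \<in> Rel)"

lemma comm_Rel_right: "p \<in> Rel \<Longrightarrow> q \<in> Car \<Longrightarrow> comm q p \<in> Rel"
  by (auto intro: Rel_diff)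

lemma centralI:
  assumes "gamma_central p" "\<And>x. comm p (vec x) \<in> Rel"
  shows "central p"
proof -
  have p: "p \<in> Car" and g: "\<And>\<gamma>. \<gamma> \<in> \<Gamma> \<Longrightarrow> comm p (grp \<gamma>) \<in> Rel"
    using assms(1) by (auto simp: gamma_central_def)
  have "comm p q \<in> Rel" if "q \<in> Car" for q
    using that
  proof (induction q rule: Car_induct)
    case (scalar a)
    then show ?case by (simp only: comm_scalar Rel_0)
  next
    case (vec x q)
    show ?case unfolding comm_mult_right using vec assms(2) by (intro Rel_add Rel_left Rel_right) auto
  next
    case (grp \<gamma> q)
    show ?case unfolding comm_mult_right using grp g by (intro Rel_add Rel_left Rel_right) auto
  next
    case (add q r)
    then show ?case unfolding comm_add_right by (intro Rel_add)
  qed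
  then show ?thesis using p by (simp add: central_def)
qed

lemma comm_vec_vec: "comm (vec x) (vec y) - kappa x y \<in> Rel"
  using Rel_commutator by simp

lemma fil_comm_vec_vec: "fil 0 (comm (vec x) (vec y))"
  using fil_add[OF fil_ideal[OF comm_vec_vec, of 0 x y] fil_kappa[of x y]] by simp

lemma symbol_kappa_id: "symbol 0 (kappa x y) id u = t * \<omega> x y"
proof -
  have "symbol 0 (scalar (c s * \<omega>s s x y) * grp s) id u = 0" if "s \<in> refl" for s
    using that id_not_refl symbol_grp[OF refl_group[OF that], of 0 id u] by (auto simp: symbol_scalar_mult)
  then have "(\<Sum>s\<in>refl. symbol 0 (scalar (c s * \<omega>s s x y) * grp s) id u) = 0" by (intro sum.neutral ballI)
  moreover have "symbol 0 (grp id) id u = 1" using symbol_grp[OF group_id, of 0 id u] by simp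
  ultimately show ?thesis by (simp only: kappa_def symbol_add symbol_sum) (simp add: symbol_scalar_mult)
qed

lemma symbol_comm_vec_vec_id: "symbol 0 (comm (vec x) (vec y)) id u = t * \<omega> x y"
proof -
  have "symbol 0 (comm (vec x) (vec y) - kappa x y) id u = 0" by (rule symbol_ideal[OF comm_vec_vec])
  then show ?thesis by (simp only: symbol_diff[of 0 _ "kappa x y"] symbol_kappa_id right_minus_eq)
qed

lemma dd_commute: "pol k f \<Longrightarrow> dd x (dd e f) u = dd e (dd x f) u"
proof (induction arbitrary: u rule: pol.induct)
  case (pol_zero k)
  have "dd e (\<lambda>u. 0) = (\<lambda>u. 0)" for e by (rule ext) simp
  then show ?case by simp
next
  case (pol_const a)
  have "dd e (\<lambda>u. a) = (\<lambda>u. 0)" for e by (rule ext) simp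
  then show ?case by simp
next
  case (pol_mult_form k f v)
  have d: "dd e (\<lambda>u. \<omega> u v * f u) = (\<lambda>u. \<omega> e v * f u + \<omega> u v * dd e f u)" for e
    by (rule ext) (rule dd_mult_form[OF pol_mult_form(1)])
  have "pol (k - 1 + 1) (\<lambda>u. \<omega> u v * dd e f u)" for e by (intro pol.pol_mult_form pol_dd pol_mult_form(1))
  then have p: "pol k (\<lambda>u. \<omega> u v * dd e f u)" for e by simp
  have "dd x (\<lambda>u. \<omega> e v * f u + \<omega> u v * dd e f u) u
      = \<omega> e v * dd x f u + (\<omega> x v * dd e f u + \<omega> u v * dd x (dd e f) u)" for x e
    unfolding dd_add[OF pol_scale[OF pol_mult_form(1)] p] dd_scale[OF pol_mult_form(1)]
      dd_mult_form[OF pol_dd[OF pol_mult_form(1)]] ..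
  then show ?case unfolding d by (simp add: pol_mult_form.IH)
next
  case (pol_add k f g)
  have d: "dd e (\<lambda>u. f u + g u) = (\<lambda>u. dd e f u + dd e g u)" for e
    by (rule ext) (rule dd_add[OF pol_add(1,2)])
  show ?case unfolding d dd_add[OF pol_dd[OF pol_add(1)] pol_dd[OF pol_add(2)]] by (simp only: pol_add.IH)
qed

text \<open>The commutator is a derivation, and on vectors its value has degree \<open>0\<close>, which is two less than the
  degree of the product. The component of \<open>[x, y]\<close> at the identity is \<open>t \<omega>(x, y)\<close>, as the identity
  is not a reflection; so the leading term there is the Poisson bracket, up to the factor \<open>- t\<close>.\<close>

lemma comm_sec_vec:
  assumes "pol (int n) f"
  shows "fil (int n - 1) (comm (sec n f) (vec x))"
    and "symbol (int n - 1) (comm (sec n f) (vec x)) id u = - t * dd x f u"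
proof -
  have "fil (int n - 1) (comm (sec n f) (vec x)) \<and> symbol (int n - 1) (comm (sec n f) (vec x)) id u = - t * dd x f u"
    using assms
  proof (induction n arbitrary: f)
    case 0
    have "comm (sec 0 f) (vec x) = 0" by (simp only: sec.simps scalar_comm) simp
    moreover have "dd x f u = 0" using pol_neg[OF pol_dd[OF 0]] by simp
    ultimately show ?case by (simp only: fil_0 symbol_0 mult_zero_right simp_thms)
  next
    case (Suc n)
    have i: "int (Suc n) - 1 = int n" by simp
    have d: "pol (int n) (dd e f)" for e using pol_dd[OF Suc.prems, of e] by simp
    define T where "T b e = vec b * comm (sec n (dd e f)) (vec x) + comm (vec b) (vec x) * sec n (dd e f)" for b e
    have e: "comm (sec (Suc n) f) (vec x) = scalar (1 / of_nat (Suc n)) * (\<Sum>p\<in>dual_basis. T (fst p) (snd p))"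
      by (simp only: sec.simps comm_scalar_left comm_sum_left) (simp only: comm_mult_left T_def)
    have f1: "fil (int n) (vec b * comm (sec n (dd e f)) (vec x))" for b e
      using fil_vec_mult[of "int n - 1" "comm (sec n (dd e f)) (vec x)" b] Suc.IH[OF d] by simp
    have f2: "fil (int n) (comm (vec b) (vec x) * sec n (dd e f))" for b e
      using fil_mult[OF fil_comm_vec_vec[of b x] fil_sec[of n "dd e f"]] by simp
    have ps: "pure (int n) (sec n (dd e f))" for e using pure_isec[OF d, of e] by (simp add: isec_def)
    have s1: "symbol (int n) (vec b * comm (sec n (dd e f)) (vec x)) id u = \<omega> u b * (- t * dd x (dd e f) u)" for b e
      using symbol_vec_mult[of "int n - 1" "comm (sec n (dd e f)) (vec x)" b id u] Suc.IH[OF d] by simp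
    have s2: "symbol (int n) (comm (vec b) (vec x) * sec n (dd e f)) id u = t * \<omega> b x * dd e f u" for b e
      using symbol_mult_pure[OF fil_comm_vec_vec[of b x] ps[of e] group_id, of u] symbol_isec_id[OF d, of e u]
      by (simp add: symbol_comm_vec_vec_id isec_def inv_id)
    have ep: "(\<Sum>p\<in>dual_basis. \<omega> u (fst p) * dd x (dd (snd p) f) u) = of_nat n * dd x f u"
      using euler[OF pol_dd[OF Suc.prems, of x], of u] dd_commute[OF Suc.prems, of x _ u]
      by (simp add: case_prod_unfold)
    have "(\<Sum>p\<in>dual_basis. scale (\<omega> (fst p) x) (snd p)) = - x"
    proof -
      have "(\<Sum>p\<in>dual_basis. scale (\<omega> (fst p) x) (snd p)) = (\<Sum>p\<in>dual_basis. - scale (\<omega> x (fst p)) (snd p))"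
        by (intro sum.cong refl) (subst omega_skew, simp)
      then show ?thesis using dual_basis_right[of x] by (simp add: case_prod_unfold sum_negf)
    qed
    then have "dd (\<Sum>p\<in>dual_basis. scale (\<omega> (fst p) x) (snd p)) f u = - dd x f u"
      using dd_direction_scale[OF Suc.prems, of "-1" x u] by simp
    then have eq: "(\<Sum>p\<in>dual_basis. \<omega> (fst p) x * dd (snd p) f u) = - dd x f u"
      by (simp add: dd_direction_sum[OF Suc.prems] dd_direction_scale[OF Suc.prems])
    have "symbol (int n) (comm (sec (Suc n) f) (vec x)) id u
      = 1 / of_nat (Suc n) * (\<Sum>p\<in>dual_basis. \<omega> u (fst p) * (- t * dd x (dd (snd p) f) u) + t * \<omega> (fst p) x * dd (snd p) f u)"
      unfolding e symbol_scalar_mult symbol_sum T_def symbol_add s1 s2 ..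
    also have "(\<Sum>p\<in>dual_basis. \<omega> u (fst p) * (- t * dd x (dd (snd p) f) u) + t * \<omega> (fst p) x * dd (snd p) f u)
      = - t * (\<Sum>p\<in>dual_basis. \<omega> u (fst p) * dd x (dd (snd p) f) u) + t * (\<Sum>p\<in>dual_basis. \<omega> (fst p) x * dd (snd p) f u)"
      by (simp only: sum.distrib sum_distrib_left ac_simps)
    also have "\<dots> = of_nat (Suc n) * (- t * dd x f u)" unfolding ep eq by (simp add: algebra_simps)
    also have "1 / of_nat (Suc n) * (of_nat (Suc n) * (- t * dd x f u)) = - t * dd x f u"
      by (simp del: of_nat_Suc)
    finally have "symbol (int n) (comm (sec (Suc n) f) (vec x)) id u = - t * dd x f u" .
    moreover have "fil (int n) (comm (sec (Suc n) f) (vec x))"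
      unfolding e T_def by (intro fil_scalar_mult fil_sum fil_add f1 f2)
    ultimately show ?case unfolding i by blast
  qed
  then show "fil (int n - 1) (comm (sec n f) (vec x))"
    and "symbol (int n - 1) (comm (sec n f) (vec x)) id u = - t * dd x f u" by auto
qed

lemma comm_isec_vec:
  assumes f: "pol k f"
  shows "fil (k - 1) (comm (isec k f) (vec x))"
    and "symbol (k - 1) (comm (isec k f) (vec x)) id u = - t * dd x f u"
proof -
  have "fil (k - 1) (comm (isec k f) (vec x)) \<and> symbol (k - 1) (comm (isec k f) (vec x)) id u = - t * dd x f u"
  proof (cases "k < 0")
    case True
    then have "dd x f u = 0" using pol_neg[OF pol_dd[OF f]] by simp
    moreover have "comm (isec k f) (vec x) = 0" using True by (simp add: isec_def)
    ultimately show ?thesis by (simp only: fil_0 symbol_0 mult_zero_right simp_thms)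
  next
    case False
    then have k: "k = int (nat k)" by simp
    have "isec k f = sec (nat k) f" using False by (simp add: isec_def)
    then show ?thesis using comm_sec_vec[of "nat k" f x] f k by simp
  qed
  then show "fil (k - 1) (comm (isec k f) (vec x))"
    and "symbol (k - 1) (comm (isec k f) (vec x)) id u = - t * dd x f u" by auto
qed

text \<open>The \<open>\<gamma>\<close>-component of the leading term of \<open>[p, x]\<close> is that of \<open>p\<close> times the linear form attached to
  \<open>\<gamma> x - x\<close>, which is nonzero for some \<open>x\<close> if \<open>\<gamma> \<noteq> 1\<close>.\<close>

lemma pure_if_comm:
  assumes p: "fil m p" and c: "\<And>x. fil m (comm p (vec x))"
  shows "pure m p"
  unfolding pure_def
proof (intro conjI allI impI p)
  fix \<gamma> u assume g1: "\<gamma> \<noteq> (id :: 'v \<Rightarrow> 'v)"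
  show "symbol m p \<gamma> u = 0"
  proof (cases "\<gamma> \<in> \<Gamma>")
    case True
    obtain x where x: "\<gamma> x \<noteq> x" using g1 by (auto simp: fun_eq_iff)
    have "\<omega> u (\<gamma> x - x) * symbol m p \<gamma> u = 0" for u
      using symbol_comm_vec[OF p True, of x u] symbol_above[OF c, of "m + 1" x \<gamma> u] by (simp add: mult.commute)
    then show ?thesis by (rule form_cancel[OF pol_symbol[OF fil_Car[OF p]], rotated]) (use x in simp)
  qed (use symbol_outside[OF fil_Car[OF p]] in blast)
qed

lemma fil_diff_isec: "pure m p \<Longrightarrow> fil (m - 1) (p - isec m (symbol m p id))"
proof (rule fil_if_symbol_0)
  assume p: "pure m p"
  show "fil m (p - isec m (symbol m p id))" using p by (intro fil_diff fil_isec) (simp add: pure_def)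
  have pl: "pol m (symbol m p id)" using p fil_Car by (auto simp: pure_def intro: pol_symbol)
  fix \<gamma> u
  show "symbol m (p - isec m (symbol m p id)) \<gamma> u = 0"
    using p by (cases "\<gamma> = id") (simp_all only: symbol_diff symbol_isec[OF pl] pure_def, simp_all)
qed

text \<open>The claim is known for the symmetrised lift of the symbol. The difference \<open>b\<close> has degree \<open>m - 1\<close>, and
  it is again pure because its commutators have low order; so it contributes nothing in degree
  \<open>m - 1\<close> at the identity.\<close>

lemma symbol_comm_id:
  assumes p: "fil m p" and c: "\<And>x. fil (m - 1) (comm p (vec x))"
  shows "symbol (m - 1) (comm p (vec x)) id u = - t * dd x (symbol m p id) u"
proof -
  let ?f = "symbol m p id"
  have f: "pol m ?f" using fil_Car[OF p] by (rule pol_symbol)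
  have "pure m p" by (rule pure_if_comm[OF p fil_mono[OF c]]) simp
  define b where "b = p - isec m ?f"
  have b: "fil (m - 1) b" unfolding b_def by (rule fil_diff_isec) fact
  have bc: "fil (m - 1) (comm b (vec x))" for x
    unfolding b_def comm_diff_left by (intro fil_diff c comm_isec_vec f)
  have pb: "pure (m - 1) b" by (rule pure_if_comm[OF b bc])
  define g where "g = symbol (m - 1) b id"
  have g: "pol (m - 1) g" unfolding g_def using fil_Car[OF b] by (rule pol_symbol)
  have r: "fil (m - 1 - 1) (b - isec (m - 1) g)" unfolding g_def by (rule fil_diff_isec[OF pb])
  have "symbol (m - 1 - 1 + 1) (comm (b - isec (m - 1) g) (vec x)) id u = 0"
    unfolding symbol_comm_vec[OF r group_id] by simp
  then have 1: "symbol (m - 1) (comm (b - isec (m - 1) g) (vec x)) id u = 0" by simp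
  have 2: "symbol (m - 1) (comm (isec (m - 1) g) (vec x)) id u = 0"
    by (rule symbol_above[OF comm_isec_vec(1)[OF g]]) simp
  have 3: "symbol (m - 1) (comm b (vec x)) id u = 0"
    using 1 unfolding comm_diff_left symbol_diff[of _ "comm b (vec x)"] 2 by simp
  have "symbol (m - 1) (comm p (vec x)) id u - symbol (m - 1) (comm (isec m ?f) (vec x)) id u = 0"
    using 3 unfolding b_def comm_diff_left symbol_diff[of _ "comm p (vec x)"] .
  then show ?thesis using comm_isec_vec(2)[OF f, of x u] by (simp only: right_minus_eq)
qed

section \<open>The centre for nonzero \<open>t\<close>\<close>

text \<open>The symbol of a central element has no derivatives, so by Euler's identity it vanishes in positive
  degree.\<close>

lemma central_fil_0:
  assumes t: "t \<noteq> 0" and z: "central z"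
  shows "fil 0 z"
proof -
  have zC: "z \<in> Car" and zc: "\<And>q. q \<in> Car \<Longrightarrow> comm z q \<in> Rel" using z by (auto simp: central_def)
  have cz: "fil k (comm z (vec x))" for k x by (intro fil_ideal zc) simp
  have step: "fil (int n) z" if "fil (int (Suc n)) z" for n
  proof -
    have "fil (int (Suc n) - 1) z"
    proof (rule fil_if_symbol_0[OF that])
      fix \<gamma> u
      have pz: "pure (int (Suc n)) z" by (rule pure_if_comm[OF that cz])
      show "symbol (int (Suc n)) z \<gamma> u = 0"
      proof (cases "\<gamma> = id")
        case True
        let ?f = "symbol (int (Suc n)) z id"
        have f: "pol (int (Suc n)) ?f" by (rule pol_symbol[OF zC])
        have "dd x ?f u = 0" for x
          using symbol_comm_id[OF that cz, of x u] symbol_ideal[OF zc, of "vec x"] t by simp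
        then have "of_int (int (Suc n)) * ?f u = 0" using euler[OF f, of u] by (simp add: case_prod_unfold)
        then show ?thesis using True by (simp del: of_nat_Suc)
      qed (use pz in \<open>simp add: pure_def\<close>)
    qed
    then show ?thesis by simp
  qed
  obtain m where "m \<ge> 0" "fil m z" using fil_exhaust[OF zC] by blast
  then have "fil (int (nat m)) z" by simp
  then show ?thesis
  proof (induction "nat m" arbitrary: m)
    case (Suc n)
    then show ?case using step[of n] by (metis nat_int)
  qed simp
qed

theorem central_scalar:
  assumes t: "t \<noteq> 0" and z: "central z"
  shows "\<exists>k. z - scalar k \<in> Rel"
proof -
  have zC: "z \<in> Car" and zc: "\<And>q. q \<in> Car \<Longrightarrow> comm z q \<in> Rel" using z by (auto simp: central_def)
  have f0: "fil 0 z" by (rule central_fil_0[OF t z])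
  have pz: "pure 0 z" by (rule pure_if_comm[OF f0]) (intro fil_ideal zc, simp)
  define k where "k = symbol 0 z id 0"
  have "fil (0 - 1) (z - scalar k)"
  proof (rule fil_if_symbol_0)
    show "fil 0 (z - scalar k)" by (intro fil_diff f0 fil_scalar) simp
    fix \<gamma> u
    have "symbol 0 z id u = k" unfolding k_def by (rule pol_0_const[OF pol_symbol[OF zC] refl])
    then show "symbol 0 (z - scalar k) \<gamma> u = 0"
      using pz by (cases "\<gamma> = id") (simp_all add: symbol_diff symbol_scalar pure_def)
  qed
  then have "z - scalar k \<in> Rel" by (rule fil_neg) simp
  then show ?thesis ..
qed

end

section \<open>Central lifts of invariants for \<open>t = 0\<close>\<close>

context symplectic_reflection_data
begin

subsection \<open>Averaging\<close>

definition avg :: "'v sra_gen nc_poly \<Rightarrow> 'v sra_gen nc_poly" where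
  "avg p = scalar (1 / of_nat (card \<Gamma>)) * (\<Sum>\<gamma>\<in>\<Gamma>. grp \<gamma> * p * grp (ginv \<gamma>))"

lemma fil_avg: "fil m p \<Longrightarrow> fil m (avg p)"
  unfolding avg_def by (intro fil_scalar_mult fil_sum fil_grp_mult_right fil_grp_mult) auto

lemma avg_Car: "p \<in> Car \<Longrightarrow> avg p \<in> Car"
  unfolding avg_def by (intro Car_mult Car_scalar Car_sum) auto

lemma symbol_avg:
  assumes p: "fil m p"
  shows "symbol m (avg p) \<delta> u = 1 / of_nat (card \<Gamma>) * (\<Sum>\<gamma>\<in>\<Gamma>. symbol m p (ginv \<gamma> \<circ> \<delta> \<circ> \<gamma>) (ginv \<gamma> u))"
proof -
  have "symbol m (grp \<gamma> * p * grp (ginv \<gamma>)) \<delta> u = symbol m p (ginv \<gamma> \<circ> \<delta> \<circ> \<gamma>) (ginv \<gamma> u)" if g: "\<gamma> \<in> \<Gamma>" for \<gamma>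
    unfolding symbol_mult_grp[OF fil_grp_mult[OF g p] group_ginv[OF g]] symbol_grp_mult
    using g by (simp only: ginv_ginv comp_assoc)
  then show ?thesis unfolding avg_def symbol_scalar_mult symbol_sum by (simp cong: sum.cong)
qed

lemma gamma_central_avg:
  assumes p: "p \<in> Car"
  shows "gamma_central (avg p)"
  unfolding gamma_central_def
proof (intro conjI ballI avg_Car p)
  fix \<delta> assume d: "\<delta> \<in> \<Gamma>"
  let ?s = "\<lambda>\<gamma>. grp \<gamma> * p * grp (ginv \<gamma>)"
  have 1: "grp \<delta> * ?s \<gamma> - grp (\<delta> \<circ> \<gamma>) * p * grp (ginv \<gamma>) \<in> Rel" if g: "\<gamma> \<in> \<Gamma>" for \<gamma>
  proof -
    have "- (grp (\<delta> \<circ> \<gamma>) - grp \<delta> * grp \<gamma>) * (p * grp (ginv \<gamma>)) \<in> Rel"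
      by (intro Rel_right Rel_uminus Rel_grp_comp d g) (use p g in auto)
    then show ?thesis by (simp add: algebra_simps)
  qed
  have 2: "?s \<gamma> * grp \<delta> - grp \<gamma> * p * grp (ginv \<gamma> \<circ> \<delta>) \<in> Rel" if g: "\<gamma> \<in> \<Gamma>" for \<gamma>
  proof -
    have "(grp \<gamma> * p) * - (grp (ginv \<gamma> \<circ> \<delta>) - grp (ginv \<gamma>) * grp \<delta>) \<in> Rel"
      by (intro Rel_left Rel_uminus Rel_grp_comp d) (use p g in auto)
    then show ?thesis by (simp add: algebra_simps)
  qed
  have "(\<Sum>\<gamma>\<in>\<Gamma>. grp \<gamma> * p * grp (ginv \<gamma> \<circ> \<delta>)) = (\<Sum>\<gamma>\<in>\<Gamma>. grp (\<delta> \<circ> \<gamma>) * p * grp (ginv (\<delta> \<circ> \<gamma>) \<circ> \<delta>))"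
    by (rule sum.reindex_bij_betw[OF bij_betw_comp_left[OF d], symmetric])
  also have "\<dots> = (\<Sum>\<gamma>\<in>\<Gamma>. grp (\<delta> \<circ> \<gamma>) * p * grp (ginv \<gamma>))"
    using d by (intro sum.cong refl) (simp add: comp_assoc)
  finally have e: "(\<Sum>\<gamma>\<in>\<Gamma>. grp \<gamma> * p * grp (ginv \<gamma> \<circ> \<delta>)) = (\<Sum>\<gamma>\<in>\<Gamma>. grp (\<delta> \<circ> \<gamma>) * p * grp (ginv \<gamma>))" .
  have "(\<Sum>\<gamma>\<in>\<Gamma>. ?s \<gamma> * grp \<delta> - grp \<gamma> * p * grp (ginv \<gamma> \<circ> \<delta>)) - (\<Sum>\<gamma>\<in>\<Gamma>. grp \<delta> * ?s \<gamma> - grp (\<delta> \<circ> \<gamma>) * p * grp (ginv \<gamma>)) \<in> Rel"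
    by (intro Rel_diff Rel_sum 1 2)
  then have "comm (\<Sum>\<gamma>\<in>\<Gamma>. ?s \<gamma>) (grp \<delta>) \<in> Rel"
    unfolding sum_subtractf e by (simp add: sum_distrib_left sum_distrib_right)
  then show "comm (avg p) (grp \<delta>) \<in> Rel"
    unfolding avg_def comm_scalar_left by (rule Rel_left) (rule Car_scalar)
qed

text \<open>Since \<open>[\<gamma> p \<gamma>\<^sup>-\<^sup>1, x] = \<gamma> [p, \<gamma>\<^sup>-\<^sup>1 x] \<gamma>\<^sup>-\<^sup>1\<close>, averaging does not destroy bounds on the order of
  commutators with vectors.\<close>

lemma comm_avg_vec:
  assumes p: "p \<in> Car"
  shows "comm (avg p) (vec x) - scalar (1 / of_nat (card \<Gamma>)) * (\<Sum>\<gamma>\<in>\<Gamma>. grp \<gamma> * comm p (vec (ginv \<gamma> x)) * grp (ginv \<gamma>)) \<in> Rel"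
proof -
  have 1: "comm (grp \<gamma> * p * grp (ginv \<gamma>)) (vec x) - grp \<gamma> * comm p (vec (ginv \<gamma> x)) * grp (ginv \<gamma>) \<in> Rel" if g: "\<gamma> \<in> \<Gamma>" for \<gamma>
  proof -
    have "grp \<gamma> * p * (grp (ginv \<gamma>) * vec x - vec (ginv \<gamma> x) * grp (ginv \<gamma>))
      + (grp \<gamma> * vec (ginv \<gamma> x) - vec (\<gamma> (ginv \<gamma> x)) * grp \<gamma>) * (p * grp (ginv \<gamma>)) \<in> Rel"
      using g p by (intro Rel_add Rel_left Rel_right Rel_grp_vec) auto
    then show ?thesis using g by (simp add: ginv_right algebra_simps)
  qed
  have "scalar (1 / of_nat (card \<Gamma>)) * (\<Sum>\<gamma>\<in>\<Gamma>. comm (grp \<gamma> * p * grp (ginv \<gamma>)) (vec x) - grp \<gamma> * comm p (vec (ginv \<gamma> x)) * grp (ginv \<gamma>)) \<in> Rel"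
    by (intro Rel_left Rel_sum 1 Car_scalar)
  then show ?thesis unfolding avg_def comm_scalar_left comm_sum_left
    by (simp only: sum_subtractf right_diff_distrib)
qed

lemma fil_comm_avg_vec:
  assumes p: "p \<in> Car" and c: "\<And>x. fil k (comm p (vec x))"
  shows "fil k (comm (avg p) (vec x))"
proof (subst fil_cong[OF fil_ideal[OF comm_avg_vec[OF p]]])
  show "fil k (scalar (1 / of_nat (card \<Gamma>)) * (\<Sum>\<gamma>\<in>\<Gamma>. grp \<gamma> * comm p (vec (ginv \<gamma> x)) * grp (ginv \<gamma>)))"
    using c by (intro fil_scalar_mult fil_sum fil_grp_mult_right fil_grp_mult) auto
qed

lemma symbol_comm_avg_vec:
  assumes p: "p \<in> Car" and c: "\<And>x. fil k (comm p (vec x))"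
  shows "symbol k (comm (avg p) (vec x)) \<delta> u = 1 / of_nat (card \<Gamma>) *
    (\<Sum>\<gamma>\<in>\<Gamma>. symbol k (comm p (vec (ginv \<gamma> x))) (ginv \<gamma> \<circ> \<delta> \<circ> \<gamma>) (ginv \<gamma> u))"
proof -
  have 1: "symbol k (grp \<gamma> * q * grp (ginv \<gamma>)) \<delta> u = symbol k q (ginv \<gamma> \<circ> \<delta> \<circ> \<gamma>) (ginv \<gamma> u)" if g: "\<gamma> \<in> \<Gamma>" and q: "fil k q" for \<gamma> q
    unfolding symbol_mult_grp[OF fil_grp_mult[OF g q] group_ginv[OF g]] symbol_grp_mult
    using g by (simp only: ginv_ginv comp_assoc)
  have "symbol k (comm (avg p) (vec x)) \<delta> u
    = symbol k (scalar (1 / of_nat (card \<Gamma>)) * (\<Sum>\<gamma>\<in>\<Gamma>. grp \<gamma> * comm p (vec (ginv \<gamma> x)) * grp (ginv \<gamma>))) \<delta> u"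
    using symbol_ideal[OF comm_avg_vec[OF p], of k x \<delta> u] unfolding symbol_diff[of k "comm (avg p) (vec x)"] by simp
  also have "\<dots> = 1 / of_nat (card \<Gamma>) * (\<Sum>\<gamma>\<in>\<Gamma>. symbol k (comm p (vec (ginv \<gamma> x))) (ginv \<gamma> \<circ> \<delta> \<circ> \<gamma>) (ginv \<gamma> u))"
    unfolding symbol_scalar_mult symbol_sum
    by (intro arg_cong2[where f = "(*)"] refl sum.cong 1 c)
  finally show ?thesis .
qed

subsection \<open>Approximately central lifts\<close>

definition invariant_fun :: "('v \<Rightarrow> complex) \<Rightarrow> bool" where
  "invariant_fun f \<longleftrightarrow> (\<forall>\<gamma>\<in>\<Gamma>. \<forall>u. f (ginv \<gamma> u) = f u)"

text \<open>Central lifts of the invariant \<open>f\<close> of degree \<open>m\<close> are reached by successive approximation: \<open>d\<close> measures by how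
  much the commutators with vectors have lower order than products. Once \<open>m + 1 - d\<close> is negative,
  they are zero in the algebra.\<close>

definition approx_central :: "int \<Rightarrow> int \<Rightarrow> ('v \<Rightarrow> complex) \<Rightarrow> 'v sra_gen nc_poly \<Rightarrow> bool" where
  "approx_central d m f z \<longleftrightarrow> pure m z \<and> (\<forall>u. symbol m z id u = f u) \<and> gamma_central z \<and>
     (\<forall>x. fil (m + 1 - d) (comm z (vec x)))"

definition all_approx_central :: "int \<Rightarrow> bool" where
  "all_approx_central d \<longleftrightarrow> (\<forall>m f. pol m f \<longrightarrow> invariant_fun f \<longrightarrow> (\<exists>z. approx_central d m f z))"

lemma approx_centralD:
  assumes "approx_central d m f z"
  shows "pure m z" "fil m z" "z \<in> Car" "symbol m z id u = f u" "gamma_central z" "fil (m + 1 - d) (comm z (vec x))"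
  using assms fil_Car by (auto simp: approx_central_def pure_def)

lemma conj_id: "\<gamma> \<in> \<Gamma> \<Longrightarrow> ginv \<gamma> \<circ> id \<circ> \<gamma> = id"
  by simp

lemma conj_eq_id_iff: "\<gamma> \<in> \<Gamma> \<Longrightarrow> ginv \<gamma> \<circ> \<delta> \<circ> \<gamma> = id \<longleftrightarrow> \<delta> = id"
  by (metis comp_assoc comp_id ginv_comp ginv_comp_assoc id_comp)

lemma pure_avg:
  assumes p: "pure m p" and inv: "invariant_fun (symbol m p id)"
  shows "pure m (avg p)" "symbol m (avg p) id u = symbol m p id u"
proof -
  have s: "symbol m (avg p) \<delta> u = 1 / of_nat (card \<Gamma>) * (\<Sum>\<gamma>\<in>\<Gamma>. symbol m p (ginv \<gamma> \<circ> \<delta> \<circ> \<gamma>) (ginv \<gamma> u))" for \<delta> u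
    by (rule symbol_avg[OF pure_fil[OF p]])
  have "symbol m (avg p) \<delta> u = 0" if "\<delta> \<noteq> id" for \<delta> u
  proof -
    have "(\<Sum>\<gamma>\<in>\<Gamma>. symbol m p (ginv \<gamma> \<circ> \<delta> \<circ> \<gamma>) (ginv \<gamma> u)) = 0"
      using p that by (intro sum.neutral ballI) (simp only: pure_def conj_eq_id_iff simp_thms)
    then show ?thesis unfolding s by simp
  qed
  then show "pure m (avg p)" using p by (auto simp: pure_def fil_avg)
  have "(\<Sum>\<gamma>\<in>\<Gamma>. symbol m p (ginv \<gamma> \<circ> id \<circ> \<gamma>) (ginv \<gamma> u)) = (\<Sum>\<gamma>\<in>\<Gamma>. symbol m p id u)"
    using inv by (intro sum.cong refl) (simp only: conj_id invariant_fun_def)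
  then show "symbol m (avg p) id u = symbol m p id u" unfolding s by simp
qed

lemma approx_central_avg:
  assumes p: "pure m p" and inv: "invariant_fun f" and f: "\<And>u. symbol m p id u = f u"
    and c: "\<And>x. fil (m + 1 - d) (comm p (vec x))"
  shows "approx_central d m f (avg p)"
proof -
  have C: "p \<in> Car" using p fil_Car by (auto simp: pure_def)
  have "invariant_fun (symbol m p id)" using inv f by (simp add: invariant_fun_def)
  from pure_avg[OF p this] show ?thesis
    unfolding approx_central_def using f fil_comm_avg_vec[OF C c] gamma_central_avg[OF C] by simp
qed

text \<open>Commutators of vectors have degree \<open>0\<close>, so symmetrised lifts already gain two degrees; averaging makes
  them commute with \<open>\<Gamma>\<close>.\<close>

lemma all_approx_central_2: "all_approx_central 2"
  unfolding all_approx_central_def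
proof (intro allI impI)
  fix m f assume f: "pol m f" "invariant_fun f"
  have "approx_central 2 m f (avg (isec m f))"
  proof (rule approx_central_avg[OF pure_isec[OF f(1)] f(2) symbol_isec_id[OF f(1)]])
    show "fil (m + 1 - 2) (comm (isec m f) (vec x))" for x using comm_isec_vec(1)[OF f(1), of x] by simp
  qed
  then show "\<exists>z. approx_central 2 m f z" ..
qed

subsection \<open>Removing the group components\<close>

text \<open>Exactness of the Koszul complex twisted by \<open>\<gamma>\<close> in degree one. It holds because \<open>\<gamma>\<close> displaces
  vectors in two independent directions, and two independent linear forms are coprime.\<close>

lemma twisted_koszul:
  assumes g: "\<gamma> \<in> \<Gamma>" "\<gamma> \<noteq> id" and F: "\<And>x. pol k (F x)"
    and eq: "\<And>x y u. F x u * \<omega> u (\<gamma> y - y) = F y u * \<omega> u (\<gamma> x - x)"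
  shows "\<exists>q. pol (k - 1) q \<and> (\<forall>x u. F x u = q u * \<omega> u (\<gamma> x - x))"
proof -
  obtain x where x: "\<gamma> x \<noteq> x" using g(2) by (auto simp: fun_eq_iff)
  let ?w = "\<gamma> x - x"
  have w: "?w \<noteq> 0" using x by simp
  obtain y where y: "\<And>a. \<gamma> y - y \<noteq> scale a ?w" using displacement_not_in_line[OF g] by blast
  have "F x u = 0" if u: "\<omega> u ?w = 0" for u
  proof (rule form_prime[OF F w y _ u])
    show "\<omega> u (\<gamma> y - y) * F x u = 0" if "\<omega> u ?w = 0" for u
      using eq[of x u y] that by (simp add: mult.commute)
  qed
  then obtain q where q: "pol (k - 1) q" "F x = (\<lambda>u. \<omega> u ?w * q u)"
    using form_divides[OF F w] by blast
  have "F z u - q u * \<omega> u (\<gamma> z - z) = 0" for z u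
  proof (rule form_cancel[OF _ w, where f = "\<lambda>u. F z u - q u * \<omega> u (\<gamma> z - z)"])
    have "pol (k - 1 + 1) (\<lambda>u. \<omega> u (\<gamma> z - z) * q u)" by (rule pol_mult_form[OF q(1)])
    then have "pol k (\<lambda>u. q u * \<omega> u (\<gamma> z - z))" by (simp add: mult.commute)
    then show "pol k (\<lambda>u. F z u - q u * \<omega> u (\<gamma> z - z))" by (intro pol_diff F)
    show "\<omega> u ?w * (F z u - q u * \<omega> u (\<gamma> z - z)) = 0" for u
      using eq[of z u x] unfolding q(2) right_diff_distrib by (simp only: ac_simps right_minus_eq)
  qed
  then show ?thesis using q(1) by (intro exI[of _ q]) simp
qed

lemma comm_kappa: "gamma_central z \<Longrightarrow> comm z (kappa x y) \<in> Rel"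
  unfolding kappa_def comm_add_right comm_sum_right
proof (intro Rel_add Rel_sum)
  assume z: "gamma_central z"
  have "comm z (scalar a * grp \<gamma>) \<in> Rel" if "\<gamma> \<in> \<Gamma>" for a \<gamma>
  proof -
    have "scalar a * comm z (grp \<gamma>) \<in> Rel" using z that by (intro Rel_left) (auto simp: gamma_central_def)
    then show ?thesis by (simp only: right_diff_distrib scalar_left_comm mult.assoc)
  qed
  then show "comm z (scalar (t * \<omega> x y) * grp id) \<in> Rel" "\<And>s. s \<in> refl \<Longrightarrow> comm z (scalar (c s * \<omega>s s x y) * grp s) \<in> Rel"
    by (auto simp: refl_group)
qed

text \<open>Let \<open>F\<^sub>x\<close> be a component of the symbol of \<open>[z, x]\<close> at \<open>\<gamma> \<noteq> 1\<close>. As \<open>[x, y]\<close> lies in \<open>\<complex>\<Gamma>\<close>, with which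
  \<open>z\<close> commutes, the Jacobi identity makes \<open>F\<close> a cocycle of the twisted Koszul complex. Hence \<open>F\<^sub>x\<close> is
  \<open>q (\<gamma> x - x)\<close>, which is also the symbol of the commutator of a lift of \<open>q \<gamma>\<close> with \<open>x\<close>, and that lift is
  subtracted from \<open>z\<close>. Averaging restores the commutation with \<open>\<Gamma>\<close>.\<close>

lemma remove_group_components:
  assumes z: "approx_central d m f z" and d: "d \<ge> 1" and inv: "invariant_fun f"
  shows "\<exists>z'. approx_central d m f z' \<and> (\<forall>x \<gamma> u. \<gamma> \<noteq> id \<longrightarrow> symbol (m + 1 - d) (comm z' (vec x)) \<gamma> u = 0)"
proof -
  note zD = approx_centralD[OF z]
  let ?k = "m + 1 - d"
  define F where "F x \<gamma> = symbol ?k (comm z (vec x)) \<gamma>" for x \<gamma>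
  have cC: "comm z (vec x) \<in> Car" for x using zD(3) by simp
  have F: "pol ?k (F x \<gamma>)" for x \<gamma> unfolding F_def by (rule pol_symbol[OF cC])
  have sym: "F x \<gamma> u * \<omega> u (\<gamma> y - y) = F y \<gamma> u * \<omega> u (\<gamma> x - x)" if g: "\<gamma> \<in> \<Gamma>" for x y \<gamma> u
  proof -
    have "comm z (comm (vec x) (vec y) - kappa x y) + comm z (kappa x y) \<in> Rel"
      using comm_vec_vec[of x y] zD(3,5) by (intro Rel_add comm_Rel_right comm_kappa)
    then have "comm (comm z (vec x)) (vec y) - comm (comm z (vec y)) (vec x) \<in> Rel"
      by (simp add: algebra_simps)
    from symbol_ideal[OF this, of "?k + 1" \<gamma> u]
    have "symbol (?k + 1) (comm (comm z (vec x)) (vec y)) \<gamma> u = symbol (?k + 1) (comm (comm z (vec y)) (vec x)) \<gamma> u"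
      unfolding symbol_diff[of _ "comm (comm z (vec x)) (vec y)"] by simp
    then show ?thesis unfolding symbol_comm_vec[OF zD(6) g] F_def .
  qed
  have "\<exists>q. pol (?k - 1) q \<and> (\<forall>x u. F x \<gamma> u = q u * \<omega> u (\<gamma> x - x))" if "\<gamma> \<in> \<Gamma>" "\<gamma> \<noteq> id" for \<gamma>
    by (rule twisted_koszul[OF that F sym[OF that(1)]])
  then obtain q0 where q0: "\<And>\<gamma>. \<gamma> \<in> \<Gamma> \<Longrightarrow> \<gamma> \<noteq> id \<Longrightarrow> pol (?k - 1) (q0 \<gamma>)"
    "\<And>\<gamma> x u. \<gamma> \<in> \<Gamma> \<Longrightarrow> \<gamma> \<noteq> id \<Longrightarrow> F x \<gamma> u = q0 \<gamma> u * \<omega> u (\<gamma> x - x)" by metis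
  define q where "q \<gamma> = (if \<gamma> = id then (\<lambda>u. 0) else q0 \<gamma>)" for \<gamma>
  have q: "pol (?k - 1) (q \<gamma>)" if "\<gamma> \<in> \<Gamma>" for \<gamma> using q0(1) that by (cases "\<gamma> = id") (simp_all add: q_def)
  define b where "b = lift (?k - 1) q"
  have b: "fil (?k - 1) b" unfolding b_def by (rule fil_lift)
  have sb: "symbol (?k - 1) b \<gamma> u = q \<gamma> u" if "\<gamma> \<in> \<Gamma>" for \<gamma> u
    unfolding b_def by (rule symbol_lift[OF q that])
  have cb: "symbol ?k (comm b (vec x)) \<gamma> u = q \<gamma> u * \<omega> u (\<gamma> x - x)" if "\<gamma> \<in> \<Gamma>" for \<gamma> u x
    using symbol_comm_vec[OF b that, of x u] unfolding sb[OF that] diff_add_cancel .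
  have fcb: "fil ?k (comm b (vec x))" for x
    using fil_comm[OF b fil_vec, of x] unfolding diff_add_cancel .
  let ?y = "z - b"
  have y0: "symbol ?k (comm ?y (vec x)) \<gamma> u = 0" if g: "\<gamma> \<noteq> id" for x \<gamma> u
  proof (cases "\<gamma> \<in> \<Gamma>")
    case True
    have "symbol ?k (comm ?y (vec x)) \<gamma> u = F x \<gamma> u - q \<gamma> u * \<omega> u (\<gamma> x - x)"
      unfolding comm_diff_left symbol_diff[of _ "comm z (vec x)"] cb[OF True] F_def ..
    then show ?thesis using q0(2)[OF True g] g by (simp add: q_def)
  next
    case False
    have "comm ?y (vec x) \<in> Car" using zD(3) fil_Car[OF b] by simp
    then show ?thesis using False by (rule symbol_outside)
  qed
  have fcy: "fil ?k (comm ?y (vec x))" for x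
    unfolding comm_diff_left by (intro fil_diff zD fcb)
  have smb: "symbol m ?y \<gamma> u = symbol m z \<gamma> u" for \<gamma> u
    using symbol_above[OF b, of m \<gamma> u] d by (simp add: symbol_diff)
  have py: "pure m ?y"
    using zD(1) fil_mono[OF b, of m] d unfolding pure_def smb by (auto intro: fil_diff)
  have yC: "?y \<in> Car" using zD(3) fil_Car[OF b] by simp
  have "approx_central d m f (avg ?y)"
    by (rule approx_central_avg[OF py inv _ fcy]) (simp add: smb zD(4))
  moreover have "symbol ?k (comm (avg ?y) (vec x)) \<gamma> u = 0" if g: "\<gamma> \<noteq> id" for x \<gamma> u
  proof -
    have "(\<Sum>\<beta>\<in>\<Gamma>. symbol ?k (comm ?y (vec (ginv \<beta> x))) (ginv \<beta> \<circ> \<gamma> \<circ> \<beta>) (ginv \<beta> u)) = 0"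
      using g by (intro sum.neutral ballI y0) (simp only: conj_eq_id_iff simp_thms)
    then show ?thesis unfolding symbol_comm_avg_vec[OF yC fcy] by simp
  qed
  ultimately show ?thesis by blast
qed

lemma all_approx_central_Suc:
  assumes all: "all_approx_central d" and d: "d \<ge> 1"
    and id0: "\<And>m f z x u. approx_central d m f z \<Longrightarrow> symbol (m + 1 - d) (comm z (vec x)) id u = 0"
  shows "all_approx_central (d + 1)"
  unfolding all_approx_central_def
proof (intro allI impI)
  fix m f assume f: "pol m f" "invariant_fun f"
  then obtain z where "approx_central d m f z" using all by (auto simp: all_approx_central_def)
  then obtain z' where z': "approx_central d m f z'"
    and z0: "\<And>x \<gamma> u. \<gamma> \<noteq> id \<Longrightarrow> symbol (m + 1 - d) (comm z' (vec x)) \<gamma> u = 0"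
    using remove_group_components[OF _ d f(2)] by blast
  have "fil (m + 1 - (d + 1)) (comm z' (vec x))" for x
  proof -
    have "fil (m + 1 - d - 1) (comm z' (vec x))"
    proof (rule fil_if_symbol_0[OF approx_centralD(6)[OF z']])
      show "symbol (m + 1 - d) (comm z' (vec x)) \<gamma> u = 0" for \<gamma> u
        using z0 id0[OF z'] by (cases "\<gamma> = id") simp_all
    qed
    then show ?thesis by (simp add: algebra_simps)
  qed
  then have "approx_central (d + 1) m f z'" using z' by (simp add: approx_central_def)
  then show "\<exists>z. approx_central (d + 1) m f z" ..
qed

subsection \<open>The Poisson bracket of negative degree vanishes\<close>

lemma fil_comm_approx:
  assumes z: "approx_central d m f z" and a: "fil k a"
  shows "fil (m + k - d) (comm z a)"
  using a
proof (induction rule: fil.induct)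
  case (fil_ideal p k)
  then show ?case using approx_centralD(3)[OF z] by (intro fil.fil_ideal comm_Rel_right)
next
  case (fil_scalar k a)
  show ?case unfolding comm_scalar by (rule fil_0)
next
  case (fil_grp_mult \<gamma> k p)
  have "comm z (grp \<gamma>) \<in> Rel"
    using approx_centralD(5)[OF z] fil_grp_mult.hyps by (auto simp: gamma_central_def)
  then show ?case unfolding comm_mult_right using fil_grp_mult fil_Car
    by (intro fil.fil_add fil.fil_grp_mult) (auto intro: fil.fil_ideal Rel_right)
next
  case (fil_vec_mult k p x)
  have "fil (m + 1 - d + k) (comm z (vec x) * p)"
    by (intro fil_mult approx_centralD(6)[OF z] fil_vec_mult.hyps)
  moreover have "fil (m + k - d + 1) (vec x * comm z p)"
    by (rule fil.fil_vec_mult) fact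
  moreover have "m + 1 - d + k = m + (k + 1) - d" "m + k - d + 1 = m + (k + 1) - d" by auto
  ultimately show ?case unfolding comm_mult_right by (metis fil.fil_add)
next
  case (fil_add k p q)
  then show ?case unfolding comm_add_right by (intro fil.fil_add)
qed

lemma comm_scalar_right: "comm p (scalar a * q) = scalar a * comm p q"
  by (simp only: right_diff_distrib scalar_left_comm mult.assoc)

lemma pure_mult:
  assumes p: "pure m p" and q: "pure n q"
  shows "pure (m + n) (p * q)"
  unfolding pure_def
proof (intro conjI allI impI fil_mult pure_fil p q)
  fix \<gamma> u assume "\<gamma> \<noteq> (id :: 'v \<Rightarrow> 'v)"
  then have "symbol n q \<gamma> u = 0" using q unfolding pure_def by blast
  then show "symbol (m + n) (p * q) \<gamma> u = 0"
    unfolding symbol_pure_mult[OF p pure_fil[OF q]] by (simp only: mult_zero_right)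
qed

lemma pure_vec_power: "pure (int i) (vec v ^ i)"
proof (induction i)
  case 0
  show ?case by (simp add: pure_def fil_1 symbol_1)
next
  case (Suc i)
  then show ?case using pure_mult[OF pure_vec[of v] Suc] by (simp add: add.commute)
qed

lemma symbol_vec_power: "symbol (int i) (vec v ^ i) id u = \<omega> u v ^ i"
proof (induction i)
  case 0
  show ?case unfolding power_0 of_nat_0 symbol_1 by (simp only: simp_thms if_True)
next
  case (Suc i)
  have "symbol (int i + 1) (vec v * vec v ^ i) id u = \<omega> u v * symbol (int i) (vec v ^ i) id u"
    by (rule symbol_vec_mult[OF pure_fil[OF pure_vec_power]])
  moreover have "int (Suc i) = int i + 1" by simp
  ultimately show ?case by (simp only: Suc power_Suc)
qed

lemma symbol_mult_pure_id: "fil m p \<Longrightarrow> pure n q \<Longrightarrow> symbol (m + n) (p * q) id u = symbol m p id u * symbol n q id u"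
  using symbol_mult_pure[OF _ _ group_id, of m p n q u] unfolding inv_id id_apply .

text \<open>The leading term of \<open>[z, \<cdot>]\<close> at the identity is a derivation; here it is applied to a power of \<open>v\<close>.\<close>

lemma symbol_comm_power:
  assumes z: "approx_central d m f z"
  shows "symbol (m + int i - d) (comm z (vec v ^ i)) id u
    = of_nat i * \<omega> u v ^ (i - 1) * symbol (m + 1 - d) (comm z (vec v)) id u"
proof (induction i)
  case 0
  have "comm z (vec v ^ 0) = 0" by simp
  then show ?case by (simp only: symbol_0) simp
next
  case (Suc i)
  have 1: "symbol (m + 1 - d + int i) (comm z (vec v) * vec v ^ i) id u
      = symbol (m + 1 - d) (comm z (vec v)) id u * \<omega> u v ^ i"
    unfolding symbol_mult_pure_id[OF approx_centralD(6)[OF z] pure_vec_power] symbol_vec_power ..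
  have 2: "symbol (m + int i - d + 1) (vec v * comm z (vec v ^ i)) id u = \<omega> u v * symbol (m + int i - d) (comm z (vec v ^ i)) id u"
    by (rule symbol_vec_mult[OF fil_comm_approx[OF z pure_fil[OF pure_vec_power]]])
  have e: "m + 1 - d + int i = m + int (Suc i) - d" "m + int i - d + 1 = m + int (Suc i) - d" by auto
  have alg: "a * w ^ i + w * (of_nat i * w ^ (i - 1) * a) = of_nat (Suc i) * w ^ i * a" for a w :: complex
    by (cases i) (simp_all add: algebra_simps)
  have "symbol (m + int (Suc i) - d) (comm z (vec v * vec v ^ i)) id u
      = of_nat (Suc i) * \<omega> u v ^ i * symbol (m + 1 - d) (comm z (vec v)) id u"
    unfolding comm_mult_right symbol_add 1[unfolded e] 2[unfolded e] Suc by (rule alg)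
  then show ?case by (simp only: power_Suc diff_Suc_1)
qed

context
  fixes d :: int
  assumes all: "all_approx_central d"
begin

definition coeff_lift :: "'v \<Rightarrow> nat \<Rightarrow> 'v sra_gen nc_poly" where
  "coeff_lift v i = (SOME z. approx_central d (int (card \<Gamma>) - int i) (char_coeff v i) z)"

lemma coeff_lift: "approx_central d (int (card \<Gamma>) - int i) (char_coeff v i) (coeff_lift v i)"
  unfolding coeff_lift_def
proof (rule someI_ex)
  have "invariant_fun (char_coeff v i)" by (simp add: invariant_fun_def char_coeff_group)
  then show "\<exists>z. approx_central d (int (card \<Gamma>) - int i) (char_coeff v i) z"
    using all pol_char_coeff by (simp add: all_approx_central_def)
qed

text \<open>The value at \<open>x\<close> of the Hamiltonian derivation attached to the symbol of \<open>z\<close>, in the order that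
  \<open>d\<close>-approximately central lifts allow.\<close>

abbreviation ham :: "int \<Rightarrow> 'v sra_gen nc_poly \<Rightarrow> 'v \<Rightarrow> 'v \<Rightarrow> complex" where
  "ham m z x u \<equiv> symbol (m + 1 - d) (comm z (vec x)) id u"

text \<open>The derivative of the characteristic polynomial of \<open>v\<close> at its root \<open>v\<close>.\<close>

definition discr :: "'v \<Rightarrow> 'v \<Rightarrow> complex" where
  "discr v u = (\<Prod>\<gamma>\<in>\<Gamma> - {id}. \<omega> u (v - \<gamma> v))"

text \<open>The chain rule for the equation \<open>\<Sum> a\<^sub>i v\<^sup>i = 0\<close> that \<open>v\<close> satisfies over the invariants. It
  determines the derivation on \<open>v\<close>, after multiplication by \<open>discr v\<close>, from its values on invariants.\<close>

lemma chain_rule: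
  assumes z: "approx_central d m f z"
  shows "discr v u * ham m z v u = - (\<Sum>i\<le>card \<Gamma>. \<omega> u v ^ i * symbol (m + (int (card \<Gamma>) - int i) - d) (comm z (coeff_lift v i)) id u)"
proof -
  let ?n = "card \<Gamma>"
  define y where "y = (\<Sum>i\<le>?n. coeff_lift v i * vec v ^ i)"
  have pt: "pure (int ?n) (coeff_lift v i * vec v ^ i)" for i
    using pure_mult[OF approx_centralD(1)[OF coeff_lift[of i v]] pure_vec_power[of i v]] by simp
  have st: "symbol (int ?n) (coeff_lift v i * vec v ^ i) id u = char_coeff v i u * \<omega> u v ^ i" for i u
    using symbol_mult_pure_id[OF approx_centralD(2)[OF coeff_lift[of i v]] pure_vec_power[of i v], of u]
    by (simp add: symbol_vec_power approx_centralD(4)[OF coeff_lift])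
  have "fil (int ?n - 1) y"
  proof (rule fil_if_symbol_0)
    show "fil (int ?n) y" unfolding y_def by (intro fil_sum pure_fil pt)
    fix \<gamma> u
    show "symbol (int ?n) y \<gamma> u = 0"
    proof (cases "\<gamma> = id")
      case True
      then show ?thesis unfolding y_def symbol_sum by (simp add: st char_coeff_root)
    next
      case False
      then show ?thesis unfolding y_def symbol_sum using pt by (intro sum.neutral) (simp add: pure_def)
    qed
  qed
  from fil_comm_approx[OF z this] have "symbol (m + int ?n - d) (comm z y) id u = 0"
    by (rule symbol_above) simp
  moreover have "symbol (m + int ?n - d) (comm z (coeff_lift v i * vec v ^ i)) id u
      = \<omega> u v ^ i * symbol (m + (int ?n - int i) - d) (comm z (coeff_lift v i)) id u
       + char_coeff v i u * (of_nat i * \<omega> u v ^ (i - 1)) * ham m z v u" for i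
  proof -
    have e: "m + (int ?n - int i) - d + int i = m + int ?n - d" "int ?n - int i + (m + int i - d) = m + int ?n - d" by auto
    have 1: "symbol (m + (int ?n - int i) - d + int i) (comm z (coeff_lift v i) * vec v ^ i) id u
        = symbol (m + (int ?n - int i) - d) (comm z (coeff_lift v i)) id u * \<omega> u v ^ i"
      unfolding symbol_mult_pure_id[OF fil_comm_approx[OF z approx_centralD(2)[OF coeff_lift]] pure_vec_power] symbol_vec_power ..
    have 2: "symbol (int ?n - int i + (m + int i - d)) (coeff_lift v i * comm z (vec v ^ i)) id u
        = char_coeff v i u * (of_nat i * \<omega> u v ^ (i - 1) * ham m z v u)"
      unfolding symbol_pure_mult[OF approx_centralD(1)[OF coeff_lift] fil_comm_approx[OF z pure_fil[OF pure_vec_power]]]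
        approx_centralD(4)[OF coeff_lift] symbol_comm_power[OF z] ..
    show ?thesis unfolding comm_mult_right symbol_add 1[unfolded e] 2[unfolded e] by (simp add: algebra_simps)
  qed
  ultimately have "(\<Sum>i\<le>?n. \<omega> u v ^ i * symbol (m + (int ?n - int i) - d) (comm z (coeff_lift v i)) id u)
      + (\<Sum>i\<le>?n. char_coeff v i u * (of_nat i * \<omega> u v ^ (i - 1))) * ham m z v u = 0"
    unfolding y_def comm_sum_right symbol_sum by (simp add: sum.distrib sum_distrib_right)
  then show ?thesis unfolding char_coeff_derivative discr_def by (simp add: eq_neg_iff_add_eq_0 add.commute)
qed

lemma ham_add:
  assumes z: "z \<in> Car"
  shows "ham m z (x + y) u = ham m z x u + ham m z y u" "ham m z (scale a x) u = a * ham m z x u"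
proof -
  have "comm z (vec (x + y) - (vec x + vec y)) \<in> Rel" by (intro comm_Rel_right Rel_vec_add z)
  then have "comm z (vec (x + y)) - (comm z (vec x) + comm z (vec y)) \<in> Rel" by (simp only: comm_diff_right comm_add_right)
  from symbol_ideal[OF this] show "ham m z (x + y) u = ham m z x u + ham m z y u"
    unfolding symbol_diff[of _ "comm z (vec (x + y))"] symbol_add by simp
  have "comm z (vec (scale a x) - scalar a * vec x) \<in> Rel" by (intro comm_Rel_right Rel_vec_scale z)
  then have "comm z (vec (scale a x)) - scalar a * comm z (vec x) \<in> Rel"
    by (simp only: comm_diff_right comm_scalar_right)
  from symbol_ideal[OF this] show "ham m z (scale a x) u = a * ham m z x u"
    unfolding symbol_diff[of _ "comm z (vec (scale a x))"] symbol_scalar_mult by simp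
qed

text \<open>Differentiating \<open>\<Sum> a\<^sub>i v\<^sup>i = 0\<close> suggests \<open>- discr v {v, w}\<close> for this sum. The bracket of two vectors has
  no meaning here, as only invariants have approximately central lifts, but the sum has.\<close>

definition contraction :: "'v \<Rightarrow> 'v \<Rightarrow> 'v \<Rightarrow> complex" where
  "contraction v w u = (\<Sum>i\<le>card \<Gamma>. \<omega> u v ^ i * ham (int (card \<Gamma>) - int i) (coeff_lift v i) w u)"

lemma contraction_linear:
  "contraction v (x + y) u = contraction v x u + contraction v y u"
  "contraction v (scale a x) u = a * contraction v x u"
  unfolding contraction_def ham_add[OF approx_centralD(3)[OF coeff_lift]]
  by (simp_all add: distrib_left sum.distrib sum_distrib_left mult.left_commute)

lemma pol_contraction: "pol (int (card \<Gamma>) + 1 - d) (contraction v w)"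
proof -
  have "pol (int (card \<Gamma>) + 1 - d) (\<lambda>u. \<omega> u v ^ i * ham (int (card \<Gamma>) - int i) (coeff_lift v i) w u)" for i
  proof -
    have "pol (int i * 1 + (int (card \<Gamma>) - int i + 1 - d)) (\<lambda>u. \<omega> u v ^ i * ham (int (card \<Gamma>) - int i) (coeff_lift v i) w u)"
      by (intro pol_mult pol_power pol_form pol_symbol Car_diff Car_mult Car_vec approx_centralD(3)[OF coeff_lift])
    then show ?thesis by (simp add: algebra_simps)
  qed
  then have "pol (int (card \<Gamma>) + 1 - d) (\<lambda>u. \<Sum>i\<le>card \<Gamma>. \<omega> u v ^ i * ham (int (card \<Gamma>) - int i) (coeff_lift v i) w u)"
    by (intro pol_sum)
  then show ?thesis by (rule pol_cong) (simp_all add: contraction_def)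
qed

text \<open>The chain rule for the lift of \<open>a\<^sub>i\<close> and the vector \<open>w\<close> turns both sides into sums over the brackets of the
  coefficients of the two characteristic polynomials, which are antisymmetric.\<close>

lemma contraction_antisymmetric: "discr w u * contraction v w u = - (discr v u * contraction w v u)"
proof -
  let ?n = "card \<Gamma>"
  define br where "br i j = symbol (int ?n - int i + (int ?n - int j) - d) (comm (coeff_lift v i) (coeff_lift w j)) id u" for i j
  define rb where "rb i j = symbol (int ?n - int i + (int ?n - int j) - d) (comm (coeff_lift w i) (coeff_lift v j)) id u" for i j
  have anti: "rb j i = - br i j" for i j
  proof -
    have "comm (coeff_lift w j) (coeff_lift v i) = - comm (coeff_lift v i) (coeff_lift w j)" by simp
    then show ?thesis unfolding rb_def br_def by (simp only: symbol_uminus ac_simps)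
  qed
  have "discr w u * contraction v w u = (\<Sum>i\<le>?n. \<omega> u v ^ i * (discr w u * ham (int ?n - int i) (coeff_lift v i) w u))"
    unfolding contraction_def sum_distrib_left by (simp only: ac_simps)
  also have "\<dots> = (\<Sum>i\<le>?n. \<omega> u v ^ i * - (\<Sum>j\<le>?n. \<omega> u w ^ j * br i j))"
    unfolding chain_rule[OF coeff_lift] br_def ..
  also have "\<dots> = - (\<Sum>i\<le>?n. \<Sum>j\<le>?n. \<omega> u v ^ i * \<omega> u w ^ j * br i j)"
    by (simp add: sum_distrib_left sum_negf mult.assoc)
  finally have 1: "discr w u * contraction v w u = - (\<Sum>i\<le>?n. \<Sum>j\<le>?n. \<omega> u v ^ i * \<omega> u w ^ j * br i j)" .
  have "discr v u * contraction w v u = (\<Sum>j\<le>?n. \<omega> u w ^ j * (discr v u * ham (int ?n - int j) (coeff_lift w j) v u))"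
    unfolding contraction_def sum_distrib_left by (simp only: ac_simps)
  also have "\<dots> = (\<Sum>j\<le>?n. \<omega> u w ^ j * - (\<Sum>i\<le>?n. \<omega> u v ^ i * rb j i))"
    unfolding chain_rule[OF coeff_lift] rb_def ..
  also have "\<dots> = (\<Sum>j\<le>?n. \<Sum>i\<le>?n. \<omega> u v ^ i * \<omega> u w ^ j * br i j)"
    by (simp add: anti sum_distrib_left sum_negf algebra_simps)
  also have "\<dots> = (\<Sum>i\<le>?n. \<Sum>j\<le>?n. \<omega> u v ^ i * \<omega> u w ^ j * br i j)" by (rule sum.swap)
  finally show ?thesis using 1 by simp
qed

text \<open>By antisymmetry and coprimality \<open>discr v\<close>, of degree \<open>|\<Gamma>| - 1\<close>, divides the contraction, which has
  degree \<open>|\<Gamma>| + 1 - d\<close>.\<close>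

lemma contraction_eq_0:
  assumes d: "d \<ge> 3" and v: "generic v"
  shows "contraction v w u = 0"
proof (rule vanish_if_vanish_on_generic_pair[where v = v and F = "\<lambda>w. contraction v w u"])
  fix w assume w: "generic_pair v w"
  let ?I = "\<Gamma> - {id :: 'v \<Rightarrow> 'v}"
  have fin: "finite ?I" using finite_group by simp
  have card: "int (card ?I) = int (card \<Gamma>) - 1"
    using card_Suc_Diff1[OF finite_group group_id] by simp
  have "\<exists>r. pol (int (card \<Gamma>) + 1 - d - int (card ?I)) r \<and> contraction v w = (\<lambda>u. (\<Prod>\<gamma>\<in>?I. \<omega> u (v - \<gamma> v)) * r u)"
  proof (rule forms_divide[OF fin fin])
    show "v - \<gamma> v \<noteq> 0" if "\<gamma> \<in> ?I" for \<gamma>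
    proof -
      have "\<gamma> v \<noteq> v" using v that unfolding generic_def by blast
      then show ?thesis by (metis right_minus_eq)
    qed
    show "w - \<delta> w \<noteq> scale a (v - \<gamma> v)" if "\<gamma> \<in> ?I" "\<delta> \<in> ?I" for \<gamma> \<delta> a
      using w that by (auto simp: generic_pair_def)
    show "pol (int (card \<Gamma>) + 1 - d) (\<lambda>u. - contraction w v u)" by (intro pol_uminus pol_contraction)
    show "(\<Prod>\<gamma>\<in>?I. \<omega> u (v - \<gamma> v)) * - contraction w v u = (\<Prod>\<delta>\<in>?I. \<omega> u (w - \<delta> w)) * contraction v w u" for u
      using contraction_antisymmetric[of w u v] unfolding discr_def by simp
  qed (use pol_contraction in auto)
  then obtain r where r: "pol (int (card \<Gamma>) + 1 - d - int (card ?I)) r"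
    "contraction v w = (\<lambda>u. (\<Prod>\<gamma>\<in>?I. \<omega> u (v - \<gamma> v)) * r u)" by blast
  have "r u = 0" using d by (intro pol_neg[OF r(1)]) (simp add: card)
  then show "contraction v w u = 0" by (simp only: r(2) mult_zero_right)
qed (simp_all add: contraction_linear)

lemma discr_cancel:
  assumes v: "generic v" and f: "pol k f" and z: "\<And>u. discr v u * f u = 0"
  shows "f u = 0"
proof -
  have "f u = 0" if "finite I" "I \<subseteq> \<Gamma> - {id}" "pol k f" "\<And>u. (\<Prod>\<gamma>\<in>I. \<omega> u (v - \<gamma> v)) * f u = 0" for I f k u
    using that
  proof (induction I arbitrary: f k u rule: finite_induct)
    case (insert \<gamma> I)
    have "\<gamma> \<in> \<Gamma> - {id}" using insert.prems(1) by blast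
    then have "\<gamma> v \<noteq> v" using v unfolding generic_def by blast
    then have "v - \<gamma> v \<noteq> 0" by (metis right_minus_eq)
    have "\<omega> u (v - \<gamma> v) * f u = 0" for u
    proof (rule insert.IH)
      show "pol (k + 1) (\<lambda>u. \<omega> u (v - \<gamma> v) * f u)" by (intro pol_mult_form insert.prems)
      show "(\<Prod>\<gamma>\<in>I. \<omega> u (v - \<gamma> v)) * (\<omega> u (v - \<gamma> v) * f u) = 0" for u
        using insert.prems(3)[of u] insert.hyps by (simp add: mult.assoc mult.left_commute)
    qed (use insert.prems in blast)
    then show ?case by (rule form_cancel[OF insert.prems(2) \<open>v - \<gamma> v \<noteq> 0\<close>])
  qed simp
  from this[of "\<Gamma> - {id}" k f u] show ?thesis using f z finite_group by (simp add: discr_def)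
qed

text \<open>The contraction is a derivation, so it kills all polynomials when it kills vectors.\<close>

lemma contraction_sec:
  assumes c: "\<And>w u. contraction v w u = 0" and "pol (int k) g"
  shows "(\<Sum>i\<le>card \<Gamma>. \<omega> u v ^ i * symbol (int (card \<Gamma>) - int i + int k - d) (comm (coeff_lift v i) (sec k g)) id u) = 0"
  using assms(2)
proof (induction k arbitrary: g)
  case 0
  show ?case unfolding sec.simps comm_scalar symbol_0 by simp
next
  case (Suc k)
  let ?n = "card \<Gamma>"
  have dg: "pol (int k) (dd e g)" for e using pol_dd[OF Suc.prems, of e] by simp
  have ps: "pure (int k) (sec k (dd e g))" for e using pure_isec[OF dg, of e] by (simp add: isec_def)
  have s: "symbol (int ?n - int i + int (Suc k) - d) (comm (coeff_lift v i) (vec b * sec k (dd e g))) id u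
    = ham (int ?n - int i) (coeff_lift v i) b u * dd e g u
      + \<omega> u b * symbol (int ?n - int i + int k - d) (comm (coeff_lift v i) (sec k (dd e g))) id u" for i b e
  proof -
    have e: "int ?n - int i + 1 - d + int k = int ?n - int i + int (Suc k) - d"
      "int ?n - int i + int k - d + 1 = int ?n - int i + int (Suc k) - d" by auto
    have 1: "symbol (int ?n - int i + 1 - d + int k) (comm (coeff_lift v i) (vec b) * sec k (dd e g)) id u
        = ham (int ?n - int i) (coeff_lift v i) b u * dd e g u"
      unfolding symbol_mult_pure_id[OF approx_centralD(6)[OF coeff_lift] ps]
      using symbol_isec_id[OF dg, of e u] by (simp add: isec_def)
    have 2: "symbol (int ?n - int i + int k - d + 1) (vec b * comm (coeff_lift v i) (sec k (dd e g))) id u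
      = \<omega> u b * symbol (int ?n - int i + int k - d) (comm (coeff_lift v i) (sec k (dd e g))) id u"
      by (rule symbol_vec_mult[OF fil_comm_approx[OF coeff_lift pure_fil[OF ps]]])
    show ?thesis unfolding comm_mult_right symbol_add 1[unfolded e] 2[unfolded e] ..
  qed
  have "(\<Sum>i\<le>?n. \<omega> u v ^ i * symbol (int ?n - int i + int (Suc k) - d) (comm (coeff_lift v i) (vec b * sec k (dd e g))) id u)
    = contraction v b u * dd e g u
     + \<omega> u b * (\<Sum>i\<le>?n. \<omega> u v ^ i * symbol (int ?n - int i + int k - d) (comm (coeff_lift v i) (sec k (dd e g))) id u)" for b e
    unfolding s contraction_def sum_distrib_left sum_distrib_right sum.distrib[symmetric]
    by (simp only: distrib_left ac_simps)
  then have 0: "(\<Sum>i\<le>?n. \<omega> u v ^ i * symbol (int ?n - int i + int (Suc k) - d) (comm (coeff_lift v i) (vec b * sec k (dd e g))) id u) = 0" for b e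
    by (simp only: c Suc.IH[OF dg] mult_zero_left mult_zero_right add_0_left)
  have cs: "comm p (sec (Suc k) g) = scalar (1 / of_nat (Suc k)) * (\<Sum>q\<in>dual_basis. comm p (vec (fst q) * sec k (dd (snd q) g)))" for p
    by (simp only: sec.simps comm_scalar_right comm_sum_right)
  have "(\<Sum>i\<le>?n. \<omega> u v ^ i * symbol (int ?n - int i + int (Suc k) - d) (comm (coeff_lift v i) (sec (Suc k) g)) id u)
    = 1 / of_nat (Suc k) * (\<Sum>i\<le>?n. \<Sum>p\<in>dual_basis. \<omega> u v ^ i * symbol (int ?n - int i + int (Suc k) - d) (comm (coeff_lift v i) (vec (fst p) * sec k (dd (snd p) g))) id u)"
    unfolding cs symbol_scalar_mult symbol_sum
    by (simp only: sum_distrib_left mult.left_commute)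
  also have "(\<Sum>i\<le>?n. \<Sum>p\<in>dual_basis. \<omega> u v ^ i * symbol (int ?n - int i + int (Suc k) - d) (comm (coeff_lift v i) (vec (fst p) * sec k (dd (snd p) g))) id u)
     = (\<Sum>p\<in>dual_basis. \<Sum>i\<le>?n. \<omega> u v ^ i * symbol (int ?n - int i + int (Suc k) - d) (comm (coeff_lift v i) (vec (fst p) * sec k (dd (snd p) g))) id u)"
    by (rule sum.swap)
  also have "\<dots> = 0" unfolding 0 by simp
  finally show ?case by simp
qed

text \<open>Up to lower order \<open>z\<close> is the symmetrised lift of its symbol, to which \<open>contraction_sec\<close> applies.\<close>

lemma contraction_approx_central:
  assumes c: "\<And>w u. contraction v w u = 0" and z: "approx_central d m f z"
  shows "(\<Sum>i\<le>card \<Gamma>. \<omega> u v ^ i * symbol (int (card \<Gamma>) - int i + m - d) (comm (coeff_lift v i) z) id u) = 0"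
proof -
  let ?g = "symbol m z id"
  have g: "pol m ?g" by (rule pol_symbol[OF approx_centralD(3)[OF z]])
  have r: "fil (m - 1) (z - isec m ?g)" by (rule fil_diff_isec[OF approx_centralD(1)[OF z]])
  have "symbol (int (card \<Gamma>) - int i + m - d) (comm (coeff_lift v i) z) id u
      = symbol (int (card \<Gamma>) - int i + m - d) (comm (coeff_lift v i) (isec m ?g)) id u" for i
  proof -
    have "symbol (int (card \<Gamma>) - int i + m - d) (comm (coeff_lift v i) (z - isec m ?g)) id u = 0"
      by (rule symbol_above[OF fil_comm_approx[OF coeff_lift r]]) simp
    then show ?thesis unfolding comm_diff_right symbol_diff[of _ "comm (coeff_lift v i) z"] by (simp only: right_minus_eq)
  qed
  moreover have "(\<Sum>i\<le>card \<Gamma>. \<omega> u v ^ i * symbol (int (card \<Gamma>) - int i + m - d) (comm (coeff_lift v i) (isec m ?g)) id u) = 0"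
  proof (cases "m < 0")
    case True
    then have i0: "isec m ?g = 0" by (simp add: isec_def)
    show ?thesis unfolding i0 by (simp add: symbol_0)
  next
    case False
    then have m: "int (nat m) = m" and i: "isec m ?g = sec (nat m) ?g" by (simp_all add: isec_def)
    show ?thesis unfolding i using contraction_sec[of v "nat m" ?g u, OF c] g unfolding m by blast
  qed
  ultimately show ?thesis by (simp only:)
qed

text \<open>The chain rule expresses \<open>discr v {z, v}\<close> by the brackets with the coefficients, which are given by the
  contraction of \<open>v\<close>, up to sign.\<close>

lemma ham_eq_0:
  assumes d: "d \<ge> 3" and z: "approx_central d m f z"
  shows "ham m z x u = 0"
proof (rule vanish_if_vanish_on_generic[where F = "\<lambda>x. ham m z x u"])
  fix v assume v: "generic v"
  show "ham m z v u = 0"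
  proof (rule discr_cancel[OF v pol_symbol])
    show "comm z (vec v) \<in> Car" using approx_centralD(3)[OF z] by simp
    fix u
    have "symbol (m + (int (card \<Gamma>) - int i) - d) (comm z (coeff_lift v i)) id u
        = - symbol (int (card \<Gamma>) - int i + m - d) (comm (coeff_lift v i) z) id u" for i
    proof -
      have "comm z (coeff_lift v i) = - comm (coeff_lift v i) z" by simp
      then show ?thesis by (simp only: symbol_uminus ac_simps)
    qed
    then show "discr v u * ham m z v u = 0"
      unfolding chain_rule[OF z] using contraction_approx_central[OF contraction_eq_0[OF d v] z, of u]
      by (simp add: sum_negf)
  qed
qed (simp_all only: ham_add[OF approx_centralD(3)[OF z]])

end

lemma all_approx_central:
  assumes t: "t = 0"
  shows "all_approx_central (int n + 3)"
proof (induction n)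
  case 0
  have "all_approx_central (2 + 1)"
  proof (rule all_approx_central_Suc[OF all_approx_central_2])
    fix m f z x u assume z: "approx_central 2 m f z"
    have "fil (m - 1) (comm z (vec x))" for x using approx_centralD(6)[OF z, of x] by simp
    from symbol_comm_id[OF approx_centralD(2)[OF z] this] show "symbol (m + 1 - 2) (comm z (vec x)) id u = 0"
      by (simp add: t)
  qed simp
  then show ?case by simp
next
  case (Suc n)
  have "all_approx_central (int n + 3 + 1)"
  proof (rule all_approx_central_Suc[OF Suc])
    show "symbol (m + 1 - (int n + 3)) (comm z (vec x)) id u = 0" if "approx_central (int n + 3) m f z" for m f z x u
      by (rule ham_eq_0[OF Suc _ that]) simp
  qed simp
  then show ?case by (simp add: algebra_simps)
qed

text \<open>For \<open>d = m + 3\<close> the commutators with vectors have negative degree.\<close>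

theorem central_lift:
  assumes t: "t = 0" and f: "pol m f" "invariant_fun f"
  shows "\<exists>z. central z \<and> pure m z \<and> (\<forall>u. symbol m z id u = f u)"
proof -
  obtain z where z: "approx_central (int (nat m) + 3) m f z"
    using all_approx_central[OF t, of "nat m"] f by (auto simp: all_approx_central_def)
  have "comm z (vec x) \<in> Rel" for x
    by (rule fil_neg[OF approx_centralD(6)[OF z]]) simp
  then have "central z" by (rule centralI[OF approx_centralD(5)[OF z]])
  then show ?thesis using approx_centralD(1,4)[OF z] by blast
qed

end

section \<open>The spherical subalgebra\<close>

context symplectic_reflection_data
begin

definition idem :: "'v sra_gen nc_poly" where
  "idem = scalar (1 / of_nat (card \<Gamma>)) * (\<Sum>\<gamma>\<in>\<Gamma>. grp \<gamma>)"

lemma fil_idem: "fil 0 idem"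
  unfolding idem_def by (intro fil_scalar_mult fil_sum fil_grp)

lemma idem_Car [simp]: "idem \<in> Car"
  by (rule fil_Car[OF fil_idem])

lemma symbol_idem:
  assumes "\<gamma> \<in> \<Gamma>"
  shows "symbol 0 idem \<gamma> u = 1 / of_nat (card \<Gamma>)"
proof -
  have "(\<Sum>\<delta>\<in>\<Gamma>. symbol 0 (grp \<delta>) \<gamma> u) = (\<Sum>\<delta>\<in>\<Gamma>. if \<delta> = \<gamma> then 1 else 0)"
    by (intro sum.cong refl) (simp only: symbol_grp simp_thms)
  also have "\<dots> = 1" using assms by (simp add: finite_group)
  finally show ?thesis unfolding idem_def symbol_scalar_mult symbol_sum by simp
qed

lemma grp_idem: "grp \<delta> * idem - idem \<in> Rel"
  and idem_grp: "idem * grp \<delta> - idem \<in> Rel"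
  if d: "\<delta> \<in> \<Gamma>"
proof -
  let ?s = "\<Sum>\<gamma>\<in>\<Gamma>. grp \<gamma>" and ?k = "scalar (1 / of_nat (card \<Gamma>))"
  have "(\<Sum>\<gamma>\<in>\<Gamma>. - (grp (\<delta> \<circ> \<gamma>) - grp \<delta> * grp \<gamma>)) = grp \<delta> * ?s - ?s"
    by (simp add: sum.reindex_bij_betw[OF bij_betw_comp_left[OF d], of grp] sum_distrib_left sum_subtractf sum_negf)
  moreover have "(\<Sum>\<gamma>\<in>\<Gamma>. - (grp (\<gamma> \<circ> \<delta>) - grp \<gamma> * grp \<delta>)) = ?s * grp \<delta> - ?s"
    by (simp add: sum.reindex_bij_betw[OF bij_betw_comp_right[OF d], of grp] sum_distrib_right sum_subtractf sum_negf)
  moreover have "?k * (\<Sum>\<gamma>\<in>\<Gamma>. - (grp (\<delta> \<circ> \<gamma>) - grp \<delta> * grp \<gamma>)) \<in> Rel"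
    "?k * (\<Sum>\<gamma>\<in>\<Gamma>. - (grp (\<gamma> \<circ> \<delta>) - grp \<gamma> * grp \<delta>)) \<in> Rel"
    by - (rule Rel_left[OF Rel_sum[OF Rel_uminus[OF Rel_grp_comp]] Car_scalar]; (rule d | assumption))+
  ultimately show "grp \<delta> * idem - idem \<in> Rel" "idem * grp \<delta> - idem \<in> Rel"
    unfolding idem_def by (simp_all only: right_diff_distrib generator_scalar_comm mult.assoc)
qed

lemma idem_idem: "idem * idem - idem \<in> Rel"
proof -
  have "scalar (1 / of_nat (card \<Gamma>)) * (\<Sum>\<gamma>\<in>\<Gamma>. grp \<gamma> * idem - idem) \<in> Rel"
    by (intro Rel_left Rel_sum grp_idem Car_scalar)
  moreover have "scalar (1 / of_nat (card \<Gamma>)) * (\<Sum>\<gamma>\<in>\<Gamma>. idem) = idem"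
    by (simp only: sum_constant of_nat_scalar scalar_mult_cancel[OF card_group_nonzero(1)])
  moreover have "scalar (1 / of_nat (card \<Gamma>)) * (\<Sum>\<gamma>\<in>\<Gamma>. grp \<gamma> * idem) = idem * idem"
    by (subst (2) idem_def) (simp only: sum_distrib_right mult.assoc)
  ultimately show ?thesis by (simp only: sum_subtractf right_diff_distrib)
qed

lemma central_Car: "central z \<Longrightarrow> z \<in> Car"
  and central_comm: "central z \<Longrightarrow> q \<in> Car \<Longrightarrow> comm z q \<in> Rel"
  by (auto simp: central_def)

lemma central_pure: "central z \<Longrightarrow> fil m z \<Longrightarrow> pure m z"
  by (rule pure_if_comm) (auto intro!: fil_ideal central_comm)

lemma central_add: "central z \<Longrightarrow> central w \<Longrightarrow> central (z + w)"
  unfolding central_def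
proof (intro conjI ballI)
  fix q assume z: "z \<in> Car \<and> (\<forall>q\<in>Car. comm z q \<in> Rel)" and w: "w \<in> Car \<and> (\<forall>q\<in>Car. comm w q \<in> Rel)" and q: "q \<in> Car"
  have "comm (z + w) q = comm z q + comm w q" by (simp add: algebra_simps)
  then show "comm (z + w) q \<in> Rel" using z w q by (simp only: Rel_add)
qed auto

lemma central_mult: "central z \<Longrightarrow> central w \<Longrightarrow> central (z * w)"
  unfolding central_def
proof (intro conjI ballI)
  fix q assume z: "z \<in> Car \<and> (\<forall>q\<in>Car. comm z q \<in> Rel)" and w: "w \<in> Car \<and> (\<forall>q\<in>Car. comm w q \<in> Rel)" and q: "q \<in> Car"
  show "comm (z * w) q \<in> Rel"
    unfolding comm_mult_left by (rule Rel_add) (use z w q in \<open>auto intro: Rel_left Rel_right\<close>)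
qed auto

lemma central_scalar_elem: "central (scalar k)"
  unfolding central_def using scalar_comm by (metis Car_scalar Rel_0 right_minus_eq)

lemma central_0: "central 0"
  using central_scalar_elem[of 0] unfolding scalar_simps .

lemma Rel_if_fil_descends:
  assumes p: "p \<in> Car" and d: "\<And>n. fil (int n) p \<Longrightarrow> fil (int n - 1) p"
  shows "p \<in> Rel"
proof -
  have "p \<in> Rel" if "fil (int n) p" for n
    using that
  proof (induction n)
    case 0
    then show ?case using fil_neg[OF d[of 0]] by simp
  next
    case (Suc n)
    then show ?case using d[of "Suc n"] by simp
  qed
  moreover obtain m where "m \<ge> 0" "fil m p" using fil_exhaust[OF p] by blast
  ultimately show ?thesis by (metis nonneg_int_cases)
qed

text \<open>A central element is pure, so its symbol at the identity is \<open>|\<Gamma>|\<close> times that of its product with \<open>e\<close>.\<close>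

lemma central_idem_injective:
  assumes z: "central z" and e: "z * idem \<in> Rel"
  shows "z \<in> Rel"
proof (rule Rel_if_fil_descends[OF central_Car[OF z]])
  fix n assume f: "fil (int n) z"
  have pz: "pure (int n) z" by (rule central_pure[OF z f])
  show "fil (int n - 1) z"
  proof (rule fil_if_symbol_0[OF f])
    fix \<gamma> u
    have "symbol (int n + 0) (z * idem) id u = symbol (int n) z id u * (1 / of_nat (card \<Gamma>))"
      unfolding symbol_pure_mult[OF pz fil_idem] symbol_idem[OF group_id] ..
    then have "symbol (int n) z id u = 0"
      using symbol_ideal[OF e] card_group_nonzero(1) by simp
    then show "symbol (int n) z \<gamma> u = 0" using pz unfolding pure_def by (cases "\<gamma> = id") blast+
  qed
qed

text \<open>In \<open>e A e\<close> one has \<open>\<gamma> b = b = b \<gamma>\<close>. Hence the symbol of \<open>b\<close> is the same at all group elements, and it is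
  invariant. It is the symbol of \<open>z e\<close> for a central lift \<open>z\<close> of \<open>|\<Gamma>|\<close> times this invariant, and the
  difference has lower degree.\<close>

lemma spherical_lift:
  assumes t: "t = 0" and "b \<in> Car" "idem * b * idem - b \<in> Rel"
  shows "\<exists>z. central z \<and> z * idem - b \<in> Rel"
proof -
  have main: "\<exists>z. central z \<and> z * idem - b \<in> Rel" if "fil (int n - 1) b" "idem * b * idem - b \<in> Rel" for n b
    using that
  proof (induction n arbitrary: b)
    case 0
    then have "b \<in> Rel" by (auto intro: fil_neg)
    then have "0 * idem - b \<in> Rel" by (simp add: Rel_uminus)
    then show ?case using central_0 by blast
  next
    case (Suc n)
    have f: "fil (int n) b" using Suc.prems by simp
    have C: "b \<in> Car" by (rule fil_Car[OF f])
    define r where "r = idem * b * idem - b"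
    have r: "r \<in> Rel" using Suc.prems by (simp add: r_def)
    have left: "grp \<gamma> * b - b \<in> Rel" if g: "\<gamma> \<in> \<Gamma>" for \<gamma>
    proof -
      have "(grp \<gamma> * idem - idem) * (b * idem) - grp \<gamma> * r + r \<in> Rel"
        using r g C by (intro Rel_add Rel_diff Rel_right Rel_left grp_idem) auto
      then show ?thesis by (simp add: r_def algebra_simps)
    qed
    have right: "b * grp \<gamma> - b \<in> Rel" if g: "\<gamma> \<in> \<Gamma>" for \<gamma>
    proof -
      have "(idem * b) * (idem * grp \<gamma> - idem) - r * grp \<gamma> + r \<in> Rel"
        using r g C by (intro Rel_add Rel_diff Rel_right Rel_left idem_grp) auto
      then show ?thesis by (simp add: r_def algebra_simps)
    qed
    let ?f = "symbol (int n) b id"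
    have s: "symbol (int n) b \<gamma> u = ?f u" if g: "\<gamma> \<in> \<Gamma>" for \<gamma> u
      using symbol_ideal[OF right[OF g], of "int n" \<gamma> u] symbol_mult_grp[OF f g, of \<gamma> u] g
      unfolding symbol_diff ginv_comp(2)[OF g] by simp
    have inv: "invariant_fun ?f" unfolding invariant_fun_def
    proof (intro ballI allI)
      fix \<gamma> u assume g: "\<gamma> \<in> \<Gamma>"
      show "?f (ginv \<gamma> u) = ?f u"
        using symbol_ideal[OF left[OF g], of "int n" \<gamma> u]
        unfolding symbol_diff symbol_grp_mult ginv_comp(1)[OF g] s[OF g] by simp
    qed
    have "pol (int n) (\<lambda>u. of_nat (card \<Gamma>) * ?f u)" by (intro pol_scale pol_symbol C)
    moreover have "invariant_fun (\<lambda>u. of_nat (card \<Gamma>) * ?f u)" using inv by (simp add: invariant_fun_def)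
    ultimately obtain z where z: "central z" "pure (int n) z" "\<And>u. symbol (int n) z id u = of_nat (card \<Gamma>) * ?f u"
      using central_lift[OF t] by blast
    have zC: "z \<in> Car" by (rule central_Car[OF z(1)])
    let ?b = "b - z * idem"
    have "fil (int n + 0) (z * idem)" by (intro fil_mult pure_fil z fil_idem)
    then have fb: "fil (int n) ?b" using f by (intro fil_diff) simp_all
    have "fil (int n - 1) ?b"
    proof (rule fil_if_symbol_0[OF fb])
      fix \<gamma> u assume g: "\<gamma> \<in> \<Gamma>"
      have "symbol (int n + 0) (z * idem) \<gamma> u = of_nat (card \<Gamma>) * ?f u * (1 / of_nat (card \<Gamma>))"
        unfolding symbol_pure_mult[OF z(2) fil_idem] z(3) symbol_idem[OF g] ..
      then have "symbol (int n) (z * idem) \<gamma> u = ?f u" using card_group_nonzero(1) by simp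
      then show "symbol (int n) ?b \<gamma> u = 0" unfolding symbol_diff s[OF g] by simp
    qed
    moreover have "idem * ?b * idem - ?b \<in> Rel"
    proof -
      have "r + comm z idem * (idem * idem) - z * idem * (idem * idem - idem) - z * (idem * idem - idem) \<in> Rel"
        using r zC by (intro Rel_add Rel_diff Rel_right Rel_left idem_idem central_comm z) auto
      then show ?thesis by (simp add: r_def algebra_simps)
    qed
    ultimately obtain w where w: "central w" "w * idem - ?b \<in> Rel" using Suc.IH by blast
    have "(z + w) * idem - b = w * idem - ?b" by (simp add: algebra_simps)
    then show ?case using w z central_add by metis
  qed
  obtain m where m: "m \<ge> 0" "fil m b" using fil_exhaust assms(2) by blast
  then have "fil (int (Suc (nat m)) - 1) b" by simp
  from main[OF this assms(3)] show ?thesis .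
qed

section \<open>Finite generation over the centre\<close>

definition mono :: "('v \<times> 'v \<Rightarrow> nat) \<Rightarrow> 'v \<Rightarrow> complex" where
  "mono \<alpha> u = (\<Prod>p\<in>dual_basis. \<omega> u (fst p) ^ \<alpha> p)"

definition mdeg :: "('v \<times> 'v \<Rightarrow> nat) \<Rightarrow> int" where
  "mdeg \<alpha> = (\<Sum>p\<in>dual_basis. int (\<alpha> p))"

lemma mono_split: "p \<in> dual_basis \<Longrightarrow> mono (\<alpha>(p := k)) u = \<omega> u (fst p) ^ k * (\<Prod>q\<in>dual_basis - {p}. \<omega> u (fst q) ^ \<alpha> q)"
  unfolding mono_def by (subst prod.remove[of _ p]) (auto intro!: prod.cong)

lemma mdeg_split: "p \<in> dual_basis \<Longrightarrow> mdeg (\<alpha>(p := k)) = int k + (\<Sum>q\<in>dual_basis - {p}. int (\<alpha> q))"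
  unfolding mdeg_def by (subst sum.remove[of _ p]) (auto intro!: sum.cong)

lemma pol_mono: "pol (mdeg \<alpha>) (mono \<alpha>)"
proof -
  have "pol (\<Sum>p\<in>J. int (\<alpha> p)) (\<lambda>u. \<Prod>p\<in>J. \<omega> u (fst p) ^ \<alpha> p)" if "finite J" for J
    using that
  proof (induction J rule: finite_induct)
    case (insert p J)
    have "pol (int (\<alpha> p) * 1 + (\<Sum>p\<in>J. int (\<alpha> p))) (\<lambda>u. \<omega> u (fst p) ^ \<alpha> p * (\<Prod>p\<in>J. \<omega> u (fst p) ^ \<alpha> p))"
      by (intro pol_mult pol_power pol_form insert)
    then show ?case using insert.hyps by simp
  qed simp
  from this[OF finite_dual_basis] show ?thesis by (rule pol_cong) (simp_all add: mdeg_def mono_def)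
qed

text \<open>An induction principle for homogeneous polynomials as combinations of monomials.\<close>

inductive mono_span :: "int \<Rightarrow> ('v \<Rightarrow> complex) \<Rightarrow> bool" where
  zero: "mono_span k (\<lambda>u. 0)"
| mono: "mono_span (mdeg \<alpha>) (mono \<alpha>)"
| add: "mono_span k f \<Longrightarrow> mono_span k g \<Longrightarrow> mono_span k (\<lambda>u. f u + g u)"
| scale: "mono_span k f \<Longrightarrow> mono_span k (\<lambda>u. a * f u)"

lemma pol_mono_span: "mono_span k f \<Longrightarrow> pol k f"
  by (induction rule: mono_span.induct) (auto intro: pol_mono pol_add pol_scale)

lemma mono_span_sum: "(\<And>i. i \<in> I \<Longrightarrow> mono_span k (f i)) \<Longrightarrow> mono_span k (\<lambda>u. \<Sum>i\<in>I. f i u)"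
  by (induction I rule: infinite_finite_induct) (auto intro: mono_span.zero mono_span.add)

lemma mono_span_mult_form: "mono_span k f \<Longrightarrow> mono_span (k + 1) (\<lambda>u. \<omega> u v * f u)"
proof (induction rule: mono_span.induct)
  case (mono \<alpha>)
  have v: "\<omega> u v = (\<Sum>p\<in>dual_basis. \<omega> (snd p) v * \<omega> u (fst p))" for u
    using arg_cong[OF dual_basis_left[of v, symmetric], of "\<omega> u"] by (simp add: omega_sum_right case_prod_unfold)
  have "mono_span (mdeg \<alpha> + 1) (\<lambda>u. \<Sum>p\<in>dual_basis. \<omega> (snd p) v * (\<omega> u (fst p) * mono \<alpha> u))"
  proof (intro mono_span_sum mono_span.scale)
    fix p assume p: "p \<in> dual_basis"
    have "mono (\<alpha>(p := Suc (\<alpha> p))) = (\<lambda>u. \<omega> u (fst p) * mono \<alpha> u)"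
      using mono_split[OF p, of \<alpha> "\<alpha> p"] by (auto simp: mono_split[OF p])
    moreover have "mdeg (\<alpha>(p := Suc (\<alpha> p))) = mdeg \<alpha> + 1"
      using mdeg_split[OF p, of \<alpha> "\<alpha> p"] by (simp add: mdeg_split[OF p])
    ultimately show "mono_span (mdeg \<alpha> + 1) (\<lambda>u. \<omega> u (fst p) * mono \<alpha> u)" using mono_span.mono by metis
  qed
  moreover have "\<omega> u v * mono \<alpha> u = (\<Sum>p\<in>dual_basis. \<omega> (snd p) v * (\<omega> u (fst p) * mono \<alpha> u))" for u
    by (subst v[of u]) (simp only: sum_distrib_right mult.assoc)
  ultimately show ?case by simp
next
  case (add k f g)
  then show ?case unfolding distrib_left by (intro mono_span.add)
next
  case (scale k f a)
  then show ?case unfolding mult.left_commute[of _ a] by (intro mono_span.scale)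
qed (simp add: mono_span.zero)

lemma mono_span_if_pol: "pol k f \<Longrightarrow> mono_span k f"
proof (induction rule: pol.induct)
  case (pol_const a)
  show ?case using mono_span.scale[OF mono_span.mono, of "\<lambda>_. 0" a] by (simp add: mdeg_def mono_def)
qed (rule mono_span.zero mono_span_mult_form mono_span.add; assumption)+

definition gen :: "('v \<times> 'v \<Rightarrow> nat) \<Rightarrow> ('v \<Rightarrow> 'v) \<Rightarrow> 'v sra_gen nc_poly" where
  "gen \<alpha> \<gamma> = isec (mdeg \<alpha>) (mono \<alpha>) * grp \<gamma>"

text \<open>Generators of the algebra as a module over the centre: the \<open>v\<close>-degree of a monomial can be kept below the
  degree of the equation that \<open>v\<close> satisfies over the invariants.\<close>

definition gens :: "'v sra_gen nc_poly set" where
  "gens = (\<lambda>(\<alpha>, \<gamma>). gen \<alpha> \<gamma>) ` (PiE dual_basis (\<lambda>_. {..<card \<Gamma>}) \<times> \<Gamma>)"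

lemma finite_gens: "finite gens"
  unfolding gens_def using finite_group by (intro finite_imageI finite_cartesian_product finite_PiE) auto

lemma gens_Car: "g \<in> gens \<Longrightarrow> g \<in> Car"
  unfolding gens_def gen_def by (auto simp: isec_def)

text \<open>The submodule that the generators span over the centre, pulled back to the free algebra.\<close>

inductive spanned :: "'v sra_gen nc_poly \<Rightarrow> bool" where
  spanned_Rel: "p \<in> Rel \<Longrightarrow> spanned p"
| spanned_gen: "central z \<Longrightarrow> g \<in> gens \<Longrightarrow> spanned (z * g)"
| spanned_add: "spanned p \<Longrightarrow> spanned q \<Longrightarrow> spanned (p + q)"

lemma spanned_Car: "spanned p \<Longrightarrow> p \<in> Car"
  by (induction rule: spanned.induct) (auto simp: central_Car gens_Car)

lemma spanned_central_mult: "spanned p \<Longrightarrow> central z \<Longrightarrow> spanned (z * p)"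
proof (induction rule: spanned.induct)
  case (spanned_Rel p)
  then show ?case by (intro spanned.spanned_Rel Rel_left central_Car)
next
  case (spanned_gen w g)
  then show ?case unfolding mult.assoc[symmetric] by (intro spanned.spanned_gen central_mult)
next
  case (spanned_add p q)
  then show ?case unfolding distrib_left by (intro spanned.spanned_add)
qed

lemma spanned_sum: "(\<And>i. i \<in> I \<Longrightarrow> spanned (f i)) \<Longrightarrow> spanned (\<Sum>i\<in>I. f i)"
  by (induction I rule: infinite_finite_induct) (auto intro: spanned.intros)

lemma spanned_uminus: "spanned p \<Longrightarrow> spanned (- p)"
  using spanned_central_mult[OF _ central_scalar_elem, of p "-1"] by (simp add: scalar_simps)

lemma spanned_diff: "spanned p \<Longrightarrow> spanned q \<Longrightarrow> spanned (p - q)"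
  using spanned_add[of p "- q"] spanned_uminus[of q] by simp

lemma isec_scale: "pol k f \<Longrightarrow> isec k (\<lambda>u. a * f u) = scalar a * isec k f"
  by (simp add: isec_def sec_scale)

lemma mono_restrict: "mono (restrict \<alpha> dual_basis) = mono \<alpha>" "mdeg (restrict \<alpha> dual_basis) = mdeg \<alpha>"
  by (auto simp: mono_def mdeg_def fun_eq_iff intro!: prod.cong sum.cong)

lemma fil_gen: "\<gamma> \<in> \<Gamma> \<Longrightarrow> fil (mdeg \<alpha>) (gen \<alpha> \<gamma>)"
  unfolding gen_def by (intro fil_grp_mult_right fil_isec)

text \<open>If some exponent of the monomial reaches \<open>|\<Gamma>|\<close>, then \<open>v\<^sup>n = - \<Sum> a\<^sub>i v\<^sup>i\<close>, where \<open>n = |\<Gamma>|\<close> and \<open>i < n\<close>, rewrites it. Up to lower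
  filtration degree this holds in the algebra with central lifts of the \<open>a\<^sub>i\<close>, and the
  monomials that remain have lower degree, too.\<close>

lemma spanned_gen_elem:
  assumes t: "t = 0" and g: "\<gamma> \<in> \<Gamma>"
    and IH: "\<And>q. fil (mdeg \<alpha> - 1) q \<Longrightarrow> spanned q"
  shows "spanned (gen \<alpha> \<gamma>)"
proof (cases "\<forall>p\<in>dual_basis. \<alpha> p < card \<Gamma>")
  case True
  then have "gen (restrict \<alpha> dual_basis) \<gamma> \<in> gens"
    unfolding gens_def using g by (intro image_eqI[of _ _ "(restrict \<alpha> dual_basis, \<gamma>)"]) (auto simp: PiE_iff)
  then have "gen \<alpha> \<gamma> \<in> gens" unfolding gen_def mono_restrict .
  from spanned_gen[OF central_scalar_elem[of 1] this] show ?thesis unfolding scalar_simps by simp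
next
  case False
  then obtain p where p: "p \<in> dual_basis" "card \<Gamma> \<le> \<alpha> p" by (auto simp: not_less)
  let ?n = "card \<Gamma>" and ?k = "mdeg \<alpha>" and ?v = "fst p"
  define \<beta> where "\<beta> i = \<alpha>(p := \<alpha> p - ?n + i)" for i
  have inv: "invariant_fun (char_coeff ?v i)" for i by (simp add: invariant_fun_def char_coeff_group)
  have "\<exists>z. \<forall>i. central (z i) \<and> pure (int ?n - int i) (z i) \<and> (\<forall>u. symbol (int ?n - int i) (z i) id u = char_coeff ?v i u)"
    using central_lift[OF t pol_char_coeff[of _ ?v] inv] by (intro choice allI)
  then obtain z where z: "\<And>i. central (z i)" "\<And>i. pure (int ?n - int i) (z i)"
    "\<And>i u. symbol (int ?n - int i) (z i) id u = char_coeff ?v i u" by blast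
  have deg: "mdeg (\<beta> i) = ?k - (int ?n - int i)" for i
    using mdeg_split[OF p(1), of \<alpha> "\<alpha> p - ?n + i"] mdeg_split[OF p(1), of \<alpha> "\<alpha> p"] p(2) by (simp add: \<beta>_def)
  define r where "r u = (\<Prod>q\<in>dual_basis - {p}. \<omega> u (fst q) ^ \<alpha> q)" for u
  have mon: "mono (\<beta> i) u = \<omega> u ?v ^ (\<alpha> p - ?n) * \<omega> u ?v ^ i * r u" for i u
    unfolding \<beta>_def mono_split[OF p(1)] r_def power_add ..
  have b: "mono (\<beta> ?n) = mono \<alpha>" "mdeg (\<beta> ?n) = ?k" using p by (simp_all add: \<beta>_def)
  have rel: "(\<Sum>i\<le>?n. char_coeff ?v i u * mono (\<beta> i) u) = 0" for u
  proof -
    have "(\<Sum>i\<le>?n. char_coeff ?v i u * mono (\<beta> i) u) = (\<Sum>i\<le>?n. char_coeff ?v i u * \<omega> u ?v ^ i) * (\<omega> u ?v ^ (\<alpha> p - ?n) * r u)"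
      unfolding mon sum_distrib_right by (simp only: ac_simps)
    then show ?thesis unfolding char_coeff_root by simp
  qed
  then have rel': "mono \<alpha> u + (\<Sum>i<?n. char_coeff ?v i u * mono (\<beta> i) u) = 0" for u
    using rel[of u] unfolding lessThan_Suc_atMost[symmetric] sum.lessThan_Suc by (simp add: char_coeff_top b(1) add.commute)
  have pb: "pure (mdeg (\<beta> i)) (isec (mdeg (\<beta> i)) (mono (\<beta> i)))" for i by (rule pure_isec[OF pol_mono])
  define q where "q = isec ?k (mono \<alpha>) + (\<Sum>i<?n. z i * isec (mdeg (\<beta> i)) (mono (\<beta> i)))"
  have pz: "pure ?k (z i * isec (mdeg (\<beta> i)) (mono (\<beta> i)))" for i
    using pure_mult[OF z(2)[of i] pb[of i]] unfolding deg by simp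
  have fq: "fil ?k q" unfolding q_def by (intro fil_add fil_isec fil_sum pure_fil pz)
  have sz: "symbol ?k (z i * isec (mdeg (\<beta> i)) (mono (\<beta> i))) \<delta> u = (if \<delta> = id then char_coeff ?v i u * mono (\<beta> i) u else 0)" for i \<delta> u
  proof -
    have e: "int ?n - int i + mdeg (\<beta> i) = ?k" unfolding deg by simp
    show ?thesis
      using symbol_pure_mult[OF z(2)[of i] pure_fil[OF pb[of i]], of \<delta> u]
      unfolding e z(3) symbol_isec[OF pol_mono] by (simp only: mult_zero_right if_distrib)
  qed
  have "fil (?k - 1) q"
  proof (rule fil_if_symbol_0[OF fq])
    fix \<delta> u
    have "symbol ?k q \<delta> u = (if \<delta> = id then mono \<alpha> u + (\<Sum>i<?n. char_coeff ?v i u * mono (\<beta> i) u) else 0)"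
      unfolding q_def symbol_add symbol_sum sz symbol_isec[OF pol_mono] by (cases "\<delta> = id") (simp_all only: if_True if_False sum.neutral_const add_0_left simp_thms)
    then show "symbol ?k q \<delta> u = 0" unfolding rel' by simp
  qed
  then have "spanned (q * grp \<gamma>)" using g by (intro IH fil_grp_mult_right)
  moreover have "spanned (\<Sum>i<?n. z i * gen (\<beta> i) \<gamma>)"
  proof (intro spanned_sum spanned_central_mult z IH)
    fix i assume "i \<in> {..<?n}"
    then show "fil (?k - 1) (gen (\<beta> i) \<gamma>)" using deg[of i] by (intro fil_mono[OF fil_gen[OF g]]) simp
  qed
  ultimately have "spanned (q * grp \<gamma> - (\<Sum>i<?n. z i * gen (\<beta> i) \<gamma>))" by (rule spanned_diff)
  moreover have "q * grp \<gamma> - (\<Sum>i<?n. z i * gen (\<beta> i) \<gamma>) = gen \<alpha> \<gamma>"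
    by (simp add: q_def gen_def distrib_right sum_distrib_right mult.assoc)
  ultimately show ?thesis by simp
qed

text \<open>Up to lower filtration degree an element is the lift of its symbol, hence a combination of monomials
  times group elements.\<close>

lemma spanned_all:
  assumes t: "t = 0" and p: "p \<in> Car"
  shows "spanned p"
proof -
  have main: "spanned p" if "fil (int n - 1) p" for n p
    using that
  proof (induction n arbitrary: p)
    case 0
    then show ?case by (intro spanned_Rel) (auto intro: fil_neg)
  next
    case (Suc n)
    have f: "fil (int n) p" using Suc.prems by simp
    have "spanned (isec (int n) h * grp \<gamma>)" if h: "pol (int n) h" and g: "\<gamma> \<in> \<Gamma>" for h \<gamma>
      using mono_span_if_pol[OF h] Suc.IH
    proof (induction "int n" h rule: mono_span.induct)
      case zero
      show ?case by (intro spanned_Rel) (simp add: isec_zero)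
    next
      case (mono \<alpha>)
      then have "spanned (gen \<alpha> \<gamma>)" by (intro spanned_gen_elem[OF t g]) simp
      then show ?case using mono by (simp add: gen_def)
    next
      case (add h h')
      then show ?case by (simp add: isec_add pol_mono_span distrib_right spanned_add)
    next
      case (scale h a)
      have "spanned (scalar a * (isec (int n) h * grp \<gamma>))" 
        by (rule spanned_central_mult[OF _ central_scalar_elem]) (rule scale.hyps(2)[OF scale.prems])
      then show ?case unfolding isec_scale[OF pol_mono_span[OF scale.hyps(1)]] mult.assoc .
    qed
    then have "spanned (lift (int n) (symbol (int n) p))"
      unfolding lift_def using fil_Car[OF f] by (intro spanned_sum) (auto intro: pol_symbol)
    moreover have "spanned (p - lift (int n) (symbol (int n) p))"
      by (rule Suc.IH[OF fil_lift_symbol[OF f]])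
    ultimately have "spanned (p - lift (int n) (symbol (int n) p) + lift (int n) (symbol (int n) p))"
      by (intro spanned_add)
    then show ?case by simp
  qed
  obtain m where m: "m \<ge> 0" "fil m p" using fil_exhaust[OF p] by blast
  then have "fil (int (Suc (nat m)) - 1) p" by simp
  then show ?thesis by (rule main)
qed

end

section \<open>Passage to the quotient algebra\<close>

context symplectic_reflection_data
begin

abbreviation alg :: "(complex, 'v sra_gen nc_poly set) module" where
  "alg \<equiv> sra scale \<omega> \<Gamma> t c"

abbreviation cls :: "'v sra_gen nc_poly \<Rightarrow> 'v sra_gen nc_poly set" where
  "cls \<equiv> sra_class scale \<omega> \<Gamma> t c"

lemma ring_alg: "ring alg"
  by (rule sra_ring[OF vector_space_axioms subgroup])

lemma cls_eq_iff: "p \<in> Car \<Longrightarrow> q \<in> Car \<Longrightarrow> cls p = cls q \<longleftrightarrow> p - q \<in> Rel"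
proof -
  assume p: "p \<in> Car" and q: "q \<in> Car"
  interpret F: ring "sra_free \<Gamma>" by (rule ring_free)
  have "\<ominus>\<^bsub>sra_free \<Gamma>\<^esub> q = - q"
    by (rule F.minus_equality) (use q in \<open>simp_all add: free_ops\<close>)
  then have "p \<ominus>\<^bsub>sra_free \<Gamma>\<^esub> q = p - q"
    unfolding a_minus_def by (simp add: free_ops)
  then show ?thesis using F.quotient_eq_iff_same_a_r_cos[OF ideal_Rel p q] by (simp add: sra_class_def)
qed

lemma alg_carrier: "carrier alg = cls ` Car"
  by (auto simp: sra_def sra_class_def Let_def FactRing_def A_RCOSETS_def')

lemma cls_carrier [simp]: "p \<in> Car \<Longrightarrow> cls p \<in> carrier alg"
  by (simp add: alg_carrier)

lemma cls_mult: "p \<in> Car \<Longrightarrow> q \<in> Car \<Longrightarrow> cls p \<otimes>\<^bsub>alg\<^esub> cls q = cls (p * q)"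
  using ideal.rcoset_mult_add[OF ideal_Rel] by (simp add: sra_def sra_class_def Let_def FactRing_def free_ops)

lemma cls_add: "p \<in> Car \<Longrightarrow> q \<in> Car \<Longrightarrow> cls p \<oplus>\<^bsub>alg\<^esub> cls q = cls (p + q)"
  using abelian_subgroup.a_rcos_sum[OF abelian_subgroupI3[OF ideal.axioms(1)[OF ideal_Rel] ring.is_abelian_group[OF ring_free]]]
  by (simp add: sra_def sra_class_def Let_def FactRing_def free_ops)

lemma cls_one: "\<one>\<^bsub>alg\<^esub> = cls 1"
  by (simp add: sra_def sra_class_def Let_def FactRing_def free_ops)

lemma cls_zero: "\<zero>\<^bsub>alg\<^esub> = cls 0"
proof -
  interpret A: ring alg by (rule ring_alg)
  have "cls 0 \<oplus>\<^bsub>alg\<^esub> cls 0 = cls 0" using cls_add[of 0 0] by simp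
  then show ?thesis by (metis A.add.l_cancel_one' Rel_0 Rel_Car cls_carrier)
qed

lemma cls_smult: "p \<in> Car \<Longrightarrow> k \<odot>\<^bsub>alg\<^esub> cls p = cls (scalar k * p)"
  using cls_mult[OF Car_scalar, of p k] by (simp add: sra_def Let_def)

lemma cls_idem: "sra_e scale \<omega> \<Gamma> t c = cls idem"
  by (simp add: sra_e_def idem_def)

lemma cls_comm: "p \<in> Car \<Longrightarrow> q \<in> Car \<Longrightarrow> cls p \<otimes>\<^bsub>alg\<^esub> cls q = cls q \<otimes>\<^bsub>alg\<^esub> cls p \<longleftrightarrow> comm p q \<in> Rel"
  by (simp add: cls_mult cls_eq_iff)

lemma centre_carrier: "carrier (centre alg) = cls ` {z. central z}"
proof -
  have c: "(\<forall>a\<in>carrier alg. cls p \<otimes>\<^bsub>alg\<^esub> a = a \<otimes>\<^bsub>alg\<^esub> cls p) \<longleftrightarrow> central p" if "p \<in> Car" for p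
    using that by (simp add: alg_carrier central_def cls_comm)
  have e: "carrier (centre alg) = {x \<in> cls ` Car. \<forall>a\<in>carrier alg. x \<otimes>\<^bsub>alg\<^esub> a = a \<otimes>\<^bsub>alg\<^esub> x}"
    unfolding centre_def alg_carrier[symmetric] by simp
  show ?thesis
  proof (intro equalityI subsetI)
    fix x assume "x \<in> carrier (centre alg)"
    then obtain p where "p \<in> Car" "x = cls p" "\<forall>a\<in>carrier alg. x \<otimes>\<^bsub>alg\<^esub> a = a \<otimes>\<^bsub>alg\<^esub> x" unfolding e by blast
    then show "x \<in> cls ` {z. central z}" using c by blast
  next
    fix x assume "x \<in> cls ` {z. central z}"
    then obtain p where p: "central p" "x = cls p" by blast
    have "\<forall>a\<in>carrier alg. x \<otimes>\<^bsub>alg\<^esub> a = a \<otimes>\<^bsub>alg\<^esub> x" unfolding p(2) c[OF central_Car[OF p(1)]] by (rule p(1))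
    then show "x \<in> carrier (centre alg)" unfolding e p(2) using central_Car[OF p(1)] by blast
  qed
qed

lemma centre_ops: "monoid.mult (centre alg) = monoid.mult alg" "add (centre alg) = add alg"
  "\<one>\<^bsub>centre alg\<^esub> = \<one>\<^bsub>alg\<^esub>" "module.smult (centre alg) = module.smult alg"
  by (simp_all add: centre_def)

lemma corner_ops: "monoid.mult (corner alg e) = monoid.mult alg" "add (corner alg e) = add alg"
  "\<one>\<^bsub>corner alg e\<^esub> = e" "module.smult (corner alg e) = module.smult alg"
  by (simp_all add: corner_def)

lemma corner_carrier: "carrier (corner alg (cls idem)) = {cls (idem * p * idem) |p. p \<in> Car}"
proof -
  have "cls idem \<otimes>\<^bsub>alg\<^esub> cls p \<otimes>\<^bsub>alg\<^esub> cls idem = cls (idem * p * idem)" if "p \<in> Car" for p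
    using that by (simp add: cls_mult)
  then show ?thesis by (force simp: corner_def alg_carrier)
qed

lemma centre_trivial:
  assumes "t \<noteq> 0"
  shows "bij_betw (\<lambda>k. k \<odot>\<^bsub>alg\<^esub> \<one>\<^bsub>alg\<^esub>) UNIV (carrier (centre alg))"
proof -
  have s: "k \<odot>\<^bsub>alg\<^esub> \<one>\<^bsub>alg\<^esub> = cls (scalar k)" for k
    using cls_smult[of 1 k] Car_scalar[of 1] by (simp add: cls_one scalar_simps)
  have "inj (\<lambda>k. cls (scalar k))"
  proof (rule injI)
    fix k l assume "cls (scalar k) = cls (scalar l)"
    then have "scalar (k - l) \<in> Rel" by (simp add: cls_eq_iff scalar_simps)
    from symbol_ideal[OF this, of 0 id 0] have "k - l = 0" unfolding symbol_scalar by simp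
    then show "k = l" by simp
  qed
  moreover have "range (\<lambda>k. cls (scalar k)) = cls ` {z. central z}"
  proof (intro equalityI subsetI)
    fix x assume "x \<in> cls ` {z. central z}"
    then obtain z where z: "central z" "x = cls z" by blast
    then obtain k where "z - scalar k \<in> Rel" using central_scalar[OF assms] by blast
    then show "x \<in> range (\<lambda>k. cls (scalar k))" using z by (auto simp: cls_eq_iff central_Car)
  qed (use central_scalar_elem in blast)
  ultimately show ?thesis unfolding s centre_carrier bij_betw_def by simp
qed

lemma centre_iso_corner:
  assumes t: "t = 0"
  shows "algebra_isomorphic (centre alg) (corner alg (cls idem))"
proof -
  interpret A: ring alg by (rule ring_alg)
  let ?e = "cls idem"
  define h where "h x = x \<otimes>\<^bsub>alg\<^esub> ?e" for x
  have h: "h (cls z) = cls (z * idem)" if "central z" for z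
    using that by (simp add: h_def cls_mult central_Car)
  have img: "cls (z * idem) \<in> carrier (corner alg ?e)" if z: "central z" for z
  proof -
    have C: "z \<in> Car" by (rule central_Car[OF z])
    have "z * idem - idem * z * idem = - (z * (idem * idem - idem)) + comm z idem * idem"
      by (simp add: algebra_simps)
    also have "\<dots> \<in> Rel"
      using C by (intro Rel_add Rel_uminus Rel_left Rel_right idem_idem central_comm z) auto
    finally have "cls (z * idem) = cls (idem * z * idem)"
      using C by (subst cls_eq_iff) auto
    then show ?thesis using C unfolding corner_carrier by blast
  qed
  have "h \<in> ring_hom (centre alg) (corner alg ?e)"
  proof (rule ring_hom_memI)
    fix x assume "x \<in> carrier (centre alg)"
    then show "h x \<in> carrier (corner alg ?e)" using h img by (auto simp: centre_carrier)
  next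
    fix x y assume "x \<in> carrier (centre alg)" "y \<in> carrier (centre alg)"
    then obtain z w where z: "central z" "x = cls z" and w: "central w" "y = cls w" by (auto simp: centre_carrier)
    have C: "z \<in> Car" "w \<in> Car" using z w central_Car by auto
    show "h (x \<oplus>\<^bsub>centre alg\<^esub> y) = h x \<oplus>\<^bsub>corner alg ?e\<^esub> h y"
      using C by (simp add: centre_ops corner_ops h_def z w A.l_distr)
    have "z * w * idem - z * idem * (w * idem) =
        - (z * (w * (idem * idem - idem))) + z * comm w idem * idem" by (simp add: algebra_simps)
    also have "\<dots> \<in> Rel" using C by (intro Rel_add Rel_uminus Rel_left Rel_right idem_idem central_comm w) auto
    finally show "h (x \<otimes>\<^bsub>centre alg\<^esub> y) = h x \<otimes>\<^bsub>corner alg ?e\<^esub> h y"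
      using C by (simp add: centre_ops corner_ops h_def z w cls_mult cls_eq_iff)
  next
    show "h \<one>\<^bsub>centre alg\<^esub> = \<one>\<^bsub>corner alg ?e\<^esub>" by (simp add: centre_ops corner_ops h_def)
  qed
  moreover have "bij_betw h (carrier (centre alg)) (carrier (corner alg ?e))"
  proof (rule bij_betw_imageI)
    show "inj_on h (carrier (centre alg))"
    proof (rule inj_onI)
      fix x y assume "x \<in> carrier (centre alg)" "y \<in> carrier (centre alg)" and e: "h x = h y"
      then obtain z w where z: "central z" "x = cls z" and w: "central w" "y = cls w" by (auto simp: centre_carrier)
      have C: "z \<in> Car" "w \<in> Car" using z w central_Car by auto
      have "central (z + scalar (-1) * w)" by (intro central_add central_mult central_scalar_elem z w)
      then have c: "central (z - w)" by (simp add: scalar_simps)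
      have "(z - w) * idem \<in> Rel" using e C by (simp add: h z w cls_eq_iff left_diff_distrib)
      from central_idem_injective[OF c this] show "x = y" using C by (simp add: z w cls_eq_iff)
    qed
    show "h ` carrier (centre alg) = carrier (corner alg ?e)"
    proof (intro equalityI subsetI)
      fix x assume "x \<in> h ` carrier (centre alg)"
      then show "x \<in> carrier (corner alg ?e)" using h img by (auto simp: centre_carrier)
    next
      fix x assume "x \<in> carrier (corner alg ?e)"
      then obtain p where p: "p \<in> Car" "x = cls (idem * p * idem)" unfolding corner_carrier by blast
      let ?b = "idem * p * idem"
      have b: "?b \<in> Car" using p by simp
      have "(idem * idem - idem) * p * (idem * idem) + idem * p * (idem * idem - idem) \<in> Rel"
        using p by (intro Rel_add Rel_left Rel_right idem_idem) auto
      then have "idem * ?b * idem - ?b \<in> Rel" by (simp add: algebra_simps)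
      from spherical_lift[OF t b this] obtain z where z: "central z" "z * idem - ?b \<in> Rel" by blast
      then have "h (cls z) = x" using p central_Car by (simp add: h cls_eq_iff)
      then show "x \<in> h ` carrier (centre alg)" using z unfolding centre_carrier by blast
    qed
  qed
  moreover have "h (k \<odot>\<^bsub>centre alg\<^esub> x) = k \<odot>\<^bsub>corner alg ?e\<^esub> h x" if "x \<in> carrier (centre alg)" for k x
  proof -
    obtain z where z: "central z" "x = cls z" using \<open>x \<in> carrier (centre alg)\<close> by (auto simp: centre_carrier)
    then show ?thesis
      using central_Car by (simp add: centre_ops corner_ops h_def cls_mult cls_smult mult.assoc)
  qed
  ultimately show ?thesis unfolding algebra_isomorphic_def ring_iso_def by blast
qed

lemma finitely_generated:
  assumes t: "t = 0"
  shows "finitely_generated_over alg (carrier (centre alg))"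
proof -
  interpret A: ring alg by (rule ring_alg)
  let ?Z = "carrier (centre alg)" and ?G = "cls ` gens"
  have fin: "finite ?G" by (intro finite_imageI finite_gens)
  have G: "?G \<subseteq> carrier alg" using gens_Car by auto
  have Z: "?Z \<subseteq> carrier alg" by (auto simp: centre_def)
  have Z0: "\<zero>\<^bsub>alg\<^esub> \<in> ?Z" unfolding cls_zero centre_carrier using central_0 by blast
  have "\<exists>z\<in>?G \<rightarrow> ?Z. cls p = (\<Oplus>\<^bsub>alg\<^esub>g\<in>?G. z g \<otimes>\<^bsub>alg\<^esub> g)" if "spanned p" for p
    using that
  proof (induction rule: spanned.induct)
    case (spanned_Rel p)
    have "(\<Oplus>\<^bsub>alg\<^esub>g\<in>?G. \<zero>\<^bsub>alg\<^esub> \<otimes>\<^bsub>alg\<^esub> g) = (\<Oplus>\<^bsub>alg\<^esub>g\<in>?G. \<zero>\<^bsub>alg\<^esub>)"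
      by (rule A.finsum_cong') (use G in auto)
    moreover have "cls p = \<zero>\<^bsub>alg\<^esub>" using spanned_Rel by (simp add: cls_zero cls_eq_iff)
    ultimately show ?case using Z0 by (intro bexI[of _ "\<lambda>_. \<zero>\<^bsub>alg\<^esub>"]) auto
  next
    case (spanned_gen z g)
    let ?z = "\<lambda>x. if cls g = x then cls z else \<zero>\<^bsub>alg\<^esub>"
    have C: "cls z \<in> carrier alg" using spanned_gen central_Car by simp
    have "(\<Oplus>\<^bsub>alg\<^esub>x\<in>?G. ?z x \<otimes>\<^bsub>alg\<^esub> x) = (\<Oplus>\<^bsub>alg\<^esub>x\<in>?G. if cls g = x then cls z \<otimes>\<^bsub>alg\<^esub> x else \<zero>\<^bsub>alg\<^esub>)"
      by (rule A.finsum_cong') (use G C in auto)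
    also have "\<dots> = cls z \<otimes>\<^bsub>alg\<^esub> cls g"
      by (rule A.finsum_singleton) (use spanned_gen G C fin in auto)
    also have "\<dots> = cls (z * g)" using spanned_gen by (simp add: cls_mult central_Car gens_Car)
    finally show ?case using spanned_gen Z0 unfolding centre_carrier by (intro bexI[of _ ?z]) auto
  next
    case (spanned_add p q)
    from spanned_add.IH(1) obtain z where z: "z \<in> ?G \<rightarrow> ?Z" "cls p = (\<Oplus>\<^bsub>alg\<^esub>g\<in>?G. z g \<otimes>\<^bsub>alg\<^esub> g)"
      by (rule bexE)
    from spanned_add.IH(2) obtain w where w: "w \<in> ?G \<rightarrow> ?Z" "cls q = (\<Oplus>\<^bsub>alg\<^esub>g\<in>?G. w g \<otimes>\<^bsub>alg\<^esub> g)"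
      by (rule bexE)
    have C: "z g \<in> carrier alg" "w g \<in> carrier alg" "g \<in> carrier alg" if "g \<in> ?G" for g
      using z(1) w(1) that Z G by blast+
    have sum: "z g \<oplus>\<^bsub>alg\<^esub> w g \<in> ?Z" if "g \<in> ?G" for g
    proof -
      have "z g \<in> ?Z" "w g \<in> ?Z" using z(1) w(1) that by blast+
      then obtain a b where "central a" "z g = cls a" "central b" "w g = cls b" unfolding centre_carrier by blast
      then show ?thesis using central_add by (simp add: centre_carrier cls_add central_Car)
    qed
    have "cls (p + q) = cls p \<oplus>\<^bsub>alg\<^esub> cls q"
      using spanned_add.hyps spanned_Car by (simp add: cls_add)
    also have "\<dots> = (\<Oplus>\<^bsub>alg\<^esub>g\<in>?G. z g \<otimes>\<^bsub>alg\<^esub> g \<oplus>\<^bsub>alg\<^esub> w g \<otimes>\<^bsub>alg\<^esub> g)"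
      unfolding z(2) w(2) by (rule A.finsum_addf[symmetric]) (use C in auto)
    also have "\<dots> = (\<Oplus>\<^bsub>alg\<^esub>g\<in>?G. (z g \<oplus>\<^bsub>alg\<^esub> w g) \<otimes>\<^bsub>alg\<^esub> g)"
      by (rule A.finsum_cong') (use C in \<open>auto simp: A.l_distr\<close>)
    finally show ?case using sum by (intro bexI[of _ "\<lambda>g. z g \<oplus>\<^bsub>alg\<^esub> w g"]) auto
  qed
  then show ?thesis unfolding finitely_generated_over_def
    using fin G spanned_all[OF t] by (intro exI[of _ ?G]) (auto simp: alg_carrier)
qed

end

theorem proposition7p2:
  fixes scale :: "complex \<Rightarrow> 'v::ab_group_add \<Rightarrow> 'v"
    and \<omega> :: "'v \<Rightarrow> 'v \<Rightarrow> complex"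
    and n :: nat
    and \<Gamma> :: "('v \<Rightarrow> 'v) set"
    and t :: complex
    and c :: "('v \<Rightarrow> 'v) \<Rightarrow> complex"
  assumes "symplectic_vector_space scale \<omega>"
    and "vector_space.dim scale (UNIV :: 'v set) = 2 * n"
    and "subgroup \<Gamma> (Sp scale \<omega>)"
    and "finite \<Gamma>"
    and "conj_invariant \<Gamma> (symplectic_reflections scale \<Gamma>) c"
  defines "A \<equiv> sra scale \<omega> \<Gamma> t c"
    and "e \<equiv> sra_e scale \<omega> \<Gamma> t c"
  shows "(t = 0 \<longrightarrow>
            algebra_isomorphic (centre A) (corner A e) \<and>
            finitely_generated_over A (carrier (centre A))) \<and>
         (t \<noteq> 0 \<longrightarrow> bij_betw (\<lambda>k. k \<odot>\<^bsub>A\<^esub> \<one>\<^bsub>A\<^esub>) UNIV (carrier (centre A)))"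
proof -
  interpret symplectic_reflection_data scale \<omega> \<Gamma> t c
    using assms(1,3,4,5) by (intro symplectic_reflection_data.intro symplectic_reflection_data_axioms.intro)
  show ?thesis
    unfolding A_def e_def cls_idem using centre_iso_corner finitely_generated centre_trivial by blast
qed

end
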